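(* For each positive integer $n$ and each integer $0\le k\le\lfloor n/2\rfloor$, \[\Sigma_{\tilde S_n}(k,q)=q^{k^2}\cdot\frac{[n]_q}{[2n-2k]_q}\cdot\binom{n-k}{k}_q\cdot(-q^{k+1};q)_{n-2k}\cdot\left(\frac{1+q}{1-q}\right)^k\cdot\frac{1+q^n}{(1+q)^n}.\]
   Context: For $n\ge2$, $\tilde S_n$ is the group of bijections $w:\mathbb Z\to\mathbb Z$ with $w(i+n)=w(i)+n$ and $\sum_{i=1}^nw(i)=\sum_{i=1}^ni$, a Coxeter group with simple generators $s_0,\dots,s_{n-1}$, $s_i$ mapping $j\mapsto j+1$ if $j\equiv i$, $j\mapsto j-1$ if $j\equiv i+1\pmod n$, fixing $j$ otherwise; $\tilde S_1$ is the trivial group. $\ell$ is length; $S=\{s_1,\dots,s_{n-1}\}$ generates the subgroup $S_n$, and $P_{S_n}(q)=\sum_{x\in S_n}q^{\ell(x)}$. $\ell'$ is the absolute length on involutions: the unique $\mathbb N$-valued function on $\{w:w^2=1\}$ with $\ell'(1)=0$, $\ell'(sws)=\ell'(w)$ for simple $s$, and $\ell'(ws)-\ell'(w)=\ell(ws)-\ell(w)$ whenever $s$ is simple and $w,ws$ are involutions. Define \[\Sigma_{\tilde S_n}(k,q)=\sum_{w}q^{\ell(w)}\frac{P_{S_n}(q^2)}{F_{K,\diamond}(q)},\] summed over involutions $w\in\tilde S_n$ with $\ell(ws)>\ell(w)$ for all $s\in S$ and $\ell'(w)=k$, where $\diamond$ is the automorphism $x\mapsto wxw$, $K=S\cap wSw$,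 $W_K=\langle K\rangle$ and $F_{K,\diamond}(q)=\sum_{x\in W_K,\ x^\diamond=x}q^{\ell(x)}$. $q$-notation: $[n]_q=\frac{1-q^n}{1-q}$, $\binom{n}{k}_q$ the $q$-binomial coefficient, $(a;q)_r=\prod_{i=0}^{r-1}(1-aq^i)$. *)

theory Defs
  imports
    "HOL-Analysis.Analysis"
    "HOL-Computational_Algebra.Formal_Power_Series"
    "HOL-Algebra.Generated_Groups"
begin

definition affine_perms :: "nat \<Rightarrow> (int \<Rightarrow> int) set" where
  "affine_perms n = {w. bij w \<and> (\<forall>i. w (i + int n) = w i + int n) \<and>
     (\<Sum>i = 1..int n. w i) = (\<Sum>i = 1..int n. i)}"

definition affine_sym :: "nat \<Rightarrow> (int \<Rightarrow> int) monoid" where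
  "affine_sym n = \<lparr>carrier = affine_perms n, mult = (\<circ>), one = id\<rparr>"

definition simple_gen :: "nat \<Rightarrow> nat \<Rightarrow> int \<Rightarrow> int" where
  "simple_gen n i j =
     (if j mod int n = int i mod int n then j + 1
      else if j mod int n = (int i + 1) mod int n then j - 1
      else j)"

text \<open>For \<open>n = 1\<close> the group \<^term>\<open>affine_sym n\<close> is trivial and there are no simple generators; the
  formula for \<^term>\<open>simple_gen n\<close> is meaningful only for \<open>n \<ge> 2\<close>.\<close>

definition simple_gens :: "nat \<Rightarrow> (int \<Rightarrow> int) set" where
  "simple_gens n = (if n \<ge> 2 then simple_gen n ` {0..<n} else {})"

definition finite_gens :: "nat \<Rightarrow> (int \<Rightarrow> int) set" where
  "finite_gens n = simple_gen n ` {1..<n}"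

definition cox_length :: "nat \<Rightarrow> (int \<Rightarrow> int) \<Rightarrow> nat" where
  "cox_length n w =
     (LEAST l. \<exists>ss. set ss \<subseteq> simple_gens n \<and> length ss = l \<and> foldr (\<circ>) ss id = w)"

text \<open>As in the defining property of the absolute length, the identity counts as an involution.\<close>

definition involutions :: "nat \<Rightarrow> (int \<Rightarrow> int) set" where
  "involutions n = {w \<in> affine_perms n. w \<circ> w = id}"

definition is_absolute_length :: "nat \<Rightarrow> ((int \<Rightarrow> int) \<Rightarrow> nat) \<Rightarrow> bool" where
  "is_absolute_length n f \<longleftrightarrow>
     f id = 0 \<and>
     (\<forall>w \<in> involutions n. \<forall>s \<in> simple_gens n. f (s \<circ> w \<circ> s) = f w) \<and>
     (\<forall>w \<in> involutions n. \<forall>s \<in> simple_gens n. w \<circ> s \<in> involutions n \<longrightarrow>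
        int (f (w \<circ> s)) - int (f w) = int (cox_length n (w \<circ> s)) - int (cox_length n w))"

text \<open>The absolute length is a function on involutions only; it is extended by \<open>0\<close> to a total
  function so that it remains unique.\<close>

definition abs_length :: "nat \<Rightarrow> (int \<Rightarrow> int) \<Rightarrow> nat" where
  "abs_length n = (THE f. is_absolute_length n f \<and> (\<forall>w. w \<notin> involutions n \<longrightarrow> f w = 0))"

definition poincare :: "nat \<Rightarrow> 'a::comm_semiring_1 \<Rightarrow> 'a" where
  "poincare n q = (\<Sum>x \<in> generate (affine_sym n) (finite_gens n). q ^ cox_length n x)"

definition twisted_gens :: "nat \<Rightarrow> (int \<Rightarrow> int) \<Rightarrow> (int \<Rightarrow> int) set" where
  "twisted_gens n w = finite_gens n \<inter> (\<lambda>s. w \<circ> s \<circ> w) ` finite_gens n"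

definition twisted_poincare :: "nat \<Rightarrow> (int \<Rightarrow> int) \<Rightarrow> 'a::comm_semiring_1 \<Rightarrow> 'a" where
  "twisted_poincare n w q =
     (\<Sum>x | x \<in> generate (affine_sym n) (twisted_gens n w) \<and> w \<circ> x \<circ> w = x. q ^ cox_length n x)"

text \<open>The sum ranges over infinitely many involutions in general; it is an infinite sum of formal
  power series in the indeterminate \<open>q\<close>, with respect to the usual topology on \<^typ>\<open>rat fps\<close>
  given by its metric. The denominators have constant coefficient \<open>1\<close>.\<close>

definition Sigma_aff :: "nat \<Rightarrow> nat \<Rightarrow> rat fps" where
  "Sigma_aff n k =
     (\<Sum>\<^sub>\<infinity>w | w \<in> involutions n \<and> (\<forall>s \<in> finite_gens n. cox_length n (w \<circ> s) > cox_length n w) \<and>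
           abs_length n w = k.
        fps_X ^ cox_length n w * (poincare n (fps_X ^ 2) / twisted_poincare n w fps_X))"

definition q_int :: "rat fps \<Rightarrow> nat \<Rightarrow> rat fps" where
  "q_int q n = (1 - q ^ n) / (1 - q)"

definition q_fact :: "rat fps \<Rightarrow> nat \<Rightarrow> rat fps" where
  "q_fact q n = (\<Prod>i = 1..n. q_int q i)"

text \<open>Only used for \<open>k \<le> n\<close>.\<close>

definition q_binomial :: "rat fps \<Rightarrow> nat \<Rightarrow> nat \<Rightarrow> rat fps" where
  "q_binomial q n k = q_fact q n / (q_fact q k * q_fact q (n - k))"

definition q_pochhammer :: "'a::comm_ring_1 \<Rightarrow> 'a \<Rightarrow> nat \<Rightarrow> 'a" where
  "q_pochhammer a q r = (\<Prod>i<r. 1 - a * q ^ i)"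

end

theory Submission
  imports Defs "HOL-Combinatorics.Permutations" "HOL-Computational_Algebra.Formal_Laurent_Series"
begin

text \<open>
  Write \<open>w i = a i + n * c i\<close> with \<open>a i\<close> in the window \<open>{1..n}\<close>. For an involution \<open>w\<close> that is
  minimal in its coset, the level function \<open>c\<close> is weakly increasing with \<open>c (n + 1 - i) = - c i\<close>,
  and it determines \<open>w\<close>: the permutation \<open>a\<close> maps the block of level \<open>m\<close> increasingly onto the
  block of level \<open>- m\<close>. All ingredients of the sum are read off from \<open>c\<close>: the absolute length is
  the number of positive levels, the length is the sum of the numbers \<open>c i - c j - 1\<close> over the pairs
  with \<open>c j < c i\<close>, and the twisted Poincare polynomial is a product of \<open>q\<close>-factorials, one with base
  \<open>q\<close> for the block of level \<open>0\<close> and one with base \<open>q\<^sup>2\<close> for each block of positive level.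

  Lowering all positive levels by one (and raising the negative ones) leaves some \<open>j \<le> k\<close> positive
  levels. This gives a recursion for the sum over the level functions bounded by \<open>M\<close>, which the closed
  form satisfies without a bound, by the \<open>q\<close>-binomial theorem. Since each step of the recursion
  contributes a positive power of \<open>q\<close>, the bounded sums agree with the closed form modulo \<open>q\<close> to
  the power \<open>M\<close>.
\<close>

section \<open>Length of affine permutations\<close>

text \<open>The summands mix base q with base q^2, and the lengths carry a negative offset.
  Multiplying by q to the power k(2n-2k-1), which is C(n,2) - C(n-2k,2), cures both: the exponent
  becomes an even number 2(h + b), with h linear in the levels and b the sum of the zero-based ranks
  inside the positive blocks. For Q = q^2 a factor common to all w splits off, and w enters only
  through Q^h and one factor Q^t/[t+1]_Q per position of rank t in a positive block. Such a weight
  changes in a controlled way when a level is removed.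

  The recursion contains the term j = k, so the unbounded sum would stand on both sides of an
  equation before its convergence is known. The bound M is what decreases at each step; the closed
  form only has to be checked to be a fixed point.

  That closed form is an identity between quotients, while power series are not a field. It is
  therefore proved over an arbitrary field, with all powers of x different from 1, and pulled back
  along the embedding into Laurent series.\<close>

lemma periodic_add_mult:
  fixes f :: "int \<Rightarrow> int"
  assumes "\<And>i. f (i + m) = f i + c"
  shows "f (i + m * t) = f i + c * t"
proof (induction t rule: int_induct[where k = 0])
  case base
  show ?case by simp
next
  case (step1 t)
  then show ?case using assms[of "i + m * t"] by (simp add: algebra_simps)
next
  case (step2 t)
  then show ?case using assms[of "i + m * (t - 1)"] by (simp add: algebra_simps)
qed

lemma mod_eqE:
  fixes i j m :: int
  assumes "i mod m = j mod m"
  obtains t where "i = j + m * t"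
  using assms by (metis mod_eq_dvd_iff dvdE diff_add_cancel add.commute)

lemma periodic_mod_eq:
  fixes g :: "int \<Rightarrow> 'a"
  assumes "\<And>i. g (i + m) = g i" and "i mod m = j mod m"
  shows "g i = g j"
proof -
  have *: "g (i + m * t) = g i" for i t
  proof (induction t rule: int_induct[where k = 0])
    case (step1 t)
    then show ?case using assms(1)[of "i + m * t"] by (simp add: algebra_simps)
  next
    case (step2 t)
    then show ?case using assms(1)[of "i + m * (t - 1)"] by (simp add: algebra_simps)
  qed simp
  obtain t where "i = j + m * t" by (rule mod_eqE[OF assms(2)])
  then show ?thesis using * by simp
qed

text \<open>Representatives are taken in {1..n} instead of {0..n-1}, to match the window over which
  affine permutations are normalised.\<close>

definition residue :: "nat \<Rightarrow> int \<Rightarrow> int" where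
  "residue n i = (i - 1) mod int n + 1"

definition level :: "nat \<Rightarrow> int \<Rightarrow> int" where
  "level n i = (i - 1) div int n"

lemma residue_level: "i = residue n i + int n * level n i"
  by (simp add: residue_def level_def)

lemma residue_range: "n > 0 \<Longrightarrow> residue n i \<in> {1..int n}"
  by (simp add: residue_def add1_zle_eq)

lemma windowE:
  assumes "n > 0"
  obtains i t where "x = i + int n * t" "i \<in> {1..int n}"
  using residue_level residue_range[OF assms] by metis

lemma residue_level_unique:
  assumes "j \<in> {1..int n}"
  shows "residue n (j + int n * t) = j" "level n (j + int n * t) = t"
proof -
  have 0: "j + int n * t - 1 = (j - 1) + int n * t" by simp
  have "0 \<le> j - 1" "j - 1 < int n" using assms by auto
  then show "residue n (j + int n * t) = j" "level n (j + int n * t) = t"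
    unfolding residue_def level_def 0 by simp_all
qed

lemma residue_id: "j \<in> {1..int n} \<Longrightarrow> residue n j = j"
  and level_id: "j \<in> {1..int n} \<Longrightarrow> level n j = 0"
  using residue_level_unique[of j n 0] by simp_all

lemma residue_shift: "residue n (i + int n) = residue n i"
proof -
  have "i + int n - 1 = i - 1 + int n" by simp
  then show ?thesis unfolding residue_def by (simp only: mod_add_self2)
qed

lemma residue_mod: "residue n i mod int n = i mod int n"
  by (metis residue_level mod_mult_self2)

lemma affine_permsD:
  assumes "w \<in> affine_perms n"
  shows "bij w" and "w (i + int n) = w i + int n"
    and "w (i + int n * t) = w i + int n * t"
    and "w i = w j \<longleftrightarrow> i = j"
proof -
  show *: "bij w" "w (i + int n) = w i + int n" for i
    using assms by (auto simp: affine_perms_def)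
  show "w (i + int n * t) = w i + int n * t"
    using periodic_add_mult[of w "int n" "int n"] *(2) by simp
  show "w i = w j \<longleftrightarrow> i = j" using *(1) by (auto simp: bij_def inj_def)
qed

text \<open>Since \<open>w\<close> commutes with translation by n, it induces an injection, hence a
  permutation, of the n residue classes. A periodic function summed over a window is a sum over
  these classes.\<close>

lemma sum_periodic_reindex:
  fixes g :: "int \<Rightarrow> 'a::comm_monoid_add"
  assumes n: "n > 0" and w: "inj w" "\<And>i. w (i + int n) = w i + int n"
    and g: "\<And>i. g (i + int n) = g i"
  shows "(\<Sum>i = 1..int n. g (w i)) = (\<Sum>i = 1..int n. g i)"
proof -
  have wt: "w (i + int n * t) = w i + int n * t" for i t
    using periodic_add_mult[of w "int n" "int n"] w(2) by simp
  have g_residue: "g (residue n i) = g i" for i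
    by (rule periodic_mod_eq[of g "int n"]) (simp_all add: g residue_mod)
  have inj: "inj_on (\<lambda>i. residue n (w i)) {1..int n}"
  proof (rule inj_onI)
    fix i j assume ij: "i \<in> {1..int n}" "j \<in> {1..int n}" "residue n (w i) = residue n (w j)"
    define t where "t = level n (w i) - level n (w j)"
    have "w i = w j + int n * t"
      using ij(3) residue_level[of "w i" n] residue_level[of "w j" n] by (simp add: t_def algebra_simps)
    then have "w i = w (j + int n * t)" by (simp add: wt)
    then have "i = j + int n * t" using w(1) by (auto simp: inj_def)
    then show "i = j" using ij residue_level_unique[of j n t] residue_id[of i n] by simp
  qed
  have im: "(\<lambda>i. residue n (w i)) ` {1..int n} = {1..int n}"
    by (rule endo_inj_surj) (use inj residue_range[OF n] in auto)
  have "(\<Sum>i = 1..int n. g i) = (\<Sum>i\<in>(\<lambda>i. residue n (w i)) ` {1..int n}. g i)"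
    by (simp only: im)
  also have "\<dots> = (\<Sum>i = 1..int n. g (residue n (w i)))"
    using inj by (simp add: sum.reindex)
  also have "\<dots> = (\<Sum>i = 1..int n. g (w i))"
    by (simp add: g_residue)
  finally show ?thesis by simp
qed

lemma sum_residue_class:
  fixes C :: "'a::comm_monoid_add"
  assumes "n > 0"
  shows "(\<Sum>i = 1..int n. if i mod int n = r mod int n then C else 0) = C"
proof -
  have "(i mod int n = r mod int n) \<longleftrightarrow> i = residue n r" if "i \<in> {1..int n}" for i
  proof
    assume "i mod int n = r mod int n"
    then have "residue n i = residue n r"
      using periodic_mod_eq[of "residue n" "int n" i r] by (simp add: residue_shift)
    then show "i = residue n r" using residue_id[OF that] by simp
  qed (simp add: residue_mod)
  then have "(\<Sum>i = 1..int n. if i mod int n = r mod int n then C else 0)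
      = (\<Sum>i = 1..int n. if i = residue n r then C else 0)"
    by (intro sum.cong) auto
  also have "\<dots> = C" using residue_range[OF assms, of r] by (simp add: sum.delta)
  finally show ?thesis .
qed

text \<open>The displacement of \<open>u \<circ> w\<close> at i is that of \<open>u\<close> at
  \<open>w i\<close> plus that of \<open>w\<close> at i. Displacements are periodic, so the first
  part can be reindexed and both totals vanish.\<close>

lemma affine_perms_comp:
  assumes n: "n > 0" and u: "u \<in> affine_perms n" and w: "w \<in> affine_perms n"
  shows "u \<circ> w \<in> affine_perms n"
proof -
  note uD = affine_permsD[OF u] and wD = affine_permsD[OF w]
  have "(\<Sum>i = 1..int n. u (w i) - i) = (\<Sum>i = 1..int n. (u (w i) - w i) + (w i - i))"
    by simp
  also have "\<dots> = (\<Sum>i = 1..int n. u (w i) - w i) + (\<Sum>i = 1..int n. w i - i)"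
    by (rule sum.distrib)
  also have "(\<Sum>i = 1..int n. u (w i) - w i) = (\<Sum>i = 1..int n. u i - i)"
    by (rule sum_periodic_reindex[OF n, of w "\<lambda>i. u i - i"]) (use uD wD in \<open>auto simp: bij_def\<close>)
  finally have "(\<Sum>i = 1..int n. u (w i) - i) = 0"
    using u w by (simp add: affine_perms_def sum_subtractf)
  moreover have "bij (u \<circ> w)" using uD(1) wD(1) by (simp add: bij_comp)
  ultimately show ?thesis using uD(2) wD(2) by (simp add: affine_perms_def sum_subtractf)
qed

lemma id_affine_perms: "id \<in> affine_perms n"
  by (simp add: affine_perms_def)

text \<open>The sum condition is automatic: reindexing by \<open>w\<close> turns the total
  displacement into its negative.\<close>

lemma affine_permsI_involution:
  assumes n: "n > 0" and w: "w \<circ> w = id" "\<And>i. w (i + int n) = w i + int n"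
  shows "w \<in> affine_perms n"
proof -
  have bij: "bij w" using w(1) by (rule o_bij) (rule w(1))
  have ww: "w (w i) = i" for i using w(1) by (metis comp_apply id_apply)
  have "(\<Sum>i = 1..int n. w (w i) - w i) = (\<Sum>i = 1..int n. w i - i)"
    by (rule sum_periodic_reindex[OF n, of w "\<lambda>i. w i - i"]) (use bij w in \<open>auto simp: bij_def\<close>)
  then have "(\<Sum>i = 1..int n. w i) = (\<Sum>i = 1..int n. i)"
    by (simp add: ww sum_subtractf)
  then show ?thesis using bij w(2) by (simp add: affine_perms_def)
qed

section \<open>Simple reflections as permutations of the integers\<close>

lemma simple_gen_simps:
  assumes "n \<ge> 2"
  shows "j mod int n = int r mod int n \<Longrightarrow> simple_gen n r j = j + 1"
    and "j mod int n = (int r + 1) mod int n \<Longrightarrow> simple_gen n r j = j - 1"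
    and "j mod int n \<noteq> int r mod int n \<Longrightarrow> j mod int n \<noteq> (int r + 1) mod int n \<Longrightarrow> simple_gen n r j = j"
proof -
  have "(int r + 1) mod int n \<noteq> int r mod int n"
  proof
    assume "(int r + 1) mod int n = int r mod int n"
    then have "int n dvd 1" by (simp add: mod_eq_dvd_iff)
    then show False using assms by simp
  qed
  then show "j mod int n = (int r + 1) mod int n \<Longrightarrow> simple_gen n r j = j - 1"
    by (simp add: simple_gen_def)
qed (simp_all add: simple_gen_def)

lemma mod_succ_iff: "(j + 1) mod m = (r + 1) mod m \<longleftrightarrow> j mod m = r mod (m::int)"
  by (simp add: mod_eq_dvd_iff)

lemma mod_pred_iff: "(j - 1) mod m = r mod m \<longleftrightarrow> j mod m = (r + 1) mod (m::int)"
  using mod_succ_iff[of "j - 1" m r] by simp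

lemma simple_gen_invol:
  assumes "n \<ge> 2"
  shows "simple_gen n r (simple_gen n r j) = j"
proof -
  note s = simple_gen_simps[OF assms]
  consider "j mod int n = int r mod int n" | "j mod int n = (int r + 1) mod int n"
    | "j mod int n \<noteq> int r mod int n" "j mod int n \<noteq> (int r + 1) mod int n" by blast
  then show ?thesis
    by cases (simp_all add: s mod_succ_iff mod_pred_iff)
qed

lemma simple_gen_shift: "simple_gen n r (j + int n) = simple_gen n r j + int n"
  by (simp add: simple_gen_def)

lemma simple_gen_comp_self: "n \<ge> 2 \<Longrightarrow> simple_gen n r \<circ> simple_gen n r = id"
  by (simp add: fun_eq_iff simple_gen_invol)

lemma simple_gen_affine_perms: "n \<ge> 2 \<Longrightarrow> simple_gen n r \<in> affine_perms n"
  by (rule affine_permsI_involution) (auto simp: simple_gen_comp_self simple_gen_shift)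

text \<open>A simple reflection moves every point by at most one, so it can reverse only the
  neighbours that it exchanges.\<close>

lemma simple_gen_less_iff:
  assumes n: "n \<ge> 2"
  shows "simple_gen n r i < simple_gen n r j \<longleftrightarrow>
    (if i mod int n = int r mod int n \<and> j = i + 1 then False
     else if j mod int n = int r mod int n \<and> i = j + 1 then True else i < j)"
proof -
  define P where "P k \<longleftrightarrow> k mod int n = int r mod int n" for k
  have ne: "\<not> (P k \<and> P (k + 1))" for k
  proof
    assume "P k \<and> P (k + 1)"
    then have "(k + 1) mod int n = k mod int n" by (simp add: P_def)
    then have "int n dvd 1" by (simp add: mod_eq_dvd_iff)
    then show False using n by simp
  qed
  have s: "simple_gen n r k = (if P k then k + 1 else if P (k - 1) then k - 1 else k)" for k
    using simple_gen_simps[OF n, of k r] by (auto simp: P_def mod_pred_iff)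
  have ne': "\<not> (P (k - 1) \<and> P k)" for k using ne[of "k - 1"] by simp
  show ?thesis unfolding s P_def[symmetric]
  proof -
    \<comment> \<open>Points at distance two could only collide if two consecutive integers were
      both congruent to r, which \<open>ne\<close> excludes for n at least 2; beyond distance two
      nothing can happen.\<close>
    consider "i = j" | "j = i + 1" | "i = j + 1" | "j = i + 2" | "i = j + 2" | "i + 2 < j" | "j + 2 < i"
      by linarith
    then show "((if P i then i + 1 else if P (i - 1) then i - 1 else i)
        < (if P j then j + 1 else if P (j - 1) then j - 1 else j)) =
      (if P i \<and> j = i + 1 then False else if P j \<and> i = j + 1 then True else i < j)"
    proof cases
      case 2
      have "j - 1 = i" using 2 by simp
      then show ?thesis using 2 ne[of i] ne'[of i] by (cases "P i"; cases "P (i - 1)"; cases "P j"; simp)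
    next
      case 3
      have "i - 1 = j" using 3 by simp
      then show ?thesis using 3 ne[of j] ne'[of j] by (cases "P j"; cases "P (j - 1)"; cases "P i"; simp)
    next
      case 4
      have "j - 1 = i + 1" using 4 by simp
      then have "\<not> (P i \<and> P (j - 1))" using ne[of i] by metis
      then show ?thesis using 4
        by (cases "P i"; cases "P (i - 1)"; cases "P j"; cases "P (j - 1)"; simp)
    next
      case 5
      have "i - 1 = j + 1" using 5 by simp
      then have "\<not> (P j \<and> P (i - 1))" using ne[of j] by metis
      then show ?thesis using 5
        by (cases "P i"; cases "P (i - 1)"; cases "P j"; cases "P (j - 1)"; simp)
    next
      case 6
      then show ?thesis by (cases "P i"; cases "P (i - 1)"; cases "P j"; cases "P (j - 1)"; simp)
    next
      case 7
      then show ?thesis by (cases "P i"; cases "P (i - 1)"; cases "P j"; cases "P (j - 1)"; simp)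
    qed simp
  qed
qed

text \<open>Affine inversions up to simultaneous translation by n: the left index is normalised to
  the window, the right index runs over all integers.\<close>

definition inv_number :: "nat \<Rightarrow> (int \<Rightarrow> int) \<Rightarrow> nat" where
  "inv_number n w = (\<Sum>i = 1..int n. card {j. i < j \<and> w j < w i})"

lemma affine_perms_bounded_displacement:
  assumes "n > 0" and w: "w \<in> affine_perms n"
  obtains B where "\<And>j. \<bar>w j - j\<bar> \<le> B"
proof
  fix j
  have "w j - j = w (residue n j) - residue n j"
    by (rule periodic_mod_eq[of "\<lambda>j. w j - j" "int n"])
      (auto simp: affine_permsD[OF w] residue_mod)
  then show "\<bar>w j - j\<bar> \<le> Max ((\<lambda>j. \<bar>w j - j\<bar>) ` {1..int n})"
    using residue_range[OF assms(1), of j] by simp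
qed

text \<open>Displacements are bounded because they are periodic. Finiteness matters since
  \<open>card\<close> is 0 on infinite sets.\<close>

lemma finite_inversions_at:
  assumes "n > 0" and "w \<in> affine_perms n"
  shows "finite {j. i < j \<and> w j < w i}"
proof -
  obtain B where B: "\<And>j. \<bar>w j - j\<bar> \<le> B" using affine_perms_bounded_displacement[OF assms] by blast
  have "{j. i < j \<and> w j < w i} \<subseteq> {i..w i + B}"
  proof
    fix j assume "j \<in> {j. i < j \<and> w j < w i}"
    then show "j \<in> {i..w i + B}" using B[of j] by auto
  qed
  then show ?thesis by (rule finite_subset) simp
qed

lemma card_inversions_periodic:
  assumes w: "w \<in> affine_perms n"
  shows "card {j. i + int n < j \<and> w j < w (i + int n)} = card {j. i < j \<and> w j < w i}"
proof -
  have "{j. i + int n < j \<and> w j < w (i + int n)} = (\<lambda>j. j + int n) ` {j. i < j \<and> w j < w i}"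
  proof (rule Set.set_eqI)
    fix j
    have "w j = w (j - int n) + int n" using affine_permsD(2)[OF w, of "j - int n"] by simp
    then show "j \<in> {j. i + int n < j \<and> w j < w (i + int n)} \<longleftrightarrow>
        j \<in> (\<lambda>j. j + int n) ` {j. i < j \<and> w j < w i}"
      by (auto simp: affine_permsD(2)[OF w] image_iff intro!: exI[of _ "j - int n"])
  qed
  then show ?thesis by (simp add: card_image)
qed

lemma affine_perms_descent_iff:
  assumes w: "w \<in> affine_perms n" and "i mod int n = r mod int n"
  shows "w i < w (i + 1) \<longleftrightarrow> w r < w (r + 1)"
proof -
  have shift: "w (i + int n + 1) = w (i + 1) + int n" for i
    using affine_permsD(2)[OF w, of "i + 1"] by (simp add: algebra_simps)
  have "w (i + 1) - w i = w (r + 1) - w r"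
    by (rule periodic_mod_eq[of "\<lambda>i. w (i + 1) - w i" "int n"])
      (simp_all add: affine_permsD(2)[OF w] shift assms(2))
  then show ?thesis by linarith
qed

text \<open>Up to translation only the pair (r, r+1) changes its status. The rows of
  \<open>w \<circ> s\<close> are reindexed by \<open>s\<close>, so that each row can be compared
  with a single row of \<open>w\<close>.\<close>

lemma inv_number_comp_simple_gen:
  assumes n: "n \<ge> 2" and w: "w \<in> affine_perms n"
  shows "int (inv_number n (w \<circ> simple_gen n r)) =
    int (inv_number n w) + (if w (int r) < w (int r + 1) then 1 else - 1)"
proof -
  define s where "s = simple_gen n r"
  note s_simps = simple_gen_simps[OF n, of _ r, folded s_def]
  have ss: "s (s j) = j" for j by (simp add: s_def simple_gen_invol[OF n])
  have s_aff: "s \<in> affine_perms n" by (simp add: s_def simple_gen_affine_perms[OF n])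
  have n0: "n > 0" using n by simp
  define R where "R i \<longleftrightarrow> i mod int n = int r mod int n" for i
  have R1: "R (i - 1) \<longleftrightarrow> i mod int n = (int r + 1) mod int n" for i
    by (simp add: R_def mod_pred_iff)
  have notboth: "\<not> (R i \<and> R (i - 1))" for i
    using s_simps(1,2)[of i] by (auto simp: R_def mod_pred_iff)
  have less: "s i < s j \<longleftrightarrow>
      (if R i \<and> j = i + 1 then False else if R j \<and> i = j + 1 then True else i < j)" for i j
    unfolding s_def R_def by (rule simple_gen_less_iff[OF n])
  define C where "C = (w (int r) < w (int r + 1))"
  \<comment> \<open>After substituting \<open>s j\<close> for j, the two rows differ at most in a
    neighbour of i: a row in class r+1 gains i-1 at an ascent, and a row in class r loses i+1 at a
    descent.\<close>
  have step: "int (card {j. s i < j \<and> (w \<circ> s) j < (w \<circ> s) (s i)}) = int (card {j. i < j \<and> w j < w i})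
      + (if R (i - 1) then of_bool C else 0) - (if R i then of_bool (\<not> C) else 0)" for i
  proof -
    let ?A = "{j. i < j \<and> w j < w i}"
    have fin: "finite ?A" by (rule finite_inversions_at[OF n0 w])
    have "{j. s i < j \<and> (w \<circ> s) j < (w \<circ> s) (s i)} = s ` {j. s i < s j \<and> w j < w i}"
      by (auto simp: ss image_iff intro!: exI[of _ "s _"])
    moreover have "inj s" using affine_permsD(1)[OF s_aff] by (simp add: bij_def)
    ultimately have c: "card {j. s i < j \<and> (w \<circ> s) j < (w \<circ> s) (s i)} = card {j. s i < s j \<and> w j < w i}"
      by (simp add: card_image inj_on_def)
    consider "R i" | "R (i - 1)" | "\<not> R i" "\<not> R (i - 1)" by blast
    then show ?thesis
    proof cases
      case 1
      have e: "{j. s i < s j \<and> w j < w i} = ?A - {i + 1}"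
        using 1 notboth[of i] unfolding less by auto
      have "w i < w (i + 1) \<longleftrightarrow> C" unfolding C_def
        using affine_perms_descent_iff[OF w, of i "int r"] 1 by (simp add: R_def)
      then have "i + 1 \<in> ?A \<longleftrightarrow> \<not> C" using affine_permsD(4)[OF w, of i "i+1"] by auto
      then show ?thesis using 1 notboth[of i] fin card_Suc_Diff1[OF fin, of "i + 1"]
        unfolding c e by auto
    next
      case 2
      have "(i - 1) mod int n = int r mod int n" using 2 by (simp add: R_def)
      then have d: "w (i - 1) < w i \<longleftrightarrow> C" unfolding C_def
        using affine_perms_descent_iff[OF w, of "i - 1" "int r"] by simp
      have e: "{j. s i < s j \<and> w j < w i} = (if C then insert (i - 1) ?A else ?A)"
        using 2 notboth[of i] d unfolding less by auto
      show ?thesis using 2 notboth[of i] fin unfolding c e by auto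
    next
      case 3
      have "{j. s i < s j \<and> w j < w i} = ?A"
        using 3 unfolding less by auto
      then show ?thesis using 3 unfolding c by simp
    qed
  qed
  have ws: "w \<circ> s \<in> affine_perms n" by (rule affine_perms_comp[OF n0 w s_aff])
  have "inv_number n (w \<circ> s) = (\<Sum>i = 1..int n. card {j. s i < j \<and> (w \<circ> s) j < (w \<circ> s) (s i)})"
    unfolding inv_number_def
    by (rule sum_periodic_reindex[OF n0, of s "\<lambda>i. card {j. i < j \<and> (w \<circ> s) j < (w \<circ> s) i}", symmetric])
      (use affine_permsD[OF s_aff] card_inversions_periodic[OF ws] in \<open>auto simp: bij_def\<close>)
  then have "int (inv_number n (w \<circ> s)) = int (inv_number n w)
     + (\<Sum>i = 1..int n. if R (i - 1) then of_bool C else 0) - (\<Sum>i = 1..int n. if R i then of_bool (\<not> C) else 0)"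
    by (simp only: of_nat_sum step sum.distrib sum_subtractf inv_number_def)
  then show ?thesis
    unfolding R1 unfolding R_def sum_residue_class[OF n0] s_def C_def by simp
qed

text \<open>An increasing bijection of the integers is a translation, and the normalised sum leaves
  only the translation by 0.\<close>

lemma affine_perm_id_if_ascending:
  assumes n: "n > 0" and w: "w \<in> affine_perms n" and asc: "\<And>r. r < n \<Longrightarrow> w (int r) < w (int r + 1)"
  shows "w = id"
proof -
  have asc': "w i < w (i + 1)" for i
  proof -
    have "0 \<le> i mod int n" "i mod int n < int n" using n by simp_all
    then obtain r where r: "i mod int n = int r" "r < n"
      by (metis nonneg_int_cases of_nat_less_iff)
    have "i mod int n = int r mod int n" using r by simp
    then show ?thesis using affine_perms_descent_iff[OF w, of i "int r"] asc[OF r(2)] by blast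
  qed
  have mono: "w i < w j" if "i < j" for i j
    using that by (induction j rule: int_gr_induct) (use asc' in \<open>auto intro: less_trans\<close>)
  \<comment> \<open>A skipped value would have its preimage strictly between i and i+1.\<close>
  have succ: "w (i + 1) = w i + 1" for i
  proof (rule ccontr)
    assume "w (i + 1) \<noteq> w i + 1"
    then have lt: "w i < w i + 1" "w i + 1 < w (i + 1)" using asc'[of i] by auto
    obtain j where j: "w j = w i + 1" using affine_permsD(1)[OF w] by (metis bij_pointE)
    have "i < j" "j < i + 1" using lt j mono by (metis linorder_neqE_linordered_idom order_less_asym)+
    then show False by simp
  qed
  define c where "c = w 0"
  have wi: "w i = i + c" for i
    using periodic_add_mult[of w 1 1 0 i] succ by (simp add: c_def)
  have "(\<Sum>i = 1..int n. w i - i) = 0" using w by (simp add: affine_perms_def sum_subtractf)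
  then have "c = 0" using n by (simp add: wi)
  then show ?thesis using wi by (simp add: fun_eq_iff)
qed

lemma exists_descent:
  assumes n: "n > 0" and w: "w \<in> affine_perms n" "w \<noteq> id"
  obtains r where "n \<ge> 2" "r < n" "w (int r + 1) < w (int r)"
proof -
  obtain r where r: "r < n" "\<not> w (int r) < w (int r + 1)"
    using affine_perm_id_if_ascending[OF n w(1)] w(2) by blast
  then have d: "w (int r + 1) < w (int r)"
    using affine_permsD(4)[OF w(1), of "int r" "int r + 1"] by linarith
  have "n \<noteq> 1" using d affine_permsD(2)[OF w(1), of "int r"] by auto
  then show ?thesis using that r d n by simp
qed

lemma inv_number_id: "inv_number n id = 0"
  by (simp add: inv_number_def)

section \<open>Words in the simple generators and the Coxeter length\<close>

lemma foldr_comp_append: "foldr (\<circ>) (ss @ [s]) id = foldr (\<circ>) ss id \<circ> s"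
  by (induction ss) (simp_all add: comp_assoc)

lemma simple_gensE:
  assumes "s \<in> simple_gens n"
  obtains r where "n \<ge> 2" "r < n" "s = simple_gen n r"
  using assms by (auto simp: simple_gens_def split: if_splits)

lemma simple_gensI: "n \<ge> 2 \<Longrightarrow> r < n \<Longrightarrow> simple_gen n r \<in> simple_gens n"
  by (auto simp: simple_gens_def)

lemma simple_gens_word:
  assumes n: "n > 0" and "set ss \<subseteq> simple_gens n"
  shows "foldr (\<circ>) ss id \<in> affine_perms n \<and> inv_number n (foldr (\<circ>) ss id) \<le> length ss"
  using assms(2)
proof (induction ss rule: rev_induct)
  case Nil
  then show ?case using id_affine_perms[of n] inv_number_id[of n] by (simp add: id_def)
next
  case (snoc s ss)
  define w where "w = foldr (\<circ>) ss id"
  from snoc have IH: "w \<in> affine_perms n" "inv_number n w \<le> length ss" unfolding w_def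
    by (metis le_sup_iff set_append)+
  from snoc.prems have "s \<in> simple_gens n" by simp
  then obtain r where r: "n \<ge> 2" "s = simple_gen n r" by (rule simple_gensE)
  have "inv_number n (w \<circ> s) \<le> inv_number n w + 1"
    using inv_number_comp_simple_gen[OF r(1) IH(1), of r] r(2) by (auto split: if_splits)
  then have "inv_number n (w \<circ> s) \<le> length (ss @ [s])" using IH(2) by simp
  moreover have "w \<circ> s \<in> affine_perms n"
    unfolding r(2) by (rule affine_perms_comp[OF n IH(1) simple_gen_affine_perms[OF r(1)]])
  ultimately show ?case unfolding foldr_comp_append w_def[symmetric] by blast
qed

lemma simple_gens_comp_self: "s \<in> simple_gens n \<Longrightarrow> s \<circ> s = id"
  by (auto elim!: simple_gensE simp: simple_gen_comp_self)

lemma simple_gens_word_rev: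
  assumes "set ss \<subseteq> simple_gens n"
  shows "foldr (\<circ>) (rev ss) id (foldr (\<circ>) ss id i) = i"
  using assms
proof (induction ss arbitrary: i)
  case (Cons s ss)
  have "s \<in> simple_gens n" using Cons.prems by simp
  from simple_gens_comp_self[OF this] have "s (s j) = j" for j by (metis comp_apply id_apply)
  moreover have "set ss \<subseteq> simple_gens n" using Cons.prems by simp
  moreover have "foldr (\<circ>) (rev (s # ss)) id (foldr (\<circ>) (s # ss) id i)
      = foldr (\<circ>) (rev ss) id (s (s (foldr (\<circ>) ss id i)))"
    unfolding rev.simps foldr_comp_append by (simp only: foldr.simps comp_apply)
  ultimately show ?case using Cons.IH by (simp only:)
qed simp

lemma exists_word:
  assumes n: "n > 0" and "w \<in> affine_perms n"
  shows "\<exists>ss. set ss \<subseteq> simple_gens n \<and> length ss = inv_number n w \<and> foldr (\<circ>) ss id = w"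
  using assms(2)
proof (induction "inv_number n w" arbitrary: w rule: less_induct)
  case less
  show ?case
  proof (cases "w = id")
    case True
    then show ?thesis by (intro exI[of _ "[]"]) (simp add: inv_number_id)
  next
    case False
    then obtain r where r: "n \<ge> 2" "r < n" "w (int r + 1) < w (int r)"
      using exists_descent[OF n less.prems] by blast
    let ?s = "simple_gen n r"
    have L: "inv_number n w = inv_number n (w \<circ> ?s) + 1"
      using inv_number_comp_simple_gen[OF r(1) less.prems, of r] r(3) by simp
    have aff: "w \<circ> ?s \<in> affine_perms n"
      by (rule affine_perms_comp[OF n less.prems simple_gen_affine_perms[OF r(1)]])
    have "inv_number n (w \<circ> ?s) < inv_number n w" using L by linarith
    then obtain ss where ss: "set ss \<subseteq> simple_gens n"
      "length ss = inv_number n (w \<circ> ?s)" "foldr (\<circ>) ss id = w \<circ> ?s"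
      using less.hyps aff by blast
    have "foldr (\<circ>) (ss @ [?s]) id = w"
      unfolding foldr_comp_append ss(3) by (simp add: comp_assoc simple_gen_comp_self[OF r(1)])
    moreover have "set (ss @ [?s]) \<subseteq> simple_gens n" using ss(1) simple_gensI[OF r(1,2)] by simp
    moreover have "length (ss @ [?s]) = inv_number n w" using ss(2) L by simp
    ultimately show ?thesis by blast
  qed
qed

text \<open>A shortest word for \<open>v\<close>, read backwards, spells its inverse; no bijection
  between inversion sets is required. This later compares \<open>s \<circ> w\<close> with
  \<open>w \<circ> s\<close>.\<close>

lemma inv_number_inverse_le:
  assumes n: "n > 0" and v: "v \<in> affine_perms n" and uv: "\<And>i. v (u i) = i"
  shows "inv_number n u \<le> inv_number n v"
proof -
  obtain ss where ss: "set ss \<subseteq> simple_gens n" "length ss = inv_number n v" "foldr (\<circ>) ss id = v"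
    using exists_word[OF n v] by blast
  have "foldr (\<circ>) (rev ss) id = u"
  proof
    fix i show "foldr (\<circ>) (rev ss) id i = u i"
      using simple_gens_word_rev[OF ss(1), of "u i"] by (simp only: ss(3) uv)
  qed
  moreover have "set (rev ss) \<subseteq> simple_gens n" using ss(1) by simp
  ultimately show ?thesis using simple_gens_word[OF n, of "rev ss"] ss(2) by simp
qed

text \<open>Sorting along descents gives a word of exactly this length, and no word can be shorter
  because each generator raises the inversion number by at most one.\<close>

lemma cox_length_eq_inv_number:
  assumes n: "n > 0" and w: "w \<in> affine_perms n"
  shows "cox_length n w = inv_number n w"
  unfolding cox_length_def
proof (rule Least_equality)
  show "\<exists>ss. set ss \<subseteq> simple_gens n \<and> length ss = inv_number n w \<and> foldr (\<circ>) ss id = w"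
    by (rule exists_word[OF n w])
  show "inv_number n w \<le> l"
    if "\<exists>ss. set ss \<subseteq> simple_gens n \<and> length ss = l \<and> foldr (\<circ>) ss id = w" for l
    using that simple_gens_word[OF n] by blast
qed

lemma cox_length_comp_simple_gen:
  assumes n: "n \<ge> 2" and w: "w \<in> affine_perms n"
  shows "int (cox_length n (w \<circ> simple_gen n r)) =
    int (cox_length n w) + (if w (int r) < w (int r + 1) then 1 else - 1)"
proof -
  have n0: "n > 0" using n by simp
  show ?thesis
    unfolding cox_length_eq_inv_number[OF n0 w] inv_number_comp_simple_gen[OF n w, symmetric]
    by (subst cox_length_eq_inv_number[OF n0])
      (simp_all add: affine_perms_comp[OF n0 w simple_gen_affine_perms[OF n]])
qed

section \<open>Absolute length of involutions\<close>

lemma involutionsD: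
  assumes "w \<in> involutions n"
  shows "w \<in> affine_perms n" "w (w i) = i"
  using assms by (auto simp: involutions_def fun_eq_iff)

text \<open>Counts moved residue classes; half of it turns out to be the absolute length.\<close>

definition moved_count :: "nat \<Rightarrow> (int \<Rightarrow> int) \<Rightarrow> nat" where
  "moved_count n w = (\<Sum>i = 1..int n. of_bool (w i \<noteq> i))"

lemma moved_count_conj:
  assumes n: "n \<ge> 2" and w: "w \<in> affine_perms n"
  shows "moved_count n (simple_gen n r \<circ> w \<circ> simple_gen n r) = moved_count n w"
proof -
  let ?s = "simple_gen n r"
  have n0: "n > 0" using n by simp
  note sD = affine_permsD[OF simple_gen_affine_perms[OF n, of r]]
  have "(?s \<circ> w \<circ> ?s) i \<noteq> i \<longleftrightarrow> w (?s i) \<noteq> ?s i" for i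
    using sD(4)[of "w (?s i)" "?s i"] by (simp add: simple_gen_invol[OF n])
  then have "moved_count n (?s \<circ> w \<circ> ?s) = (\<Sum>i = 1..int n. of_bool (w (?s i) \<noteq> ?s i))"
    by (simp add: moved_count_def)
  also have "\<dots> = moved_count n w" unfolding moved_count_def
    by (rule sum_periodic_reindex[OF n0, of ?s "\<lambda>i. of_bool (w i \<noteq> i)"])
      (use sD affine_permsD(2)[OF w] in \<open>simp_all add: bij_def\<close>)
  finally show ?thesis .
qed

lemma moved_count_comp_fixing:
  assumes n: "n \<ge> 2" and w: "w \<in> affine_perms n" and fixed: "w (int r) = int r" "w (int r + 1) = int r + 1"
  shows "moved_count n (w \<circ> simple_gen n r) = moved_count n w + 2"
proof -
  let ?s = "simple_gen n r"
  note s = simple_gen_simps[OF n, of _ r]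
  have n0: "n > 0" using n by simp
  have disp: "w i - i = w j - j" if "i mod int n = j mod int n" for i j
    by (rule periodic_mod_eq[of "\<lambda>j. w j - j" "int n"]) (simp_all add: affine_permsD(2)[OF w] that)
  have step: "(of_bool ((w \<circ> ?s) i \<noteq> i) :: nat) = of_bool (w i \<noteq> i)
     + (if i mod int n = int r mod int n then 1 else 0)
     + (if i mod int n = (int r + 1) mod int n then 1 else 0)" for i
  proof -
    consider "i mod int n = int r mod int n" | "i mod int n = (int r + 1) mod int n"
      | "i mod int n \<noteq> int r mod int n" "i mod int n \<noteq> (int r + 1) mod int n" by blast
    then show ?thesis
    proof cases
      case 1
      have ne: "i mod int n \<noteq> (int r + 1) mod int n" using s(1,2)[of i] 1 by auto
      have "w i = i" "w (i + 1) = i + 1"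
        using disp[of i "int r"] disp[of "i + 1" "int r + 1"] 1 fixed by (simp_all add: mod_succ_iff)
      then show ?thesis using s(1)[OF 1] 1 ne by simp
    next
      case 2
      have ne: "i mod int n \<noteq> int r mod int n" using s(1,2)[of i] 2 by auto
      have "w i = i" "w (i - 1) = i - 1"
        using disp[of i "int r + 1"] disp[of "i - 1" "int r"] 2 fixed by (simp_all add: mod_pred_iff)
      then show ?thesis using s(2)[OF 2] 2 ne by simp
    next
      case 3
      then show ?thesis using s(3)[OF 3] by simp
    qed
  qed
  show ?thesis
    unfolding moved_count_def step sum.distrib sum_residue_class[OF n0] by simp
qed

text \<open>If an involution commutes with a simple reflection \<open>s\<close>, it permutes the pair exchanged
  by \<open>s\<close> without translation, since it has order two.\<close>

lemma involution_comp_cases: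
  assumes n: "n \<ge> 2" and w: "w \<in> involutions n" and ws: "w \<circ> simple_gen n r \<in> involutions n"
  shows "(w (int r) = int r \<and> w (int r + 1) = int r + 1) \<or>
    (w (int r) = int r + 1 \<and> w (int r + 1) = int r)"
proof -
  let ?s = "simple_gen n r"
  note s = simple_gen_simps[OF n, of _ r]
  note wD = affine_permsD[OF involutionsD(1)[OF w]] and ww = involutionsD(2)[OF w]
  have sr: "?s (int r) = int r + 1" by (rule s(1)) simp
  have "w (?s (w (?s (int r)))) = int r" using involutionsD(2)[OF ws, of "int r"] by simp
  then have swr: "?s (w (int r + 1)) = w (int r)" by (metis sr ww)
  have "?s (w (int r + 1)) \<noteq> w (int r + 1)" using swr wD(4)[of "int r" "int r + 1"] by simp
  then consider "w (int r + 1) mod int n = int r mod int n"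
    | "w (int r + 1) mod int n = (int r + 1) mod int n" using s(3) by blast
  then show ?thesis
  proof cases
    case 1
    then obtain t where t: "w (int r + 1) = int r + int n * t" by (rule mod_eqE)
    have "w (int r) = w (int r + 1) + 1" using swr s(1)[OF 1] by simp
    then have "w (int r) = int r + 1 + int n * t" using t by simp
    then have "w (w (int r + 1)) = int r + 1 + int n * t + int n * t" using wD(3)[of "int r" t] t by simp
    then have "int n * t = 0" unfolding ww by linarith
    then show ?thesis using t \<open>w (int r) = int r + 1 + int n * t\<close> by simp
  next
    case 2
    then obtain t where t: "w (int r + 1) = (int r + 1) + int n * t" by (rule mod_eqE)
    have "w (w (int r + 1)) = w (int r + 1) + int n * t" using wD(3)[of "int r + 1" t] t by simp
    then have "int n * t = 0" using t unfolding ww by linarith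
    moreover have "w (int r) = w (int r + 1) - 1" using swr s(2)[OF 2] by simp
    ultimately show ?thesis using t by simp
  qed
qed

lemma involutions_conj:
  assumes n: "n \<ge> 2" and w: "w \<in> involutions n"
  shows "simple_gen n r \<circ> w \<circ> simple_gen n r \<in> involutions n"
proof -
  have n0: "n > 0" using n by simp
  have s: "simple_gen n r \<in> affine_perms n" by (rule simple_gen_affine_perms[OF n])
  have "(simple_gen n r \<circ> w \<circ> simple_gen n r) \<circ> (simple_gen n r \<circ> w \<circ> simple_gen n r) = id"
    by (simp add: fun_eq_iff simple_gen_invol[OF n] involutionsD[OF w])
  moreover have "simple_gen n r \<circ> w \<circ> simple_gen n r \<in> affine_perms n"
    using affine_perms_comp[OF n0 affine_perms_comp[OF n0 s involutionsD(1)[OF w]] s] .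
  ultimately show ?thesis by (simp add: involutions_def)
qed

text \<open>When \<open>w\<close> and \<open>w \<circ> s\<close> are both involutions,
  \<open>w\<close> fixes or exchanges r and r+1. Multiplication by \<open>s\<close> then changes the
  moved classes by two and the length by one, with the same sign.\<close>

lemma moved_count_is_absolute_length:
  assumes n: "n > 0"
  shows "is_absolute_length n (\<lambda>w. if w \<in> involutions n then moved_count n w div 2 else 0)"
    (is "is_absolute_length n ?f")
  unfolding is_absolute_length_def
proof (intro conjI ballI impI)
  show "?f id = 0" by (simp add: moved_count_def)
next
  fix w s assume w: "w \<in> involutions n" and "s \<in> simple_gens n"
  then obtain r where r: "n \<ge> 2" "s = simple_gen n r" by (auto elim: simple_gensE)
  show "?f (s \<circ> w \<circ> s) = ?f w"
    using w involutions_conj[OF r(1) w] moved_count_conj[OF r(1) involutionsD(1)[OF w]] r(2) by simp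
next
  fix w s assume w: "w \<in> involutions n" and s: "s \<in> simple_gens n" and ws: "w \<circ> s \<in> involutions n"
  from s obtain r where r: "n \<ge> 2" "s = simple_gen n r" by (auto elim: simple_gensE)
  have wss: "w \<circ> s \<circ> s = w" by (simp add: r(2) comp_assoc simple_gen_comp_self[OF r(1)])
  have sr: "s (int r) = int r + 1" "s (int r + 1) = int r"
    using simple_gen_simps(1,2)[OF r(1)] r(2) by simp_all
  consider "w (int r) = int r \<and> w (int r + 1) = int r + 1"
    | "w (int r) = int r + 1 \<and> w (int r + 1) = int r"
    using involution_comp_cases[OF r(1) w] ws r(2) by blast
  then show "int (?f (w \<circ> s)) - int (?f w) = int (cox_length n (w \<circ> s)) - int (cox_length n w)"
  proof cases
    case 1
    then show ?thesis
      using moved_count_comp_fixing[OF r(1) involutionsD(1)[OF w], of r] w ws r(2)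
        cox_length_comp_simple_gen[OF r(1) involutionsD(1)[OF w], of r] by simp
  next
    \<comment> \<open>The exchange case is the fixed case for \<open>w \<circ> s\<close>, read in
      the opposite direction.\<close>
    case 2
    then have "(w \<circ> s) (int r) = int r" "(w \<circ> s) (int r + 1) = int r + 1" by (simp_all add: sr)
    then have "moved_count n (w \<circ> s \<circ> s) = moved_count n (w \<circ> s) + 2"
      using moved_count_comp_fixing[OF r(1) involutionsD(1)[OF ws], of r] r(2) by simp
    then show ?thesis
      using cox_length_comp_simple_gen[OF r(1) involutionsD(1)[OF w], of r] 2 w ws r(2)
      unfolding wss by simp
  qed
qed

text \<open>Induction on length along a descent s: either \<open>w \<circ> s\<close> is an
  involution and the difference axiom applies, or \<open>s \<circ> w \<circ> s\<close> is a strictly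
  shorter involution with the same value.\<close>

lemma is_absolute_length_unique:
  assumes n: "n > 0" and f: "is_absolute_length n f" and g: "is_absolute_length n g"
    and "w \<in> involutions n"
  shows "f w = g w"
  using assms(4)
proof (induction "inv_number n w" arbitrary: w rule: less_induct)
  case less
  note wD = involutionsD[OF less.prems]
  show ?case
  proof (cases "w = id")
    case True
    then show ?thesis using f g by (simp add: is_absolute_length_def)
  next
    case False
    then obtain r where r: "n \<ge> 2" "r < n" "w (int r + 1) < w (int r)"
      using exists_descent[OF n wD(1)] by blast
    define s where "s = simple_gen n r"
    have s: "s \<in> simple_gens n" using simple_gensI[OF r(1,2)] by (simp add: s_def)
    have s_aff: "s \<in> affine_perms n" unfolding s_def by (rule simple_gen_affine_perms[OF r(1)])
    have ss: "s (s j) = j" for j unfolding s_def by (rule simple_gen_invol[OF r(1)])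
    have ws_aff: "w \<circ> s \<in> affine_perms n" by (rule affine_perms_comp[OF n wD(1) s_aff])
    have len: "inv_number n (w \<circ> s) < inv_number n w"
      using inv_number_comp_simple_gen[OF r(1) wD(1), of r] r(3) by (simp add: s_def)
    show ?thesis
    proof (cases "w \<circ> s \<in> involutions n")
      case True
      have "int (h (w \<circ> s)) - int (h w) = int (cox_length n (w \<circ> s)) - int (cox_length n w)"
        if "is_absolute_length n h" for h
        using that less.prems s True unfolding is_absolute_length_def by blast
      from this[OF f] this[OF g] less.hyps[OF len True] show ?thesis by simp
    next
      case False
      let ?v = "s \<circ> w \<circ> s"
      have v: "?v \<in> involutions n" unfolding s_def by (rule involutions_conj[OF r(1) less.prems])
      have eq: "h ?v = h w" if "is_absolute_length n h" for h
        using that less.prems s unfolding is_absolute_length_def by blast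
      \<comment> \<open>\<open>s \<circ> w\<close> and \<open>w \<circ> s\<close> are mutually inverse; a descent of \<open>s \<circ> w\<close> at \<open>r\<close> can only fail if
        \<open>s\<close> exchanges \<open>w r\<close> and \<open>w (r + 1)\<close>, in which case \<open>w\<close> commutes with \<open>s\<close>.\<close>
      have "s (w (int r + 1)) < s (w (int r))"
      proof (rule ccontr)
        assume "\<not> ?thesis"
        then have A: "w (int r + 1) mod int n = int r mod int n" "w (int r) = w (int r + 1) + 1"
          using r(3) unfolding s_def simple_gen_less_iff[OF r(1)] by (auto split: if_splits)
        have sA: "s (w (int r + 1)) = w (int r)" "s (w (int r)) = w (int r + 1)"
          using simple_gen_simps(1)[OF r(1) A(1)] A(2) ss[of "w (int r + 1)"] by (simp_all add: s_def)
        \<comment> \<open>The difference of both sides is periodic, so it suffices to look at the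
          classes r and r+1 and at the points outside of them.\<close>
        have comm: "s (w i) = w (s i)" for i
        proof -
          note sim = simple_gen_simps[OF r(1), of _ r, folded s_def]
          have per: "s (w i) - w (s i) = s (w j) - w (s j)" if "i mod int n = j mod int n" for i j
            by (rule periodic_mod_eq[of "\<lambda>i. s (w i) - w (s i)" "int n"])
              (simp_all add: affine_permsD(2)[OF s_aff] affine_permsD(2)[OF wD(1)] that)
          have srr: "s (int r) = int r + 1" "s (int r + 1) = int r" using sim(1,2) by simp_all
          consider "i mod int n = int r mod int n" | "i mod int n = (int r + 1) mod int n"
            | "i mod int n \<noteq> int r mod int n" "i mod int n \<noteq> (int r + 1) mod int n" by blast
          then show ?thesis
          proof cases
            case 1
            then show ?thesis using per[of i "int r"] sA srr by simp
          next
            case 2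
            then show ?thesis using per[of i "int r + 1"] sA srr by simp
          next
            case 3
            \<comment> \<open>By \<open>A\<close>, \<open>w\<close> exchanges the classes of r and
              r+1, so a point outside of them is mapped outside of them, where \<open>s\<close> acts
              trivially.\<close>
            have "s (w i) = w i"
            proof (rule ccontr)
              assume "s (w i) \<noteq> w i"
              then have "w i mod int n = int r mod int n \<or> w i mod int n = (int r + 1) mod int n"
                using sim(3) by blast
              moreover have "w (int r) mod int n = (int r + 1) mod int n"
                using A by (simp add: mod_succ_iff)
              ultimately have "w i mod int n = w (int r + 1) mod int n \<or> w i mod int n = w (int r) mod int n"
                using A(1) by simp
              then obtain j where j: "j = int r \<or> j = int r + 1" "w i mod int n = w j mod int n"
                by blast
              from j(2) obtain t where "w i = w j + int n * t" by (rule mod_eqE)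
              then have "w i = w (j + int n * t)" by (simp add: affine_permsD(3)[OF wD(1)])
              then have "i = j + int n * t" by (simp add: affine_permsD(4)[OF wD(1)])
              then show False using j(1) 3 by auto
            qed
            then show ?thesis using sim(3)[OF 3] by simp
          qed
        qed
        have "(w \<circ> s) \<circ> (w \<circ> s) = id" using comm ss wD(2) by (simp add: fun_eq_iff)
        then show False using ws_aff False by (simp add: involutions_def)
      qed
      then have "inv_number n (s \<circ> w \<circ> s) < inv_number n (s \<circ> w)"
        using inv_number_comp_simple_gen[OF r(1) affine_perms_comp[OF n s_aff wD(1)], of r]
        by (simp add: s_def)
      moreover have "inv_number n (s \<circ> w) \<le> inv_number n (w \<circ> s)"
        by (rule inv_number_inverse_le[OF n ws_aff]) (simp add: ss wD)
      ultimately have "inv_number n ?v < inv_number n w" using len by linarith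
      from less.hyps[OF this v] show ?thesis using eq[OF f] eq[OF g] by simp
    qed
  qed
qed

lemma abs_length_eq:
  assumes n: "n > 0" and w: "w \<in> involutions n"
  shows "abs_length n w = moved_count n w div 2"
proof -
  let ?f = "\<lambda>w. if w \<in> involutions n then moved_count n w div 2 else 0"
  have "abs_length n = ?f" unfolding abs_length_def
  proof (rule the_equality)
    show "is_absolute_length n ?f \<and> (\<forall>w. w \<notin> involutions n \<longrightarrow> ?f w = 0)"
      using moved_count_is_absolute_length[OF n] by simp
    show "g = ?f" if g: "is_absolute_length n g \<and> (\<forall>w. w \<notin> involutions n \<longrightarrow> g w = 0)" for g
    proof
      fix w show "g w = ?f w"
      proof (cases "w \<in> involutions n")
        case True
        show ?thesis
          using is_absolute_length_unique[OF n conjunct1[OF g] moved_count_is_absolute_length[OF n] True] .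
      next
        case False
        then show ?thesis using g by simp
      qed
    qed
  qed
  then show ?thesis using w by simp
qed

section \<open>Inversions of block-preserving permutations\<close>

text \<open>If \<open>p\<close> fixes m, then \<open>p \<circ> cycle_up j m\<close> has the one-line
  word of \<open>p\<close> on the positions below m, with the value m inserted at position j.
  \<open>cycle_down\<close> undoes the insertion.\<close>

definition cycle_up :: "int \<Rightarrow> int \<Rightarrow> int \<Rightarrow> int" where
  "cycle_up j m i = (if i = j then m else if j < i \<and> i \<le> m then i - 1 else i)"

definition cycle_down :: "int \<Rightarrow> int \<Rightarrow> int \<Rightarrow> int" where
  "cycle_down j m i = (if i = m then j else if j \<le> i \<and> i < m then i + 1 else i)"

lemma cycle_up_down: "j \<le> m \<Longrightarrow> cycle_up j m (cycle_down j m i) = i"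
  and cycle_down_up: "j \<le> m \<Longrightarrow> cycle_down j m (cycle_up j m i) = i"
  by (auto simp: cycle_up_def cycle_down_def)

lemma cycle_permutes:
  assumes "j \<in> {l..m}"
  shows "cycle_up j m permutes {l..m}" "cycle_down j m permutes {l..m}"
proof -
  have jm: "j \<le> m" using assms by simp
  have "bij_betw (cycle_up j m) {l..m} {l..m}"
    by (rule bij_betw_byWitness[where f' = "cycle_down j m"])
      (use assms in \<open>auto simp: cycle_up_def cycle_down_def\<close>)
  then show "cycle_up j m permutes {l..m}"
    by (rule bij_imp_permutes) (use assms in \<open>auto simp: cycle_up_def\<close>)
  have "bij_betw (cycle_down j m) {l..m} {l..m}"
    by (rule bij_betw_byWitness[where f' = "cycle_up j m"])
      (use assms in \<open>auto simp: cycle_up_def cycle_down_def\<close>)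
  then show "cycle_down j m permutes {l..m}"
    by (rule bij_imp_permutes) (use assms in \<open>auto simp: cycle_down_def\<close>)
qed

definition block_perms :: "(int \<Rightarrow> int) \<Rightarrow> int set \<Rightarrow> (int \<Rightarrow> int) set" where
  "block_perms c A = {p. p permutes A \<and> (\<forall>i\<in>A. c (p i) = c i)}"

text \<open>The weight sits on the left index. If \<open>p\<close> preserves the levels of a weakly
  increasing level function, both indices of an inversion lie in one block, so a weight depending on
  the level alone could be read off at either.\<close>

definition weighted_inversions :: "(int \<Rightarrow> nat) \<Rightarrow> int set \<Rightarrow> (int \<Rightarrow> int) \<Rightarrow> nat" where
  "weighted_inversions u A p = (\<Sum>i\<in>A. u i * card {j \<in> A. i < j \<and> p j < p i})"

text \<open>The inserted maximum creates m - j inversions, all with left index j. The entries behind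
  it move one place to the right, which is harmless because \<open>u\<close> is constant on
  {j..m}.\<close>

lemma weighted_inversions_cycle_up:
  assumes p: "p permutes {l..m - 1}" and j: "j \<in> {l..m}"
    and u: "\<And>i. i \<in> {j..m} \<Longrightarrow> u i = u m"
  shows "weighted_inversions u {l..m} (p \<circ> cycle_up j m) =
    weighted_inversions u {l..m - 1} p + u m * nat (m - j)"
proof -
  let ?s = "cycle_up j m"
  have lm: "l \<le> m" "j \<le> m" "l \<le> j" using j by auto
  have pm: "p m = m" using p by (simp add: permutes_def)
  have pin: "p i \<in> {l..m - 1} \<longleftrightarrow> i \<in> {l..m - 1}" for i using permutes_in_image[OF p] .
  have inj: "inj ?s" using permutes_inj[OF cycle_permutes(1)[OF j]] .
  \<comment> \<open>Inversions are re-expressed in terms of the entries of the old word, whose new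
    positions are given by \<open>cycle_down\<close>.\<close>
  have N: "{k \<in> {l..m}. i < k \<and> (p \<circ> ?s) k < (p \<circ> ?s) i} =
      cycle_down j m ` {k \<in> {l..m}. i < cycle_down j m k \<and> p k < p (?s i)}" for i
  proof (intro Set.set_eqI iffI)
    fix k assume "k \<in> {k \<in> {l..m}. i < k \<and> (p \<circ> ?s) k < (p \<circ> ?s) i}"
    then show "k \<in> cycle_down j m ` {k \<in> {l..m}. i < cycle_down j m k \<and> p k < p (?s i)}"
      using permutes_in_image[OF cycle_permutes(1)[OF j], of k]
      by (intro image_eqI[of _ _ "?s k"]) (simp_all add: cycle_down_up[OF lm(2)])
  next
    fix k assume "k \<in> cycle_down j m ` {k \<in> {l..m}. i < cycle_down j m k \<and> p k < p (?s i)}"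
    then obtain k' where k': "k = cycle_down j m k'" "k' \<in> {l..m}" "i < cycle_down j m k'" "p k' < p (?s i)"
      by blast
    then show "k \<in> {k \<in> {l..m}. i < k \<and> (p \<circ> ?s) k < (p \<circ> ?s) i}"
      using permutes_in_image[OF cycle_permutes(2)[OF j], of k'] by (simp add: cycle_up_down[OF lm(2)])
  qed
  have cN: "card {k \<in> {l..m}. i < k \<and> (p \<circ> ?s) k < (p \<circ> ?s) i} =
      card {k \<in> {l..m}. i < cycle_down j m k \<and> p k < p (?s i)}" for i
    unfolding N using permutes_inj[OF cycle_permutes(2)[OF j]]
    by (intro card_image) (auto simp: inj_on_def)
  let ?C = "\<lambda>i. card {k \<in> {l..m - 1}. i < k \<and> p k < p i}"
  have cd: "i < cycle_down j m k \<longleftrightarrow> (if k = m then i < j else if j \<le> k \<and> k < m then i \<le> k else i < k)" for i k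
    by (auto simp: cycle_down_def)
  have atj: "card {k \<in> {l..m}. j < k \<and> (p \<circ> ?s) k < (p \<circ> ?s) j} = nat (m - j)"
  proof -
    have "p k < m" if "k \<in> {l..m - 1}" for k using iffD2[OF pin that] by simp
    moreover have "?s j = m" by (simp add: cycle_up_def)
    ultimately have "{k \<in> {l..m}. j < cycle_down j m k \<and> p k < p (?s j)} = {j..m - 1}"
      unfolding cd using pm lm by (auto split: if_splits)
    then show ?thesis unfolding cN by simp
  qed
  have below: "card {k \<in> {l..m}. i < k \<and> (p \<circ> ?s) k < (p \<circ> ?s) i} = ?C i" if i: "i \<in> {l..<j}" for i
  proof -
    have "i \<in> {l..m - 1}" using i lm by auto
    then have "p i \<in> {l..m - 1}" using pin by blast
    then have "\<not> p m < p i" using pm by auto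
    moreover have s: "?s i = i" using i by (simp add: cycle_up_def)
    ultimately have "{k \<in> {l..m}. i < cycle_down j m k \<and> p k < p (?s i)} = {k \<in> {l..m - 1}. i < k \<and> p k < p i}"
      using i lm s unfolding cd by (auto split: if_splits)
    then show ?thesis unfolding cN by simp
  qed
  have above: "card {k \<in> {l..m}. i + 1 < k \<and> (p \<circ> ?s) k < (p \<circ> ?s) (i + 1)} = ?C i" if i: "i \<in> {j..<m}" for i
  proof -
    have "i \<in> {l..m - 1}" using i lm by auto
    then have "p i \<in> {l..m - 1}" using pin by blast
    then have "\<not> p m < p i" using pm by auto
    moreover have s: "?s (i + 1) = i" using i by (auto simp: cycle_up_def)
    ultimately have "{k \<in> {l..m}. i + 1 < cycle_down j m k \<and> p k < p (?s (i + 1))}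
        = {k \<in> {l..m - 1}. i < k \<and> p k < p i}"
      using i lm s unfolding cd by (auto split: if_splits)
    then show ?thesis unfolding cN by simp
  qed
  let ?D = "\<lambda>i. u i * card {k \<in> {l..m}. i < k \<and> (p \<circ> ?s) k < (p \<circ> ?s) i}"
  have "{l..m} = {l..<j} \<union> ({j} \<union> (\<lambda>i. i + 1) ` {j..<m})"
    using lm by (auto simp: image_iff intro!: bexI[of _ "_ - 1"])
  then have "weighted_inversions u {l..m} (p \<circ> ?s) = sum ?D ({l..<j} \<union> ({j} \<union> (\<lambda>i. i + 1) ` {j..<m}))"
    unfolding weighted_inversions_def by (rule arg_cong)
  also have "\<dots> = sum ?D {l..<j} + (?D j + sum ?D ((\<lambda>i. i + 1) ` {j..<m}))"
    by (subst sum.union_disjoint, simp, simp, force, subst sum.union_disjoint) auto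
  also have "sum ?D {l..<j} = (\<Sum>i\<in>{l..<j}. u i * ?C i)"
    by (rule sum.cong) (simp_all only: below)
  also have "sum ?D ((\<lambda>i. i + 1) ` {j..<m}) = (\<Sum>i\<in>{j..<m}. ?D (i + 1))"
    by (subst sum.reindex) (simp_all add: inj_on_def comp_def)
  also have "\<dots> = (\<Sum>i\<in>{j..<m}. u i * ?C i)"
  proof (rule sum.cong)
    fix i assume i: "i \<in> {j..<m}"
    have "u (i + 1) = u i" using u[of i] u[of "i + 1"] i by simp
    then show "?D (i + 1) = u i * ?C i" by (simp only: above[OF i])
  qed simp
  also have "?D j = u m * nat (m - j)" using u[of j] lm by (simp only: atj) simp
  finally have "weighted_inversions u {l..m} (p \<circ> ?s) =
      (\<Sum>i\<in>{l..<j}. u i * ?C i) + (\<Sum>i\<in>{j..<m}. u i * ?C i) + u m * nat (m - j)"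
    by (simp only: add_ac)
  also have "(\<Sum>i\<in>{l..<j}. u i * ?C i) + (\<Sum>i\<in>{j..<m}. u i * ?C i) = weighted_inversions u {l..m - 1} p"
  proof -
    have "{l..m - 1} = {l..<j} \<union> {j..<m}" using lm by auto
    then have "sum f {l..m - 1} = sum f {l..<j} + sum f {j..<m}" for f :: "int \<Rightarrow> nat"
      by (simp add: sum.union_disjoint)
    then show ?thesis unfolding weighted_inversions_def by (simp only:)
  qed
  finally show ?thesis .
qed

text \<open>Induction on the right end: removing the largest value m from the one-line word leaves a
  permutation of the same kind. Its position can be any place of the block of m, which gives one
  geometric sum.\<close>

lemma block_perms_generating_function:
  fixes q :: "'a::comm_semiring_1"
  assumes "\<And>i j. l \<le> i \<Longrightarrow> i \<le> j \<Longrightarrow> j \<le> m \<Longrightarrow> c i \<le> c j"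
  shows "(\<Sum>p\<in>block_perms c {l..m}. q ^ weighted_inversions (\<lambda>i. v (c i)) {l..m} p) =
    (\<Prod>j\<in>{l..m}. \<Sum>t<card {i \<in> {l..j}. c i = c j}. (q ^ v (c j)) ^ t)"
  using assms
proof (induction "nat (m - l + 1)" arbitrary: m)
  case 0
  then have "{l..m} = {}" by simp
  moreover have "block_perms c {} = {id}" by (auto simp: block_perms_def)
  ultimately show ?case by (simp add: weighted_inversions_def)
next
  case (Suc N)
  have lm: "l \<le> m" using Suc.hyps(2) by simp
  have mono: "c i \<le> c j" if "l \<le> i" "i \<le> j" "j \<le> m" for i j using Suc.prems that by blast
  let ?u = "\<lambda>i. v (c i)"
  define B where "B = {j \<in> {l..m}. c j = c m}"
  have same: "c i = c m" if "j \<in> B" "i \<in> {j..m}" for i j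
    using mono[of j i] mono[of i m] that by (auto simp: B_def)
  have cup: "c (cycle_up j m i) = c i" if "j \<in> B" "i \<in> {l..m}" for i j
    using same[OF that(1), of i] same[OF that(1), of "i - 1"] that by (auto simp: cycle_up_def B_def)
  have cdown: "c (cycle_down j m i) = c i" if "j \<in> B" "i \<in> {l..m}" for i j
    using same[OF that(1), of i] same[OF that(1), of "i + 1"] that by (auto simp: cycle_down_def B_def)
  have comp_in: "p \<circ> cycle_up j m \<in> block_perms c {l..m}"
    if p: "p \<in> block_perms c {l..m - 1}" and j: "j \<in> B" for p j
  proof -
    have j': "j \<in> {l..m}" using j by (simp add: B_def)
    have pp: "p permutes {l..m - 1}" using p by (simp add: block_perms_def)
    have "p permutes {l..m}" by (rule permutes_subset[OF pp]) auto
    moreover have "c (p (cycle_up j m i)) = c i" if i: "i \<in> {l..m}" for i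
    proof -
      have s: "cycle_up j m i \<in> {l..m}" using permutes_in_image[OF cycle_permutes(1)[OF j'], of i] i by simp
      have "c (p k) = c k" if "k \<in> {l..m}" for k
      proof (cases "k = m")
        case True
        then show ?thesis using pp by (simp add: permutes_def)
      next
        case False
        then show ?thesis using p that by (simp add: block_perms_def)
      qed
      then show ?thesis using s cup[OF j i] by simp
    qed
    ultimately show ?thesis using permutes_compose[OF cycle_permutes(1)[OF j']]
      by (simp add: block_perms_def)
  qed
  have "(\<Sum>p\<in>block_perms c {l..m}. q ^ weighted_inversions ?u {l..m} p)
     = (\<Sum>(p, j)\<in>block_perms c {l..m - 1} \<times> B. q ^ (weighted_inversions ?u {l..m - 1} p + ?u m * nat (m - j)))"
  proof (rule sum.reindex_bij_witness[where j = "\<lambda>p. (p \<circ> cycle_down (inv_into UNIV p m) m, inv_into UNIV p m)"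
        and i = "\<lambda>(p, j). p \<circ> cycle_up j m"])
    fix p assume p: "p \<in> block_perms c {l..m}"
    \<comment> \<open>The position of the value m in the word of \<open>p\<close>.\<close>
    define j where "j = inv_into UNIV p m"
    have pp: "p permutes {l..m}" using p by (simp add: block_perms_def)
    have pj: "p j = m" unfolding j_def by (rule permutes_inverses(1)[OF pp])
    then have j: "j \<in> {l..m}" using permutes_in_image[OF pp, of j] lm by simp
    then have jB: "j \<in> B" using p pj by (auto simp: block_perms_def B_def)
    have "p \<circ> cycle_down j m permutes {l..m}"
      by (rule permutes_compose[OF cycle_permutes(2)[OF j] pp])
    moreover have "(p \<circ> cycle_down j m) i = i" if "i \<in> {l..m} - {l..m - 1}" for i
    proof -
      have "i = m" using that by auto
      then show ?thesis by (simp add: cycle_down_def pj)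
    qed
    ultimately have "p \<circ> cycle_down j m permutes {l..m - 1}"
      by (rule permutes_superset)
    moreover have "c (p (cycle_down j m i)) = c i" if i: "i \<in> {l..m - 1}" for i
    proof -
      have i': "i \<in> {l..m}" using i by auto
      have "cycle_down j m i \<in> {l..m}" using permutes_in_image[OF cycle_permutes(2)[OF j], of i] i' by simp
      then show ?thesis using p cdown[OF jB i'] by (simp add: block_perms_def)
    qed
    ultimately have pd: "p \<circ> cycle_down j m \<in> block_perms c {l..m - 1}" by (simp add: block_perms_def)
    show "(p \<circ> cycle_down (inv_into UNIV p m) m, inv_into UNIV p m) \<in> block_perms c {l..m - 1} \<times> B"
      using pd jB by (simp add: j_def)
    have undo: "p \<circ> cycle_down j m \<circ> cycle_up j m = p"
      using j by (simp add: fun_eq_iff cycle_down_up)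
    then show "(case (p \<circ> cycle_down (inv_into UNIV p m) m, inv_into UNIV p m) of (p, j) \<Rightarrow> p \<circ> cycle_up j m) = p"
      by (simp add: j_def)
    have "weighted_inversions ?u {l..m} (p \<circ> cycle_down j m \<circ> cycle_up j m) =
        weighted_inversions ?u {l..m - 1} (p \<circ> cycle_down j m) + ?u m * nat (m - j)"
      using pd unfolding block_perms_def
      by (intro weighted_inversions_cycle_up[OF _ j arg_cong[OF same[OF jB]]]) blast+
    then show "(case (p \<circ> cycle_down (inv_into UNIV p m) m, inv_into UNIV p m) of
        (p, j) \<Rightarrow> q ^ (weighted_inversions ?u {l..m - 1} p + ?u m * nat (m - j)))
        = q ^ weighted_inversions ?u {l..m} p"
      unfolding undo by (simp add: j_def)
  next
    fix x assume x: "x \<in> block_perms c {l..m - 1} \<times> B"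
    obtain p j where pj: "x = (p, j)" "p \<in> block_perms c {l..m - 1}" "j \<in> B" using x by auto
    have j: "j \<in> {l..m}" using pj(3) by (simp add: B_def)
    have in': "p \<circ> cycle_up j m \<in> block_perms c {l..m}" by (rule comp_in[OF pj(2,3)])
    then show "(case x of (p, j) \<Rightarrow> p \<circ> cycle_up j m) \<in> block_perms c {l..m}" by (simp add: pj(1))
    have pm: "p m = m" using pj(2) by (simp add: block_perms_def permutes_def)
    have "(p \<circ> cycle_up j m) j = m" by (simp add: cycle_up_def pm)
    then have "inv_into UNIV (p \<circ> cycle_up j m) m = j"
      using in' by (metis (no_types, lifting) block_perms_def inv_f_f mem_Collect_eq permutes_inj)
    moreover have "p \<circ> cycle_up j m \<circ> cycle_down j m = p"
      using j by (simp add: fun_eq_iff cycle_up_down)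
    ultimately show "((case x of (p, j) \<Rightarrow> p \<circ> cycle_up j m) \<circ>
        cycle_down (inv_into UNIV (case x of (p, j) \<Rightarrow> p \<circ> cycle_up j m) m) m,
        inv_into UNIV (case x of (p, j) \<Rightarrow> p \<circ> cycle_up j m) m) = x"
      by (simp add: pj(1))
  qed
  also have "\<dots> = (\<Sum>p\<in>block_perms c {l..m - 1}. q ^ weighted_inversions ?u {l..m - 1} p) *
      (\<Sum>j\<in>B. (q ^ ?u m) ^ nat (m - j))"
    by (simp add: sum_product sum.cartesian_product power_add power_mult)
  \<comment> \<open>By monotonicity \<open>B\<close> is an interval ending in m, so m - j runs
    through all numbers below \<open>card B\<close>.\<close>
  also have "(\<Sum>j\<in>B. (q ^ ?u m) ^ nat (m - j)) = (\<Sum>t<card B. (q ^ ?u m) ^ t)"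
  proof -
    have fin: "finite B" unfolding B_def by (rule finite_Collect_conjI) simp
    have mB: "m \<in> B" using lm by (simp add: B_def)
    define b where "b = Min B"
    have b: "b \<in> B" unfolding b_def using fin mB by (intro Min_in) auto
    have Bint: "B = {b..m}"
    proof (intro equalityI subsetI)
      fix i assume "i \<in> B" then show "i \<in> {b..m}" using fin by (auto simp: b_def B_def)
    next
      fix i assume i: "i \<in> {b..m}"
      have "c i = c m" by (rule same[OF b i])
      then show "i \<in> B" using i b by (simp add: B_def)
    qed
    have bm: "b \<le> m" using b by (simp add: B_def)
    then have cB: "card B = nat (m - b) + 1" unfolding Bint by (simp add: nat_add_distrib)
    show ?thesis
      by (rule sum.reindex_bij_witness[where j = "\<lambda>j. nat (m - j)" and i = "\<lambda>t. m - int t"])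
        (use bm in \<open>auto simp: cB Bint\<close>)
  qed
  also have "(\<Sum>p\<in>block_perms c {l..m - 1}. q ^ weighted_inversions ?u {l..m - 1} p) =
      (\<Prod>j\<in>{l..m - 1}. \<Sum>t<card {i \<in> {l..j}. c i = c j}. (q ^ v (c j)) ^ t)"
    by (rule Suc.hyps(1)) (use Suc.hyps(2) mono in auto)
  also have "\<dots> * (\<Sum>t<card B. (q ^ ?u m) ^ t) =
      (\<Prod>j\<in>insert m {l..m - 1}. \<Sum>t<card {i \<in> {l..j}. c i = c j}. (q ^ v (c j)) ^ t)"
    by (simp add: B_def mult.commute)
  also have "insert m {l..m - 1} = {l..m}" using lm by auto
  finally show ?case .
qed

section \<open>Parabolic subgroups and twisted Poincare polynomials\<close>

lemma window_mod_inj: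
  assumes "i \<in> {1..int n}" "j \<in> {1..int n}" "i mod int n = j mod int n"
  shows "i = j"
  using periodic_mod_eq[of "residue n" "int n" i j] residue_shift assms residue_id by metis

text \<open>\<open>generate\<close> closes under \<open>m_inv\<close>, a definite description, so
  the inverses of generators have to be identified.\<close>

lemma affine_sym_inv_simple_gen:
  assumes n: "n \<ge> 2"
  shows "inv\<^bsub>affine_sym n\<^esub> (simple_gen n r) = simple_gen n r"
  unfolding m_inv_def
proof (rule the_equality)
  let ?s = "simple_gen n r"
  show "?s \<in> carrier (affine_sym n) \<and> ?s \<otimes>\<^bsub>affine_sym n\<^esub> ?s = \<one>\<^bsub>affine_sym n\<^esub> \<and>
      ?s \<otimes>\<^bsub>affine_sym n\<^esub> ?s = \<one>\<^bsub>affine_sym n\<^esub>"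
    unfolding affine_sym_def monoid.simps partial_object.simps
    using simple_gen_comp_self[OF n] simple_gen_affine_perms[OF n] by blast
  fix y assume "y \<in> carrier (affine_sym n) \<and> ?s \<otimes>\<^bsub>affine_sym n\<^esub> y = \<one>\<^bsub>affine_sym n\<^esub> \<and>
      y \<otimes>\<^bsub>affine_sym n\<^esub> ?s = \<one>\<^bsub>affine_sym n\<^esub>"
  then have "?s \<circ> y = id" unfolding affine_sym_def monoid.simps by blast
  then show "y = ?s" by (metis comp_apply id_apply simple_gen_invol[OF n] ext)
qed

definition window_block_group :: "nat \<Rightarrow> (int \<Rightarrow> int) \<Rightarrow> (int \<Rightarrow> int) set" where
  "window_block_group n c =
     {x \<in> affine_perms n. \<forall>i \<in> {1..int n}. x i \<in> {1..int n} \<and> c (x i) = c i}"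

definition block_gens :: "nat \<Rightarrow> (int \<Rightarrow> int) \<Rightarrow> (int \<Rightarrow> int) set" where
  "block_gens n c = {simple_gen n r | r. r \<in> {1..<n} \<and> c (int r) = c (int r + 1)}"

lemma simple_gen_window:
  assumes r: "r \<in> {1..<n}" and i: "i \<in> {1..int n}"
  shows "simple_gen n r i = (if i = int r then i + 1 else if i = int r + 1 then i - 1 else i)"
proof -
  have n: "n \<ge> 2" using r by simp
  note s = simple_gen_simps[OF n, of i r]
  have W: "int r \<in> {1..int n}" "int r + 1 \<in> {1..int n}" using r by auto
  show ?thesis
    using s window_mod_inj[OF i W(1)] window_mod_inj[OF i W(2)] by auto
qed

lemma affine_perm_above_window:
  assumes n: "n > 0" and x: "x \<in> affine_perms n" and W: "\<And>i. i \<in> {1..int n} \<Longrightarrow> x i \<in> {1..int n}"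
    and j: "j > int n"
  shows "x j > int n"
proof -
  have "int n * level n j > 0"
    using residue_level[of j n] residue_range[OF n, of j] j by simp
  then have "level n j \<ge> 1" using n by (simp add: zero_less_mult_iff)
  then have "int n * level n j \<ge> int n" using n by simp
  moreover have "x j = x (residue n j) + int n * level n j"
    using residue_level[of j n] affine_permsD(3)[OF x] by metis
  moreover have "x (residue n j) \<ge> 1" using W[OF residue_range[OF n]] by simp
  ultimately show ?thesis by linarith
qed

text \<open>An element preserving the window sends everything above it to values above it, so no
  inversion leaves the window.\<close>

lemma inv_number_window_block_group:
  assumes n: "n > 0" and x: "x \<in> window_block_group n c"
  shows "inv_number n x = weighted_inversions (\<lambda>_. 1) {1..int n} x"
proof -
  have xa: "x \<in> affine_perms n" and W: "\<And>i. i \<in> {1..int n} \<Longrightarrow> x i \<in> {1..int n}"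
    using x by (simp_all add: window_block_group_def)
  have "{j. i < j \<and> x j < x i} = {j \<in> {1..int n}. i < j \<and> x j < x i}" if i: "i \<in> {1..int n}" for i
  proof -
    have "j \<le> int n" if "x j < x i" for j
      using affine_perm_above_window[OF n xa W, of j] W[OF i] that by force
    then show ?thesis using i by auto
  qed
  then show ?thesis unfolding inv_number_def weighted_inversions_def by simp
qed

text \<open>The group is recovered by sorting: the descent of a non-identity element must lie inside
  the window and inside one block, so it belongs to an available generator.\<close>

lemma generate_block_gens:
  assumes n: "n > 0" and mono: "\<And>i j. 1 \<le> i \<Longrightarrow> i \<le> j \<Longrightarrow> j \<le> int n \<Longrightarrow> c i \<le> c j"
  shows "generate (affine_sym n) (block_gens n c) = window_block_group n c"
proof (intro equalityI subsetI)
  have gen: "s \<in> window_block_group n c" if s: "s \<in> block_gens n c" for s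
  proof -
    obtain r where r: "s = simple_gen n r" "r \<in> {1..<n}" "c (int r) = c (int r + 1)"
      using s by (auto simp: block_gens_def)
    have "s \<in> affine_perms n" unfolding r(1) by (rule simple_gen_affine_perms) (use r(2) in simp)
    moreover have "s i \<in> {1..int n} \<and> c (s i) = c i" if "i \<in> {1..int n}" for i
      unfolding r(1) simple_gen_window[OF r(2) that] using that r(2,3) by auto
    ultimately show ?thesis by (simp add: window_block_group_def)
  qed
  fix x assume "x \<in> generate (affine_sym n) (block_gens n c)"
  then show "x \<in> window_block_group n c"
  proof (induction rule: generate.induct)
    case one
    then show ?case using id_affine_perms[of n]
      by (simp add: affine_sym_def window_block_group_def id_def)
  next
    case (incl h)
    then show ?case by (rule gen)
  next
    case (inv h)
    then obtain r where r: "h = simple_gen n r" "r \<in> {1..<n}" by (auto simp: block_gens_def)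
    then have "inv\<^bsub>affine_sym n\<^esub> h = h" using affine_sym_inv_simple_gen[of n r] by simp
    then show ?case using gen[OF inv] by simp
  next
    case (eng h1 h2)
    have "h1 \<circ> h2 \<in> affine_perms n"
      using eng.IH affine_perms_comp[OF n, of h1 h2] by (simp add: window_block_group_def)
    moreover have "(h1 \<circ> h2) i \<in> {1..int n} \<and> c ((h1 \<circ> h2) i) = c i" if "i \<in> {1..int n}" for i
      using eng.IH that by (simp add: window_block_group_def)
    ultimately show ?case unfolding affine_sym_def monoid.simps window_block_group_def by blast
  qed
next
  fix x assume "x \<in> window_block_group n c"
  then show "x \<in> generate (affine_sym n) (block_gens n c)"
  proof (induction "inv_number n x" arbitrary: x rule: less_induct)
    case less
    note x = less.prems
    have xa: "x \<in> affine_perms n" and W: "\<And>i. i \<in> {1..int n} \<Longrightarrow> x i \<in> {1..int n}"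
      and xc: "\<And>i. i \<in> {1..int n} \<Longrightarrow> c (x i) = c i"
      using x by (simp_all add: window_block_group_def)
    show ?case
    proof (cases "x = id")
      case True
      then show ?thesis using generate.one[of "affine_sym n" "block_gens n c"] by (simp add: affine_sym_def)
    next
      case False
      then obtain r where r: "n \<ge> 2" "r < n" "x (int r + 1) < x (int r)"
        using exists_descent[OF n xa] by blast
      \<comment> \<open>A descent at 0 would give x 1 < x 0 = x n - n, which is at most 0, although
        x 1 lies in the window.\<close>
      have "r \<noteq> 0"
      proof
        assume "r = 0"
        moreover have "x (int n) = x 0 + int n" using affine_permsD(2)[OF xa, of 0] by simp
        moreover have "x (int n) \<in> {1..int n}" "x 1 \<in> {1..int n}" using W n by simp_all
        ultimately show False using r(3) by simp
      qed
      then have r': "r \<in> {1..<n}" using r(2) by simp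
      have Wr: "int r \<in> {1..int n}" "int r + 1 \<in> {1..int n}" using r' by auto
      \<comment> \<open>The descent orders the levels of the values; since \<open>x\<close>
        preserves levels, it orders those of r and r+1 against monotonicity.\<close>
      have "c (int r + 1) \<le> c (int r)"
        using mono[of "x (int r + 1)" "x (int r)"] W[OF Wr(1)] W[OF Wr(2)] r(3) xc Wr by simp
      then have cr: "c (int r) = c (int r + 1)" using mono[of "int r" "int r + 1"] Wr by simp
      define s where "s = simple_gen n r"
      have s: "s \<in> block_gens n c" using r' cr by (auto simp: block_gens_def s_def)
      have sa: "s \<in> affine_perms n" unfolding s_def by (rule simple_gen_affine_perms[OF r(1)])
      have "x \<circ> s \<in> affine_perms n" by (rule affine_perms_comp[OF n xa sa])
      moreover have "(x \<circ> s) i \<in> {1..int n} \<and> c ((x \<circ> s) i) = c i" if "i \<in> {1..int n}" for i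
      proof -
        have "s i \<in> {1..int n} \<and> c (s i) = c i"
          unfolding s_def simple_gen_window[OF r' that] using that Wr cr by auto
        then show ?thesis using W xc by simp
      qed
      ultimately have xs: "x \<circ> s \<in> window_block_group n c" unfolding window_block_group_def by blast
      have "inv_number n (x \<circ> s) < inv_number n x"
        using inv_number_comp_simple_gen[OF r(1) xa, of r] r(3) by (simp add: s_def)
      from less.hyps[OF this xs]
      have "(x \<circ> s) \<otimes>\<^bsub>affine_sym n\<^esub> s \<in> generate (affine_sym n) (block_gens n c)"
        by (rule generate.eng) (rule generate.incl[OF s])
      moreover have "x \<circ> s \<circ> s = x" unfolding s_def comp_assoc simple_gen_comp_self[OF r(1)] by simp
      ultimately show ?thesis by (simp only: affine_sym_def monoid.simps)
    qed
  qed
qed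

section \<open>Blocks of equal level in a minimal involution\<close>

lemma sublevel_eq_interval:
  fixes c :: "int \<Rightarrow> int"
  assumes mono: "\<And>i j. 1 \<le> i \<Longrightarrow> i \<le> j \<Longrightarrow> j \<le> int n \<Longrightarrow> c i \<le> c j"
  shows "{i \<in> {1..int n}. c i < m} = {1..int (card {i \<in> {1..int n}. c i < m})}"
proof -
  let ?M = "{i \<in> {1..int n}. c i < m}"
  have fin: "finite ?M" by (rule finite_Collect_conjI) simp
  show ?thesis
  proof (cases "?M = {}")
    case True
    show ?thesis unfolding True by simp
  next
    case False
    define k where "k = Max ?M"
    have k: "k \<in> ?M" unfolding k_def by (rule Max_in[OF fin False])
    have "?M = {1..k}"
    proof (intro equalityI subsetI)
      fix i assume "i \<in> ?M" then show "i \<in> {1..k}" using Max_ge[OF fin] by (simp add: k_def)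
    next
      fix i assume "i \<in> {1..k}" then show "i \<in> ?M" using k mono[of i k] by simp
    qed
    moreover from this have "int (card ?M) = k" using k by simp
    ultimately show ?thesis by simp
  qed
qed

text \<open>Minimality in the coset is encoded as an increasing window;
  \<open>minimal_involution_iff\<close> translates it back into the length condition.\<close>

locale minimal_involution =
  fixes n :: nat and w :: "int \<Rightarrow> int"
  assumes n_pos: "n > 0"
    and invol: "w \<in> involutions n"
    and ascending: "\<And>i j. 1 \<le> i \<Longrightarrow> i < j \<Longrightarrow> j \<le> int n \<Longrightarrow> w i < w j"
begin

definition lev :: "int \<Rightarrow> int" where "lev i = level n (w i)"
definition res :: "int \<Rightarrow> int" where "res i = residue n (w i)"

lemmas w_affine = involutionsD(1)[OF invol]
lemmas w_w = involutionsD(2)[OF invol]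
lemmas w_shift = affine_permsD(3)[OF w_affine]

lemma w_eq: "w i = res i + int n * lev i"
  unfolding res_def lev_def by (rule residue_level)

lemma res_range: "res i \<in> {1..int n}"
  unfolding res_def by (rule residue_range[OF n_pos])

text \<open>Both facts are the two components of w (w i) = i, split by uniqueness of residue and
  level.\<close>

lemma lev_res: "i \<in> {1..int n} \<Longrightarrow> lev (res i) = - lev i"
  and res_res: "i \<in> {1..int n} \<Longrightarrow> res (res i) = i"
proof -
  assume i: "i \<in> {1..int n}"
  have "w (res i + int n * lev i) = i" using w_w[of i] by (simp only: w_eq[of i])
  then have "w (res i) = i + int n * (- lev i)" using w_shift[of "res i" "lev i"] by simp
  then show "lev (res i) = - lev i" "res (res i) = i"
    using residue_level_unique[OF i, of "- lev i"] by (simp_all only: lev_def res_def)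
qed

lemma lev_mono: "1 \<le> i \<Longrightarrow> i \<le> j \<Longrightarrow> j \<le> int n \<Longrightarrow> lev i \<le> lev j"
  unfolding lev_def level_def
  by (rule zdiv_mono1) (use ascending[of i j] n_pos in \<open>cases "i = j"; simp\<close>)+

lemma res_less_iff:
  assumes "i \<in> {1..int n}" "j \<in> {1..int n}" "lev i = lev j"
  shows "res i < res j \<longleftrightarrow> i < j"
proof -
  have "res i < res j \<longleftrightarrow> w i < w j" using assms(3) by (simp add: w_eq)
  also have "\<dots> \<longleftrightarrow> i < j" using ascending[of i j] ascending[of j i] assms(1,2)
    by (cases i j rule: linorder_cases) auto
  finally show ?thesis .
qed

lemma conj_simple_gen:
  assumes n2: "n \<ge> 2" and r: "r < n" and p: "w (int r) mod int n = int p mod int n"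
    and succ: "w (int r + 1) = w (int r) + 1"
  shows "w \<circ> simple_gen n r \<circ> w = simple_gen n p"
proof
  fix j
  note s = simple_gen_simps[OF n2]
  have wm: "w i mod int n = w k mod int n" if "i mod int n = k mod int n" for i k
  proof -
    from that obtain t where "i = k + int n * t" by (rule mod_eqE)
    then show ?thesis using w_shift[of k t] by simp
  qed
  have succ': "w (i + 1) = w i + 1" if "i mod int n = int r mod int n" for i
  proof -
    from that obtain t where t: "i = int r + int n * t" by (rule mod_eqE)
    then have "i + 1 = int r + 1 + int n * t" by simp
    then have "w (i + 1) = w (int r + 1) + int n * t" by (simp only: w_shift)
    moreover have "w i = w (int r) + int n * t" by (simp only: t w_shift)
    ultimately show ?thesis using succ by simp
  qed
  have w1: "w j mod int n = int r mod int n \<longleftrightarrow> j mod int n = int p mod int n"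
    using wm[of "w j" "int r"] wm[of j "w (int r)"] p by (auto simp: w_w)
  have pp: "w (int r + 1) mod int n = (int p + 1) mod int n" using p succ by (simp add: mod_succ_iff)
  have w2: "w j mod int n = (int r + 1) mod int n \<longleftrightarrow> j mod int n = (int p + 1) mod int n"
    using wm[of "w j" "int r + 1"] wm[of j "w (int r + 1)"] pp by (auto simp: w_w)
  consider "j mod int n = int p mod int n" | "j mod int n = (int p + 1) mod int n"
    | "j mod int n \<noteq> int p mod int n" "j mod int n \<noteq> (int p + 1) mod int n" by blast
  then show "(w \<circ> simple_gen n r \<circ> w) j = simple_gen n p j"
  proof cases
    case 1
    then show ?thesis using s(1)[of j p] s(1)[of "w j" r] w1 succ'[of "w j"] by (simp add: w_w)
  next
    case 2
    then have "(w j - 1) mod int n = int r mod int n" using w2 by (simp add: mod_pred_iff)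
    from succ'[OF this] have "w (w j - 1) = j - 1" by (simp add: w_w)
    then show ?thesis using s(2)[of j p] s(2)[of "w j" r] w2 2 by simp
  next
    case 3
    then show ?thesis using s(3)[of j p] s(3)[of "w j" r] w1 w2 by (simp add: w_w)
  qed
qed

text \<open>If conjugation by \<open>w\<close> sends one finite generator to another, it maps r, r+1
  to neighbours in the same translate of the window, hence of equal level. Conversely
  \<open>res\<close> maps a block increasingly onto the opposite block, so neighbours of equal level
  stay neighbours.\<close>

lemma twisted_gens_eq: "twisted_gens n w = block_gens n lev"
proof (intro equalityI subsetI)
  fix s assume "s \<in> twisted_gens n w"
  then obtain r p where rp: "r \<in> {1..<n}" "p \<in> {1..<n}" "s = simple_gen n r"
    "simple_gen n r = w \<circ> simple_gen n p \<circ> w"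
    by (auto simp: twisted_gens_def finite_gens_def)
  have n2: "n \<ge> 2" using rp by simp
  have W: "int r \<in> {1..int n}" "int r + 1 \<in> {1..int n}" using rp by auto
  have "simple_gen n r (int r) = int r + 1" using simple_gen_window[OF rp(1) W(1)] by simp
  then have "w (w (simple_gen n p (w (int r)))) = w (int r + 1)"
    unfolding rp(4) by simp
  then have sp: "simple_gen n p (w (int r)) = w (int r + 1)" by (simp only: w_w)
  have "w (int r) < w (int r + 1)" using ascending[of "int r" "int r + 1"] W by simp
  then have "w (int r) mod int n = int p mod int n"
    using simple_gen_simps(2,3)[OF n2, of "w (int r)" p] sp by force
  then have m: "res (int r) mod int n = int p mod int n" by (simp add: w_eq)
  have "int p \<in> {1..int n}" using rp(2) by simp
  then have rr: "res (int r) = int p" using window_mod_inj[OF res_range _ m] by simp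
  have "w (int r + 1) = w (int r) + 1"
    using simple_gen_simps(1)[OF n2, of "w (int r)" p] sp \<open>w (int r) mod int n = int p mod int n\<close> by simp
  then have "w (int r + 1) = (int p + 1) + int n * lev (int r)" by (simp add: w_eq[of "int r"] rr)
  \<comment> \<open>Because p < n, passing from p to p+1 does not carry into the level.\<close>
  moreover have "int p + 1 \<in> {1..int n}" using rp(2) by simp
  ultimately have "lev (int r + 1) = lev (int r)" using residue_level_unique(2) unfolding lev_def by metis
  then show "s \<in> block_gens n lev" unfolding block_gens_def mem_Collect_eq using rp(1,3) by metis
next
  fix s assume "s \<in> block_gens n lev"
  then obtain r where r: "s = simple_gen n r" "r \<in> {1..<n}" "lev (int r) = lev (int r + 1)"
    by (auto simp: block_gens_def)
  have n2: "n \<ge> 2" using r by simp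
  have W: "int r \<in> {1..int n}" "int r + 1 \<in> {1..int n}" using r by auto
  have less: "res (int r) < res (int r + 1)" using res_less_iff[OF W r(3)] by simp
  \<comment> \<open>A value strictly between the two images would lie in the opposite block, and
    \<open>res\<close> would send it strictly between r and r+1.\<close>
  have res_succ: "res (int r + 1) = res (int r) + 1"
  proof (rule ccontr)
    assume ne: "res (int r + 1) \<noteq> res (int r) + 1"
    define m where "m = res (int r) + 1"
    have m: "res (int r) < m" "m < res (int r + 1)" using less ne by (auto simp: m_def)
    have mW: "m \<in> {1..int n}" using m res_range[of "int r"] res_range[of "int r + 1"] by auto
    have "lev (res (int r)) \<le> lev m" "lev m \<le> lev (res (int r + 1))"
      using m mW res_range[of "int r"] res_range[of "int r + 1"] by (auto intro!: lev_mono)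
    then have "lev m = lev (res (int r))" "lev m = lev (res (int r + 1))"
      using lev_res[OF W(1)] lev_res[OF W(2)] r(3) by auto
    then have "res (res (int r)) < res m" "res m < res (res (int r + 1))"
      using res_less_iff[OF res_range mW, of "int r"] res_less_iff[OF mW res_range, of "int r + 1"] m by auto
    then show False using res_res[OF W(1)] res_res[OF W(2)] by simp
  qed
  obtain p where p: "res (int r) = int p" using res_range[of "int r"] 
    by (metis atLeastAtMost_iff nonneg_int_cases order_trans zero_le_one)
  have pr: "p \<in> {1..<n}" using res_range[of "int r"] res_range[of "int r + 1"] res_succ p by auto
  have "w (int r + 1) = w (int r) + 1" using res_succ r(3) by (simp add: w_eq)
  moreover have "w (int r) mod int n = int p mod int n" by (simp add: w_eq p)
  ultimately have "w \<circ> simple_gen n r \<circ> w = simple_gen n p"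
    using conj_simple_gen[OF n2, of r p] r(2) by simp
  then have "simple_gen n p j = w (simple_gen n r (w j))" for j by (metis comp_apply)
  then have "simple_gen n r = w \<circ> simple_gen n p \<circ> w" by (simp add: fun_eq_iff w_w)
  then show "s \<in> twisted_gens n w" using r(1,2) pr unfolding twisted_gens_def finite_gens_def by blast
qed


text \<open>The group of fixed points of \<open>x \<mapsto> w x w\<close> restricts isomorphically to the positions of
  non-negative level: an element is free there, and on the block of level \<open>- m\<close> it copies
  its action on the block of level \<open>m\<close>. Inversions in blocks of positive level therefore count twice.\<close>

definition nonneg :: "int set" where "nonneg = {i \<in> {1..int n}. 0 \<le> lev i}"

definition level_weight :: "int \<Rightarrow> nat" where "level_weight m = (if m = 0 then 1 else 2)"

definition double :: "(int \<Rightarrow> int) \<Rightarrow> int \<Rightarrow> int" where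
  "double p i = (if 0 \<le> lev i then p i else res (p (res i)))"

definition extend :: "(int \<Rightarrow> int) \<Rightarrow> int \<Rightarrow> int" where
  "extend p i = double p (residue n i) + int n * level n i"

lemma nonneg_subset: "i \<in> nonneg \<Longrightarrow> i \<in> {1..int n}"
  by (simp add: nonneg_def)

lemma block_perms_nonnegD:
  assumes "p \<in> block_perms lev nonneg" and "i \<in> nonneg"
  shows "p i \<in> nonneg" "lev (p i) = lev i"
  using assms permutes_in_image[of p nonneg i] by (auto simp: block_perms_def)

text \<open>On the block of level 0, \<open>res\<close> is an order-preserving involution, hence
  trivial.\<close>

lemma res_zero:
  assumes "i \<in> {1..int n}" "lev i = 0"
  shows "res i = i"
  using w_eq[of i] res_res[OF assms(1)] res_less_iff[OF assms(1) res_range[of i]]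
    lev_res[OF assms(1)] assms(2) by (metis add.inverse_neutral linorder_neqE_linordered_idom order_less_asym)

lemma res_mem_nonneg: "i \<in> {1..int n} \<Longrightarrow> lev i \<le> 0 \<Longrightarrow> res i \<in> nonneg"
  using res_range lev_res by (simp add: nonneg_def)

lemma double_props:
  assumes p: "p \<in> block_perms lev nonneg" and i: "i \<in> {1..int n}"
  shows "double p i \<in> {1..int n}" "lev (double p i) = lev i"
    "double p (res i) = res (double p i)"
proof -
  note pD = block_perms_nonnegD[OF p]
  consider "lev i > 0" | "lev i = 0" | "lev i < 0" by linarith
  then have "double p i \<in> {1..int n} \<and> lev (double p i) = lev i \<and> double p (res i) = res (double p i)"
  proof cases
    case 1
    then have "i \<in> nonneg" using i by (simp add: nonneg_def)
    then show ?thesis using 1 pD[of i] nonneg_subset lev_res[OF i] res_res[OF i]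
      by (simp add: double_def)
  next
    case 2
    then have "i \<in> nonneg" using i by (simp add: nonneg_def)
    then show ?thesis using 2 pD[of i] nonneg_subset res_zero[OF i] res_zero[of "p i"]
      by (simp add: double_def)
  next
    case 3
    then have ri: "res i \<in> nonneg" using res_mem_nonneg[OF i] by simp
    then have "p (res i) \<in> nonneg" "lev (p (res i)) = - lev i" using pD[OF ri] lev_res[OF i] by simp_all
    then show ?thesis using 3 nonneg_subset[of "p (res i)"] lev_res[OF i] lev_res[of "p (res i)"]
        res_res[of "p (res i)"] res_range by (simp add: double_def)
  qed
  then show "double p i \<in> {1..int n}" "lev (double p i) = lev i"
    "double p (res i) = res (double p i)" by blast+
qed

lemma double_inj:
  assumes p: "p \<in> block_perms lev nonneg"
  shows "inj_on (double p) {1..int n}"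
proof (rule inj_onI)
  fix i j assume i: "i \<in> {1..int n}" and j: "j \<in> {1..int n}" and eq: "double p i = double p j"
  have pinj: "p x = p y \<Longrightarrow> x = y" for x y
    using p permutes_inj[of p nonneg] by (auto simp: block_perms_def inj_def)
  have l: "lev i = lev j" using double_props(2)[OF p i] double_props(2)[OF p j] eq by simp
  show "i = j"
  proof (cases "0 \<le> lev i")
    case True
    then show ?thesis using eq l pinj by (simp add: double_def)
  next
    case False
    then have "p (res i) \<in> nonneg" "p (res j) \<in> nonneg"
      using l block_perms_nonnegD(1)[OF p] res_mem_nonneg i j by simp_all
    moreover have "res (p (res i)) = res (p (res j))" using eq l False by (simp add: double_def)
    ultimately have "p (res i) = p (res j)" using res_res nonneg_subset by metis
    then have "res i = res j" by (rule pinj)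
    then show ?thesis using res_res i j by metis
  qed
qed

lemma extend_window: "i \<in> {1..int n} \<Longrightarrow> extend p (i + int n * t) = double p i + int n * t"
  by (simp add: extend_def residue_level_unique)

lemma extend_window0: "i \<in> {1..int n} \<Longrightarrow> extend p i = double p i"
  using extend_window[of i p 0] by simp

lemma extend_affine_perms:
  assumes p: "p \<in> block_perms lev nonneg"
  shows "extend p \<in> affine_perms n"
proof -
  have dW: "double p i \<in> {1..int n}" if "i \<in> {1..int n}" for i by (rule double_props(1)[OF p that])
  have im: "double p ` {1..int n} = {1..int n}"
    by (rule endo_inj_surj) (use dW double_inj[OF p] in auto)
  have "inj (extend p)"
  proof (rule injI)
    fix x y assume eq: "extend p x = extend p y"
    have r: "residue n x \<in> {1..int n}" "residue n y \<in> {1..int n}" by (rule residue_range[OF n_pos])+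
    have "residue n (extend p x) = double p (residue n x)" "level n (extend p x) = level n x"
      "residue n (extend p y) = double p (residue n y)" "level n (extend p y) = level n y"
      unfolding extend_def using residue_level_unique[OF dW] r by blast+
    then have "residue n x = residue n y" "level n x = level n y"
      using eq double_inj[OF p] r by (auto simp: inj_on_def)
    then show "x = y" using residue_level by metis
  qed
  moreover have "surj (extend p)"
  proof (rule surjI)
    fix y
    define i where "i = inv_into {1..int n} (double p) (residue n y)"
    have "residue n y \<in> double p ` {1..int n}" unfolding im by (rule residue_range[OF n_pos])
    then have i: "i \<in> {1..int n}" "double p i = residue n y"
      unfolding i_def by (rule inv_into_into, rule f_inv_into_f)
    then show "extend p (inv_into {1..int n} (double p) (residue n y) + int n * level n y) = y"
      using extend_window[OF i(1), of p "level n y"] residue_level[of y n] by (simp add: i_def)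
  qed
  moreover have "extend p (x + int n) = extend p x + int n" for x
  proof -
    have r: "residue n x \<in> {1..int n}" by (rule residue_range[OF n_pos])
    have "x + int n = residue n x + int n * (level n x + 1)"
      using residue_level[of x n] by (simp add: algebra_simps)
    then have "extend p (x + int n) = double p (residue n x) + int n * (level n x + 1)"
      by (simp only: extend_window[OF r])
    then show ?thesis by (simp add: extend_def algebra_simps)
  qed
  moreover have "(\<Sum>i = 1..int n. extend p i) = (\<Sum>i = 1..int n. i)"
  proof -
    have "(\<Sum>i = 1..int n. extend p i) = (\<Sum>i = 1..int n. double p i)"
      by (rule sum.cong) (simp_all add: extend_window0)
    also have "\<dots> = (\<Sum>i\<in>double p ` {1..int n}. i)" by (simp add: sum.reindex[OF double_inj[OF p]])
    finally show ?thesis unfolding im .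
  qed
  ultimately show ?thesis by (simp add: affine_perms_def bij_def)
qed

lemma extend_in_group:
  assumes p: "p \<in> block_perms lev nonneg"
  shows "extend p \<in> window_block_group n lev"
  using extend_affine_perms[OF p] double_props[OF p]
  by (simp add: window_block_group_def extend_window0)

lemma extend_fixed:
  assumes p: "p \<in> block_perms lev nonneg"
  shows "w \<circ> extend p \<circ> w = extend p"
proof
  fix x
  obtain i t where x: "x = i + int n * t" and i: "i \<in> {1..int n}" by (rule windowE[OF n_pos])
  note d = double_props[OF p i] and dr = double_props[OF p res_range[of i]]
  have "w x = res i + int n * (lev i + t)" using w_shift[of i t] w_eq[of i] x by (simp add: algebra_simps)
  then have "extend p (w x) = res (double p i) + int n * (lev i + t)"
    by (simp only: extend_window[OF res_range] d(3))
  then have "w (extend p (w x)) = w (res (double p i)) + int n * (lev i + t)" by (simp only: w_shift)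
  also have "w (res (double p i)) = double p i - int n * lev i"
    using w_eq[of "res (double p i)"] res_res[OF d(1)] lev_res[OF d(1)] d(2) by simp
  finally show "(w \<circ> extend p \<circ> w) x = extend p x"
    using x extend_window[OF i, of p t] by (simp add: algebra_simps)
qed

lemma fixed_commutes_res:
  assumes x: "x \<in> window_block_group n lev" and fixed: "w \<circ> x \<circ> w = x" and i: "i \<in> {1..int n}"
  shows "x (res i) = res (x i)"
proof -
  have xa: "x \<in> affine_perms n" and xi: "x i \<in> {1..int n}" "lev (x i) = lev i"
    using x i by (simp_all add: window_block_group_def)
  have "w (x i) = x (w i)" using fixed by (metis comp_apply w_w)
  then have "w (x i) = x (res i + int n * lev i)" by (simp only: w_eq[of i])
  then have "res (x i) + int n * lev i = x (res i) + int n * lev i"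
    using w_eq[of "x i"] xi(2) affine_permsD(3)[OF xa] by simp
  then show ?thesis by simp
qed

text \<open>All inversions stay inside blocks. \<open>res\<close> matches those of a negative block
  with those of the opposite positive block, so the negative part can be folded into the weight
  2.\<close>

lemma inv_number_fixed:
  assumes x: "x \<in> window_block_group n lev" and fixed: "w \<circ> x \<circ> w = x"
  shows "inv_number n x = weighted_inversions (\<lambda>i. level_weight (lev i)) nonneg x"
proof -
  have xW: "x i \<in> {1..int n}" "lev (x i) = lev i" if "i \<in> {1..int n}" for i
    using x that by (simp_all add: window_block_group_def)
  note xr = fixed_commutes_res[OF x fixed]
  let ?N = "\<lambda>i. card {j \<in> {1..int n}. i < j \<and> x j < x i}"
  have same: "lev j = lev i" if "i \<in> {1..int n}" "j \<in> {1..int n}" "i < j" "x j < x i" for i j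
    using lev_mono[of i j] lev_mono[of "x j" "x i"] xW that by force
  have N_res: "?N (res i) = ?N i" if i: "i \<in> {1..int n}" for i
  proof -
    have bij: "bij_betw res {j \<in> {1..int n}. i < j \<and> x j < x i} {j \<in> {1..int n}. res i < j \<and> x j < x (res i)}"
    proof (rule bij_betw_byWitness[where f' = res])
      have step: "res j \<in> {1..int n} \<and> res k < res j \<and> x (res j) < x (res k)"
        if k: "k \<in> {1..int n}" and j: "j \<in> {1..int n}" "k < j" "x j < x k" for k j
        using same[OF k j] res_less_iff[OF k j(1)] res_range xr[OF j(1)] xr[OF k]
          res_less_iff[OF xW(1)[OF j(1)] xW(1)[OF k]] xW(2)[OF k] xW(2)[OF j(1)] j by simp
      then show "res ` {j \<in> {1..int n}. i < j \<and> x j < x i} \<subseteq> {j \<in> {1..int n}. res i < j \<and> x j < x (res i)}"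
        using i by blast
      show "res ` {j \<in> {1..int n}. res i < j \<and> x j < x (res i)} \<subseteq> {j \<in> {1..int n}. i < j \<and> x j < x i}"
        using step[OF res_range[of i]] res_res[OF i] by auto
    qed (simp_all add: res_res)
    then show ?thesis by (rule bij_betw_same_card[symmetric])
  qed
  have N_nonneg: "?N i = card {j \<in> nonneg. i < j \<and> x j < x i}" if "i \<in> nonneg" for i
  proof -
    have "0 \<le> lev j" if "j \<in> {1..int n}" "i < j" for j
      using \<open>i \<in> nonneg\<close> lev_mono[of i j] that by (simp add: nonneg_def)
    then have "{j \<in> {1..int n}. i < j \<and> x j < x i} = {j \<in> nonneg. i < j \<and> x j < x i}"
      by (auto simp: nonneg_def)
    then show ?thesis by simp
  qed
  let ?P = "{i \<in> {1..int n}. 0 < lev i}" and ?M = "{i \<in> {1..int n}. lev i < 0}"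
    and ?Z = "{i \<in> {1..int n}. lev i = 0}"
  have fin: "finite ?P" "finite ?M" "finite ?Z" by (rule finite_Collect_conjI, simp)+
  have "(\<Sum>i\<in>?M. ?N i) = (\<Sum>i\<in>?P. ?N i)"
    by (rule sum.reindex_bij_witness[where i = res and j = res])
      (use res_range lev_res res_res N_res in auto)
  moreover have "{1..int n} = ?M \<union> (?Z \<union> ?P)" by auto
  then have "(\<Sum>i\<in>{1..int n}. ?N i) = (\<Sum>i\<in>?M \<union> (?Z \<union> ?P). ?N i)" by (rule arg_cong)
  moreover have "\<dots> = (\<Sum>i\<in>?M. ?N i) + ((\<Sum>i\<in>?Z. ?N i) + (\<Sum>i\<in>?P. ?N i))"
    using fin by (subst sum.union_disjoint, simp, simp, force, subst sum.union_disjoint) auto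
  moreover have "nonneg = ?Z \<union> ?P" by (auto simp: nonneg_def)
  then have "(\<Sum>i\<in>nonneg. level_weight (lev i) * ?N i) = (\<Sum>i\<in>?Z \<union> ?P. level_weight (lev i) * ?N i)"
    by (rule arg_cong)
  moreover have "\<dots> = (\<Sum>i\<in>?Z. level_weight (lev i) * ?N i) + (\<Sum>i\<in>?P. level_weight (lev i) * ?N i)"
    using fin by (subst sum.union_disjoint) auto
  moreover have "(\<Sum>i\<in>?Z. level_weight (lev i) * ?N i) = (\<Sum>i\<in>?Z. ?N i)"
    by (rule sum.cong) (simp_all add: level_weight_def)
  moreover have "(\<Sum>i\<in>?P. level_weight (lev i) * ?N i) = 2 * (\<Sum>i\<in>?P. ?N i)"
    unfolding sum_distrib_left by (rule sum.cong) (auto simp: level_weight_def)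
  moreover have "weighted_inversions (\<lambda>i. level_weight (lev i)) nonneg x = (\<Sum>i\<in>nonneg. level_weight (lev i) * ?N i)"
    unfolding weighted_inversions_def by (rule sum.cong) (simp_all only: N_nonneg)
  moreover have "inv_number n x = (\<Sum>i\<in>{1..int n}. ?N i)"
    unfolding inv_number_window_block_group[OF n_pos x] weighted_inversions_def by simp
  ultimately show ?thesis by linarith
qed

lemma twisted_poincare_block_perms:
  fixes q :: "'a::comm_semiring_1"
  shows "twisted_poincare n w q =
    (\<Sum>p\<in>block_perms lev nonneg. q ^ weighted_inversions (\<lambda>i. level_weight (lev i)) nonneg p)"
proof -
  let ?X = "{x. x \<in> window_block_group n lev \<and> w \<circ> x \<circ> w = x}"
  let ?W = "weighted_inversions (\<lambda>i. level_weight (lev i)) nonneg"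
  have gen: "generate (affine_sym n) (block_gens n lev) = window_block_group n lev"
    by (rule generate_block_gens[OF n_pos]) (rule lev_mono)
  have "twisted_poincare n w q = (\<Sum>x\<in>?X. q ^ cox_length n x)"
    unfolding twisted_poincare_def twisted_gens_eq gen ..
  also have "\<dots> = (\<Sum>x\<in>?X. q ^ ?W x)"
  proof (rule sum.cong)
    fix x assume "x \<in> ?X"
    then have x: "x \<in> window_block_group n lev" "w \<circ> x \<circ> w = x" by blast+
    then have "x \<in> affine_perms n" by (simp add: window_block_group_def)
    then show "q ^ cox_length n x = q ^ ?W x"
      using cox_length_eq_inv_number[OF n_pos] inv_number_fixed[OF x] by simp
  qed simp
  also have "\<dots> = (\<Sum>p\<in>block_perms lev nonneg. q ^ ?W p)"
  proof (rule sum.reindex_bij_witness[where i = extend and j = "\<lambda>x i. if i \<in> nonneg then x i else i"])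
    fix x assume "x \<in> ?X"
    then have x: "x \<in> window_block_group n lev" "w \<circ> x \<circ> w = x" by blast+
    \<comment> \<open>Restriction to \<open>nonneg\<close>, set to the identity elsewhere because
      \<open>permutes\<close> asks for that default.\<close>
    define p where "p = (\<lambda>i. if i \<in> nonneg then x i else i)"
    have xW: "x i \<in> {1..int n}" "lev (x i) = lev i" if "i \<in> {1..int n}" for i
      using x(1) that by (simp_all add: window_block_group_def)
    have xa: "x \<in> affine_perms n" using x(1) by (simp add: window_block_group_def)
    have fin: "finite nonneg" unfolding nonneg_def by (rule finite_Collect_conjI) simp
    have im: "x ` nonneg \<subseteq> nonneg" using xW by (auto simp: nonneg_def)
    have inj: "inj_on x nonneg" by (auto simp: inj_on_def affine_permsD(4)[OF xa])
    have "bij_betw p nonneg nonneg"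
      unfolding bij_betw_def p_def using inj endo_inj_surj[OF fin im inj] by (simp add: inj_on_def image_def)
    then have "p permutes nonneg" by (rule bij_imp_permutes) (simp add: p_def)
    then have p: "p \<in> block_perms lev nonneg"
      using xW(2)[OF nonneg_subset] by (simp add: block_perms_def p_def)
    then show "(\<lambda>i. if i \<in> nonneg then x i else i) \<in> block_perms lev nonneg" by (simp only: p_def)
    have dbl: "double p i = x i" if i: "i \<in> {1..int n}" for i
    proof (cases "0 \<le> lev i")
      case True
      then show ?thesis using i by (simp add: double_def p_def nonneg_def)
    next
      case False
      then have "res i \<in> nonneg" using res_mem_nonneg[OF i] by simp
      then have "double p i = res (x (res i))" using False by (simp add: double_def p_def)
      then show ?thesis using fixed_commutes_res[OF x i] res_res[OF xW(1)[OF i]] by simp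
    qed
    have "extend p y = x y" for y
      using dbl[OF residue_range[OF n_pos, of y]] residue_level[of y n] affine_permsD(3)[OF xa]
      unfolding extend_def by metis
    then show "extend (\<lambda>i. if i \<in> nonneg then x i else i) = x" by (simp add: p_def fun_eq_iff)
    have "card {j \<in> nonneg. i < j \<and> p j < p i} = card {j \<in> nonneg. i < j \<and> x j < x i}" if "i \<in> nonneg" for i
      using that by (intro arg_cong[of _ _ card]) (auto simp: p_def)
    then have "?W p = ?W x" unfolding weighted_inversions_def by simp
    then show "q ^ ?W (\<lambda>i. if i \<in> nonneg then x i else i) = q ^ ?W x" by (simp only: p_def)
  next
    fix p assume p: "p \<in> block_perms lev nonneg"
    show "extend p \<in> ?X" using extend_in_group[OF p] extend_fixed[OF p] by blast
    have "p i = i" if "i \<notin> nonneg" for i using p that by (auto simp: block_perms_def permutes_def)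
    moreover have "extend p i = p i" if "i \<in> nonneg" for i
      using that extend_window0[OF nonneg_subset[OF that], of p] by (simp add: double_def nonneg_def)
    ultimately show "(\<lambda>i. if i \<in> nonneg then extend p i else i) = p" by auto
  qed
  finally show ?thesis .
qed

text \<open>Puts the index set into the interval form that
  \<open>block_perms_generating_function\<close> expects.\<close>

lemma nonneg_interval: "nonneg = {int (card {i \<in> {1..int n}. lev i < 0}) + 1..int n}"
proof -
  have "{i \<in> {1..int n}. lev i < 0} = {1..int (card {i \<in> {1..int n}. lev i < 0})}"
    by (rule sublevel_eq_interval) (rule lev_mono)
  moreover have "nonneg = {1..int n} - {i \<in> {1..int n}. lev i < 0}" by (auto simp: nonneg_def)
  ultimately show ?thesis by force
qed

lemma twisted_poincare_eq:
  fixes q :: "'a::comm_semiring_1"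
  shows "twisted_poincare n w q =
    (\<Prod>j\<in>nonneg. \<Sum>t<card {i \<in> nonneg. i \<le> j \<and> lev i = lev j}. (q ^ level_weight (lev j)) ^ t)"
proof -
  let ?l = "int (card {i \<in> {1..int n}. lev i < 0}) + 1"
  have mono: "lev i \<le> lev j" if "?l \<le> i" "i \<le> j" "j \<le> int n" for i j
    using that by (intro lev_mono) auto
  have "{i \<in> nonneg. i \<le> j \<and> lev i = lev j} = {i \<in> {?l..j}. lev i = lev j}" if "j \<in> nonneg" for j
    using that unfolding nonneg_interval by auto
  then show ?thesis
    unfolding twisted_poincare_block_perms
    using block_perms_generating_function[of ?l "int n" lev q level_weight, OF mono]
    unfolding nonneg_interval[symmetric] by simp
qed

end

lemma minimal_involution_id: "n > 0 \<Longrightarrow> minimal_involution n id"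
  using id_affine_perms[of n] by (unfold_locales) (auto simp: involutions_def)

text \<open>The whole finite group is the twisted case of \<open>w = id\<close>: a single block of
  level 0, and every element is fixed under conjugation by the identity.\<close>

lemma poincare_eq:
  fixes q :: "'a::comm_semiring_1"
  assumes n: "n > 0"
  shows "poincare n q = (\<Prod>j = 1..n. \<Sum>t<j. q ^ t)"
proof -
  interpret minimal_involution n id by (rule minimal_involution_id[OF n])
  have lev0: "lev i = 0" if "i \<in> {1..int n}" for i
    using that level_id by (simp add: lev_def)
  have nn: "nonneg = {1..int n}" using lev0 by (auto simp: nonneg_def)
  have "poincare n q = twisted_poincare n id q"
    by (simp add: poincare_def twisted_poincare_def twisted_gens_def)
  also have "\<dots> = (\<Prod>j\<in>{1..int n}. \<Sum>t<nat j. q ^ t)"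
    unfolding twisted_poincare_eq nn
  proof (rule prod.cong)
    fix j assume j: "j \<in> {1..int n}"
    have "{i \<in> {1..int n}. i \<le> j \<and> lev i = lev j} = {1..j}" using lev0 j by auto
    then show "(\<Sum>t<card {i \<in> {1..int n}. i \<le> j \<and> lev i = lev j}. (q ^ level_weight (lev j)) ^ t) = (\<Sum>t<nat j. q ^ t)"
      using lev0[OF j] by (simp add: level_weight_def)
  qed simp
  also have "\<dots> = (\<Prod>j = 1..n. \<Sum>t<j. q ^ t)"
    by (rule prod.reindex_bij_witness[where i = int and j = nat]) auto
  finally show ?thesis .
qed

section \<open>Level functions of minimal involutions\<close>

lemma finite_window: "finite {i \<in> {1..int n}. P i}"
  by (rule finite_Collect_conjI) simp

definition sublevel_count :: "nat \<Rightarrow> (int \<Rightarrow> int) \<Rightarrow> int \<Rightarrow> int" where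
  "sublevel_count n c m = int (card {i \<in> {1..int n}. c i < m})"

lemma sublevel_count_range: "0 \<le> sublevel_count n c m" "sublevel_count n c m \<le> int n"
proof -
  have "card {i \<in> {1..int n}. c i < m} \<le> card {1..int n}" by (rule card_mono) auto
  then show "sublevel_count n c m \<le> int n" by (simp add: sublevel_count_def)
qed (simp add: sublevel_count_def)

lemma less_iff_le_sublevel_count:
  assumes mono: "\<And>i j. 1 \<le> i \<Longrightarrow> i \<le> j \<Longrightarrow> j \<le> int n \<Longrightarrow> c i \<le> c j" and i: "i \<in> {1..int n}"
  shows "c i < m \<longleftrightarrow> i \<le> sublevel_count n c m"
proof -
  have "{i \<in> {1..int n}. c i < m} = {1..int (card {i \<in> {1..int n}. c i < m})}"
    by (rule sublevel_eq_interval) (rule mono)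
  then have "i \<in> {i \<in> {1..int n}. c i < m} \<longleftrightarrow> i \<in> {1..sublevel_count n c m}"
    unfolding sublevel_count_def by (rule arg_cong)
  then show ?thesis using i by simp
qed

lemma sublevel_count_compl:
  "sublevel_count n c (m + 1) + int (card {i \<in> {1..int n}. m < c i}) = int n"
proof -
  have "card {i \<in> {1..int n}. c i < m + 1} + card {i \<in> {1..int n}. m < c i}
      = card ({i \<in> {1..int n}. c i < m + 1} \<union> {i \<in> {1..int n}. m < c i})"
    by (rule card_Un_disjoint[symmetric, OF finite_window finite_window]) auto
  also have "{i \<in> {1..int n}. c i < m + 1} \<union> {i \<in> {1..int n}. m < c i} = {1..int n}" by auto
  finally show ?thesis by (simp add: sublevel_count_def)
qed

text \<open>The value 0 outside the window makes a profile a unique function, and the bound M makes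
  the set finite. For the profile of a minimal involution, the last condition says that the absolute
  length is k.\<close>

definition level_profiles :: "nat \<Rightarrow> nat \<Rightarrow> nat \<Rightarrow> (int \<Rightarrow> int) set" where
  "level_profiles n k M = {c. (\<forall>i. i \<notin> {1..int n} \<longrightarrow> c i = 0) \<and>
     (\<forall>i j. 1 \<le> i \<longrightarrow> i \<le> j \<longrightarrow> j \<le> int n \<longrightarrow> c i \<le> c j) \<and>
     (\<forall>i \<in> {1..int n}. c (int n + 1 - i) = - c i) \<and>
     (\<forall>i \<in> {1..int n}. c i \<le> int M) \<and>
     (\<forall>i \<in> {1..int n}. 0 < c i \<longleftrightarrow> int n - int k < i)}"

lemma level_profilesD:
  assumes "c \<in> level_profiles n k M"
  shows "i \<notin> {1..int n} \<Longrightarrow> c i = 0" "1 \<le> i \<Longrightarrow> i \<le> j \<Longrightarrow> j \<le> int n \<Longrightarrow> c i \<le> c j"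
    "i \<in> {1..int n} \<Longrightarrow> c (int n + 1 - i) = - c i" "i \<in> {1..int n} \<Longrightarrow> c i \<le> int M"
    "i \<in> {1..int n} \<Longrightarrow> 0 < c i \<longleftrightarrow> int n - int k < i"
  using assms unfolding level_profiles_def mem_Collect_eq by blast+

text \<open>Subtracting the count below \<open>c i\<close> gives the rank of i within its block, and
  adding the count below \<open>- c i\<close> moves to the same rank in the opposite block. Outside
  the window it is extended by translation.\<close>

definition build_involution :: "nat \<Rightarrow> (int \<Rightarrow> int) \<Rightarrow> int \<Rightarrow> int" where
  "build_involution n c i = residue n i
     + sublevel_count n c (- c (residue n i)) - sublevel_count n c (c (residue n i))
     + int n * (c (residue n i) + level n i)"

definition profile :: "nat \<Rightarrow> (int \<Rightarrow> int) \<Rightarrow> int \<Rightarrow> int" where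
  "profile n w i = (if i \<in> {1..int n} then level n (w i) else 0)"

lemma build_involution_props:
  assumes n: "n > 0" and c: "c \<in> level_profiles n k M"
  shows "minimal_involution n (build_involution n c)" "profile n (build_involution n c) = c"
proof -
  note cD = level_profilesD[OF c]
  let ?L = "sublevel_count n c"
  let ?w = "build_involution n c"
  define a where "a i = i + ?L (- c i) - ?L (c i)" for i
  \<comment> \<open>Used at m and at -m, this shows that opposite blocks have the same size, so a
    rank in one is a rank in the other.\<close>
  have sym: "?L (m + 1) = int n - ?L (- m)" for m
  proof -
    have "card {i \<in> {1..int n}. m < c i} = card {i \<in> {1..int n}. c i < - m}"
    proof (rule bij_betw_same_card[of "\<lambda>i. int n + 1 - i"], rule bij_betw_byWitness[where f' = "\<lambda>i. int n + 1 - i"])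
      show "(\<lambda>i. int n + 1 - i) ` {i \<in> {1..int n}. m < c i} \<subseteq> {i \<in> {1..int n}. c i < - m}"
        "(\<lambda>i. int n + 1 - i) ` {i \<in> {1..int n}. c i < - m} \<subseteq> {i \<in> {1..int n}. m < c i}"
        using cD(3) by force+
    qed simp_all
    then show ?thesis using sublevel_count_compl[of n c m] by (simp add: sublevel_count_def)
  qed
  have less: "c i < m \<longleftrightarrow> i \<le> ?L m" if "i \<in> {1..int n}" for i m
    by (rule less_iff_le_sublevel_count[OF cD(2) that])
  have eq: "c i = m \<longleftrightarrow> ?L m < i \<and> i \<le> ?L (m + 1)" if "i \<in> {1..int n}" for i m
    using less[OF that, of m] less[OF that, of "m + 1"] by linarith
  have aW: "a i \<in> {1..int n}" and ca: "c (a i) = - c i" and aa: "a (a i) = i"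
    if i: "i \<in> {1..int n}" for i
  proof -
    have i': "?L (c i) < i" "i \<le> ?L (c i + 1)" using eq[OF i, of "c i"] by auto
    have b: "?L (- c i) < a i" "a i \<le> ?L (- c i + 1)"
      using i' sym[of "c i"] sym[of "- c i"] by (simp_all add: a_def)
    then show W: "a i \<in> {1..int n}"
      using sublevel_count_range[of n c "- c i"] sublevel_count_range[of n c "- c i + 1"] by simp
    show C: "c (a i) = - c i" using eq[OF W] b by simp
    have "a (a i) = a i + ?L (- c (a i)) - ?L (c (a i))" by (rule a_def)
    then show "a (a i) = i" unfolding C by (simp add: a_def)
  qed
  have w_eq: "?w (i + int n * t) = a i + int n * (c i + t)" if "i \<in> {1..int n}" for i t
    by (simp add: build_involution_def residue_level_unique[OF that] a_def)
  have w_eq0: "?w i = a i + int n * c i" if "i \<in> {1..int n}" for i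
    using w_eq[OF that, of 0] by simp
  have ww: "?w (?w x) = x" for x
  proof -
    obtain i t where x: "x = i + int n * t" and i: "i \<in> {1..int n}" by (rule windowE[OF n])
    show ?thesis unfolding x w_eq[OF i] w_eq[OF aW[OF i]] aa[OF i] ca[OF i] by simp
  qed
  have shift: "?w (x + int n) = ?w x + int n" for x
  proof -
    obtain i t where x: "x = i + int n * t" and i: "i \<in> {1..int n}" by (rule windowE[OF n])
    have xn: "x + int n = i + int n * (t + 1)" by (simp add: x algebra_simps)
    show ?thesis unfolding xn w_eq[OF i] unfolding x w_eq[OF i] by (simp add: algebra_simps)
  qed
  have comp: "?w \<circ> ?w = id" by (simp add: fun_eq_iff ww)
  then have "?w \<in> involutions n" using affine_permsI_involution[OF n comp shift] by (simp add: involutions_def)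
  moreover have "?w i < ?w j" if "1 \<le> i" "i < j" "j \<le> int n" for i j
  proof -
    have i: "i \<in> {1..int n}" and j: "j \<in> {1..int n}" using that by auto
    show ?thesis
    proof (cases "c i = c j")
      case True
      then show ?thesis using w_eq0[OF i] w_eq0[OF j] that by (simp add: a_def)
    next
      case False
      then have "c i + 1 \<le> c j" using cD(2)[of i j] that by simp
      then have "int n * (c i + 1) \<le> int n * c j" by (intro mult_left_mono) simp_all
      then show ?thesis using w_eq0[OF i] w_eq0[OF j] aW[OF i] aW[OF j] by (simp add: algebra_simps)
    qed
  qed
  ultimately show "minimal_involution n ?w" using n by unfold_locales
  have "profile n ?w i = c i" for i
  proof (cases "i \<in> {1..int n}")
    case True
    then show ?thesis using residue_level_unique(2)[OF aW[OF True], of "c i"] w_eq0[OF True]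
      by (simp add: profile_def)
  next
    case False
    then show ?thesis using cD(1)[OF False] by (auto simp: profile_def)
  qed
  then show "profile n ?w = c" by blast
qed

lemma window_diff_less_mult_iff:
  assumes "x \<in> {1..int n}" "y \<in> {1..int n}"
  shows "x - y < int n * d \<longleftrightarrow> (if x < y then 0 \<le> d else 1 \<le> d)"
proof -
  consider "d \<le> - 1" | "d = 0" | "1 \<le> d" by linarith
  then show ?thesis
  proof cases
    case 1
    then have "int n * d \<le> int n * (- 1)" by (intro mult_left_mono) simp_all
    moreover have "y \<le> int n" "1 \<le> x" using assms by simp_all
    ultimately have "\<not> x - y < int n * d" by linarith
    then show ?thesis using 1 by simp
  next
    case 3
    then have "int n * 1 \<le> int n * d" by (intro mult_left_mono) simp_all
    moreover have "x \<le> int n" "1 \<le> y" using assms by simp_all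
    ultimately have "x - y < int n * d" by linarith
    then show ?thesis using 3 by simp
  qed (use assms in auto)
qed

context minimal_involution
begin

lemma lev_less_iff: "i \<in> {1..int n} \<Longrightarrow> lev i < m \<longleftrightarrow> i \<le> sublevel_count n lev m"
  by (rule less_iff_le_sublevel_count) (rule lev_mono)

lemma card_superlevel: "card {i \<in> {1..int n}. m < lev i} = card {i \<in> {1..int n}. lev i < - m}"
proof (rule bij_betw_same_card[of res], rule bij_betw_byWitness[where f' = res])
  show "res ` {i \<in> {1..int n}. m < lev i} \<subseteq> {i \<in> {1..int n}. lev i < - m}"
    "res ` {i \<in> {1..int n}. lev i < - m} \<subseteq> {i \<in> {1..int n}. m < lev i}"
    using lev_res res_range by force+
qed (simp_all add: res_res)

text \<open>\<open>res\<close> alone only shows that opposite blocks are equally large. As sublevel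
  sets are initial segments of the window, equal counts become a reflection of positions.\<close>

lemma lev_reflect:
  assumes i: "i \<in> {1..int n}"
  shows "lev (int n + 1 - i) = - lev i"
proof -
  have i': "int n + 1 - i \<in> {1..int n}" using i by auto
  have "m < lev i \<longleftrightarrow> lev (int n + 1 - i) < - m" for m
    using lev_less_iff[OF i, of "m + 1"] lev_less_iff[OF i', of "- m"]
      sublevel_count_compl[of n lev m] card_superlevel[of m]
    unfolding sublevel_count_def by linarith
  \<comment> \<open>The two thresholds bound the level of the reflected point from both
    sides.\<close>
  from this[of "lev i"] this[of "lev i - 1"] show ?thesis by linarith
qed

text \<open>The rank of \<open>res i\<close> in the window is counted: \<open>res\<close> reverses
  the order of levels and keeps the order inside a block, so below it lie the levels under
  \<open>- lev i\<close> together with the predecessors of i in its block.\<close>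

lemma res_eq:
  assumes i: "i \<in> {1..int n}"
  shows "res i = i + sublevel_count n lev (- lev i) - sublevel_count n lev (lev i)"
proof -
  let ?E = "{j \<in> {1..int n}. lev j = lev i \<and> j \<le> i}"
  have "{1..i} = {j \<in> {1..int n}. lev j < lev i} \<union> ?E"
  proof (intro Set.set_eqI iffI)
    fix j assume "j \<in> {1..i}"
    then show "j \<in> {j \<in> {1..int n}. lev j < lev i} \<union> ?E" using i lev_mono[of j i] by auto
  next
    fix j assume j: "j \<in> {j \<in> {1..int n}. lev j < lev i} \<union> ?E"
    then have "j \<le> i" using lev_mono[of i j] i by fastforce
    then show "j \<in> {1..i}" using j by auto
  qed
  moreover have "card ({j \<in> {1..int n}. lev j < lev i} \<union> ?E) = card {j \<in> {1..int n}. lev j < lev i} + card ?E"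
    by (rule card_Un_disjoint[OF finite_window finite_window]) auto
  moreover have card_i: "int (card {1..i}) = i" using i by simp
  ultimately have "card {1..i} = card {j \<in> {1..int n}. lev j < lev i} + card ?E" by (simp only:)
  then have "i = sublevel_count n lev (lev i) + int (card ?E)"
    unfolding sublevel_count_def using card_i by linarith
  moreover have "res i = sublevel_count n lev (- lev i) + int (card ?E)"
  proof -
    have le: "res j \<le> res i \<longleftrightarrow> lev i < lev j \<or> (lev j = lev i \<and> j \<le> i)" if j: "j \<in> {1..int n}" for j
    proof (cases "lev i = lev j")
      case True
      then show ?thesis using res_less_iff[OF i j] by auto
    next
      case False
      have "lev (res j) \<le> lev (res i)" if "res j \<le> res i" using lev_mono[of "res j" "res i"] that res_range[of i] res_range[of j] by simp
      moreover have "lev (res i) \<le> lev (res j)" if "res i \<le> res j" using lev_mono[of "res i" "res j"] that res_range[of i] res_range[of j] by simp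
      ultimately show ?thesis using False lev_res[OF i] lev_res[OF j] by linarith
    qed
    have "{1..res i} = res ` ({j \<in> {1..int n}. lev i < lev j} \<union> ?E)"
    proof (intro Set.set_eqI iffI)
      fix y assume "y \<in> {1..res i}"
      then have y: "y \<in> {1..int n}" "y \<le> res i" using res_range[of i] by auto
      then have "res (res y) \<le> res i" by (simp add: res_res)
      then show "y \<in> res ` ({j \<in> {1..int n}. lev i < lev j} \<union> ?E)"
        using le[OF res_range[of y]] res_range[of y] by (intro image_eqI[of _ _ "res y"] res_res[OF y(1), symmetric]) blast
    next
      fix y assume "y \<in> res ` ({j \<in> {1..int n}. lev i < lev j} \<union> ?E)"
      then obtain j where "y = res j" "j \<in> {1..int n}" "lev i < lev j \<or> (lev j = lev i \<and> j \<le> i)" by auto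
      then show "y \<in> {1..res i}" using le res_range[of j] by simp
    qed
    moreover have "inj_on res ({j \<in> {1..int n}. lev i < lev j} \<union> ?E)"
      by (rule inj_on_inverseI[where g = res]) (auto simp: res_res)
    ultimately have "card {1..res i} = card ({j \<in> {1..int n}. lev i < lev j} \<union> ?E)"
      by (simp only: card_image)
    also have "\<dots> = card {j \<in> {1..int n}. lev i < lev j} + card ?E"
      by (rule card_Un_disjoint[OF finite_window finite_window]) auto
    finally have "card {1..res i} = card {j \<in> {1..int n}. lev j < - lev i} + card ?E"
      by (simp only: card_superlevel)
    moreover have "int (card {1..res i}) = res i" using res_range[of i] by simp
    ultimately show ?thesis unfolding sublevel_count_def by linarith
  qed
  ultimately show ?thesis by linarith
qed

lemma build_involution_profile: "build_involution n (profile n w) = w"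
proof
  fix x
  obtain i t where x: "x = i + int n * t" and i: "i \<in> {1..int n}" by (rule windowE[OF n_pos])
  have p: "profile n w j = lev j" if "j \<in> {1..int n}" for j using that by (simp add: profile_def lev_def)
  have "{j \<in> {1..int n}. profile n w j < m} = {j \<in> {1..int n}. lev j < m}" for m using p by auto
  then have "sublevel_count n (profile n w) m = sublevel_count n lev m" for m
    by (simp add: sublevel_count_def)
  then have "build_involution n (profile n w) x = res i + int n * (lev i + t)"
    using res_eq[OF i] p[OF i] by (simp add: build_involution_def x residue_level_unique[OF i])
  also have "\<dots> = w x" using w_shift[of i t] w_eq[of i] x by (simp add: algebra_simps)
  finally show "build_involution n (profile n w) x = w x" .
qed

lemma moved_count_eq: "moved_count n w = 2 * card {i \<in> {1..int n}. lev i < 0}"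
proof -
  have moved: "w i \<noteq> i \<longleftrightarrow> lev i \<noteq> 0" if "i \<in> {1..int n}" for i
  proof
    show "lev i \<noteq> 0" if "w i \<noteq> i"
      using that res_zero[OF \<open>i \<in> {1..int n}\<close>] w_eq[of i] by fastforce
    show "w i \<noteq> i" if "lev i \<noteq> 0"
      using that level_id[OF \<open>i \<in> {1..int n}\<close>] unfolding lev_def by metis
  qed
  have "moved_count n w = card {i \<in> {1..int n}. w i \<noteq> i}"
    by (simp add: moved_count_def sum_of_bool_eq Int_def)
  also have "{i \<in> {1..int n}. w i \<noteq> i} = {i \<in> {1..int n}. lev i < 0} \<union> {i \<in> {1..int n}. 0 < lev i}"
    using moved by force
  also have "card \<dots> = card {i \<in> {1..int n}. lev i < 0} + card {i \<in> {1..int n}. 0 < lev i}"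
    by (rule card_Un_disjoint[OF finite_window finite_window]) auto
  finally show ?thesis using card_superlevel[of 0] by simp
qed

lemma abs_length_iff:
  assumes "k \<le> n"
  shows "abs_length n w = k \<longleftrightarrow> (\<forall>i \<in> {1..int n}. 0 < lev i \<longleftrightarrow> int n - int k < i)"
proof -
  define K where "K = card {i \<in> {1..int n}. lev i < 0}"
  have Kn: "K \<le> n" using sublevel_count_range(2)[of n lev 0] by (simp add: K_def sublevel_count_def)
  have "0 < lev i \<longleftrightarrow> int n - int K < i" if i: "i \<in> {1..int n}" for i
  proof -
    have "int n + 1 - i \<in> {1..int n}" using i by auto
    from lev_less_iff[OF this, of 0] lev_reflect[OF i] show ?thesis
      by (auto simp: sublevel_count_def K_def)
  qed
  moreover have "abs_length n w = K"
    unfolding abs_length_eq[OF n_pos invol] moved_count_eq K_def by simp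
  moreover have "K = k" if "\<forall>i \<in> {1..int n}. int n - int K < i \<longleftrightarrow> int n - int k < i"
  proof (rule ccontr)
    assume ne: "K \<noteq> k"
    \<comment> \<open>The position at which the thresholds n - K and n - k disagree; it lies in the
      window because the smaller of two distinct numbers up to n is below n.\<close>
    define i where "i = int n - int (min K k)"
    have "i \<in> {1..int n}" using ne Kn assms by (auto simp: i_def)
    with that have "int n - int K < i \<longleftrightarrow> int n - int k < i" by blast
    then show False using ne by (auto simp: i_def min_def split: if_splits)
  qed
  ultimately show ?thesis by auto
qed

lemma profile_in_level_profiles:
  assumes "k \<le> n" and "abs_length n w = k" and "\<And>i. i \<in> {1..int n} \<Longrightarrow> lev i \<le> int M"
  shows "profile n w \<in> level_profiles n k M"
proof -
  have p: "profile n w j = lev j" if "j \<in> {1..int n}" for j using that by (simp add: profile_def lev_def)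
  have "int n + 1 - i \<in> {1..int n}" if "i \<in> {1..int n}" for i using that by auto
  then show ?thesis
    using assms abs_length_iff[OF assms(1)] lev_mono lev_reflect p
    unfolding level_profiles_def mem_Collect_eq
    by (intro conjI allI impI ballI) (auto simp: profile_def[of n w "_"] simp flip: lev_def)
qed

text \<open>Write the right index as j + nt. An increasing window gives the lower limit for t, and
  the order of the residues gives the upper one: if \<open>lev j < lev i\<close>, then j < i and
  \<open>res j > res i\<close>, which leaves exactly t from 1 to \<open>lev i - lev j - 1\<close>;
  otherwise nothing remains.\<close>

lemma inv_number_eq: "inv_number n w = (\<Sum>i = 1..int n. \<Sum>j = 1..int n. nat (lev i - lev j - 1))"
  unfolding inv_number_def
proof (rule sum.cong)
  fix i assume i: "i \<in> {1..int n}"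
  let ?T = "\<lambda>j. {t. i < j + int n * t \<and> w j + int n * t < w i}"
  have T: "?T j = {1..lev i - lev j - 1}" if j: "j \<in> {1..int n}" for j
  proof (rule Set.set_eqI)
    fix t
    have "i < j + int n * t \<longleftrightarrow> i - j < int n * t" by linarith
    then have lo: "i < j + int n * t \<longleftrightarrow> (if i < j then 0 \<le> t else 1 \<le> t)"
      unfolding window_diff_less_mult_iff[OF i j] .
    define d where "d = lev i - lev j - t"
    have "w j + int n * t < w i \<longleftrightarrow> res j - res i < int n * d"
      by (simp add: w_eq d_def algebra_simps)
    also have "\<dots> \<longleftrightarrow> (if res j < res i then 0 \<le> d else 1 \<le> d)"
      by (rule window_diff_less_mult_iff[OF res_range res_range])
    finally have hi: "w j + int n * t < w i \<longleftrightarrow> (if res j < res i then 0 \<le> d else 1 \<le> d)" .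
    have r: "lev i = lev j \<Longrightarrow> res j < res i \<longleftrightarrow> j < i" using res_less_iff[OF j i] by simp
    have r': "lev j < lev i \<Longrightarrow> \<not> res j < res i"
      using lev_mono[of "res j" "res i"] res_range[of i] res_range[of j] lev_res[OF i] lev_res[OF j] by force
    have m: "i < j \<Longrightarrow> lev i \<le> lev j" "j < i \<Longrightarrow> lev j \<le> lev i" using lev_mono i j by simp_all
    consider "lev i < lev j" | "lev i = lev j" | "lev j < lev i" by linarith
    then show "t \<in> ?T j \<longleftrightarrow> t \<in> {1..lev i - lev j - 1}"
      using lo hi r r' m unfolding d_def by cases (auto split: if_splits)
  qed
  have "bij_betw (\<lambda>(j, t). j + int n * t) (SIGMA j:{1..int n}. ?T j) {j. i < j \<and> w j < w i}"
  proof (rule bij_betw_byWitness[where f' = "\<lambda>x. (residue n x, level n x)"])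
    show "\<forall>a\<in>SIGMA j:{1..int n}. ?T j. (residue n (case a of (j, t) \<Rightarrow> j + int n * t), level n (case a of (j, t) \<Rightarrow> j + int n * t)) = a"
      by (auto simp: residue_level_unique)
    show "\<forall>a'\<in>{j. i < j \<and> w j < w i}. (case (residue n a', level n a') of (j, t) \<Rightarrow> j + int n * t) = a'"
      using residue_level by simp
    show "(\<lambda>(j, t). j + int n * t) ` (SIGMA j:{1..int n}. ?T j) \<subseteq> {j. i < j \<and> w j < w i}"
      by (auto simp: w_shift)
    show "(\<lambda>x. (residue n x, level n x)) ` {j. i < j \<and> w j < w i} \<subseteq> (SIGMA j:{1..int n}. ?T j)"
    proof
      fix z assume "z \<in> (\<lambda>x. (residue n x, level n x)) ` {j. i < j \<and> w j < w i}"
      then obtain x where x: "z = (residue n x, level n x)" "i < x" "w x < w i" by blast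
      have "x = residue n x + int n * level n x" by (rule residue_level)
      moreover from this have "w x = w (residue n x) + int n * level n x" using w_shift by metis
      ultimately have "level n x \<in> ?T (residue n x)" using x by simp
      then show "z \<in> (SIGMA j:{1..int n}. ?T j)" using residue_range[OF n_pos, of x] x(1) by blast
    qed
  qed
  from bij_betw_same_card[OF this]
  have "card {j. i < j \<and> w j < w i} = card (SIGMA j:{1..int n}. ?T j)" by simp
  also have "\<dots> = (\<Sum>j = 1..int n. card (?T j))"
    by (rule card_SigmaI) (auto simp: T)
  also have "\<dots> = (\<Sum>j = 1..int n. nat (lev i - lev j - 1))"
    by (rule sum.cong) (simp_all add: T)
  finally show "card {j. i < j \<and> w j < w i} = (\<Sum>j = 1..int n. nat (lev i - lev j - 1))" .
qed simp

end

lemma minimal_involution_iff: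
  assumes n: "n > 0"
  shows "minimal_involution n w \<longleftrightarrow>
    w \<in> involutions n \<and> (\<forall>s \<in> finite_gens n. cox_length n w < cox_length n (w \<circ> s))"
proof
  assume "minimal_involution n w"
  then interpret minimal_involution n w .
  have "cox_length n w < cox_length n (w \<circ> s)" if s: "s \<in> finite_gens n" for s
  proof -
    obtain r where r: "s = simple_gen n r" "r \<in> {1..<n}" using s unfolding finite_gens_def by blast
    have "w (int r) < w (int r + 1)" by (rule ascending) (use r in auto)
    moreover have "n \<ge> 2" using r by simp
    ultimately show ?thesis using cox_length_comp_simple_gen[OF _ w_affine, of r] r(1) by simp
  qed
  then show "w \<in> involutions n \<and> (\<forall>s \<in> finite_gens n. cox_length n w < cox_length n (w \<circ> s))"
    using invol by blast
next
  assume w: "w \<in> involutions n \<and> (\<forall>s \<in> finite_gens n. cox_length n w < cox_length n (w \<circ> s))"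
  have asc: "w i < w (i + 1)" if i: "1 \<le> i" "i + 1 \<le> int n" for i
  proof -
    obtain r where r: "i = int r" using i by (metis nonneg_int_cases order_trans zero_le_one)
    have "simple_gen n r \<in> finite_gens n" using i r by (auto simp: finite_gens_def)
    then have "cox_length n w < cox_length n (w \<circ> simple_gen n r)" using w by blast
    moreover have "n \<ge> 2" using i by simp
    ultimately show ?thesis
      using cox_length_comp_simple_gen[of n w r] involutionsD(1) w r by (auto split: if_splits)
  qed
  have "w i < w j" if "1 \<le> i" "i < j" "j \<le> int n" for i j
    using that(2,3)
  proof (induction j rule: int_gr_induct)
    case base
    then show ?case using asc that(1) by simp
  next
    case (step j)
    then show ?case using asc[of j] that(1) by simp
  qed
  then show "minimal_involution n w" using w n by unfold_locales auto
qed

section \<open>Weights of level functions\<close>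

definition block_pos :: "nat \<Rightarrow> (int \<Rightarrow> int) \<Rightarrow> int \<Rightarrow> nat" where
  "block_pos n c j = card {i \<in> {1..int n}. i < j \<and> c i = c j}"

text \<open>Half of the pairing of the level vector with the sum of the positive roots of type A.
  Truncation by \<open>nat\<close> drops the negative levels, which by reflection would contribute
  the same amount.\<close>

definition half_height :: "nat \<Rightarrow> (int \<Rightarrow> int) \<Rightarrow> nat" where
  "half_height n c = (\<Sum>i = 1..int n. nat (c i) * nat (2 * i - int n - 1))"

lemma sum_int_interval_Suc:
  fixes f :: "int \<Rightarrow> 'a::comm_monoid_add"
  shows "(\<Sum>i = a + 1..a + int (Suc m). f i) = (\<Sum>i = a + 1..a + int m. f i) + f (a + int (Suc m))"
proof -
  have "{a + 1..a + int (Suc m)} = insert (a + int (Suc m)) {a + 1..a + int m}" by auto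
  then show ?thesis by (simp add: add.commute)
qed

lemma sum_pair_differences:
  fixes c :: "int \<Rightarrow> int"
  shows "2 * (\<Sum>i = 1..int n. \<Sum>j = 1..i - 1. c i - c j - 1) =
    2 * (\<Sum>i = 1..int n. c i * (2 * i - int n - 1)) - int n * (int n - 1)"
proof (induction n)
  case (Suc n)
  have S: "(\<Sum>i = 1..int (Suc n). f i) = (\<Sum>i = 1..int n. f i) + f (int n + 1)" for f :: "int \<Rightarrow> int"
    using sum_int_interval_Suc[of f 0 n] by (simp add: add.commute)
  have "(\<Sum>j = 1..int n. c (int n + 1) - c j - 1) = int n * c (int n + 1) - (\<Sum>j = 1..int n. c j) - int n"
    by (simp add: sum_subtractf)
  moreover have "(\<Sum>i = 1..int n. c i * (2 * i - int (Suc n) - 1)) =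
      (\<Sum>i = 1..int n. c i * (2 * i - int n - 1)) - (\<Sum>j = 1..int n. c j)"
    by (simp add: sum_subtractf[symmetric] algebra_simps)
  ultimately show ?case using Suc.IH unfolding S by (simp add: algebra_simps)
qed simp

lemma sum_consecutive: "2 * (\<Sum>i = a + 1..a + int m. i - a - 1) = int m * (int m - 1)"
  by (induction m) (simp_all only: sum_int_interval_Suc, simp_all add: algebra_simps)

lemma sum_window_split:
  fixes f :: "int \<Rightarrow> 'a::comm_monoid_add"
  assumes "2 * k \<le> n"
  shows "(\<Sum>i = 1..int n. f i) = (\<Sum>i = 1..int k. f i) + (\<Sum>i = int k + 1..int n - int k. f i)
    + (\<Sum>i = int n - int k + 1..int n. f i)"
proof -
  have "{1..int n} = ({1..int k} \<union> {int k + 1..int n - int k}) \<union> {int n - int k + 1..int n}"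
    using assms by auto
  moreover have "({1..int k} \<union> {int k + 1..int n - int k}) \<inter> {int n - int k + 1..int n} = {}"
    "{1..int k} \<inter> {int k + 1..int n - int k} = {}" using assms by auto
  ultimately show ?thesis by (simp add: sum.union_disjoint)
qed

lemma sum_window_reflect:
  "(\<Sum>i = 1..int k. f i) = (\<Sum>i = int n - int k + 1..int n. f (int n + 1 - i))"
  by (rule sum.reindex_bij_witness[where i = "\<lambda>i. int n + 1 - i" and j = "\<lambda>i. int n + 1 - i"]) auto

context
  fixes n k M :: nat and c :: "int \<Rightarrow> int"
  assumes kn: "2 * k \<le> n" and c: "c \<in> level_profiles n k M"
begin

lemma profile_top: "i \<in> {int n - int k + 1..int n} \<Longrightarrow> 0 < c i"
  using level_profilesD(5)[OF c, of i] kn by auto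

lemma profile_middle:
  assumes "i \<in> {int k + 1..int n - int k}"
  shows "c i = 0"
proof -
  have "i \<in> {1..int n}" "int n + 1 - i \<in> {1..int n}" using assms by auto
  from level_profilesD(5)[OF c this(1)] level_profilesD(5)[OF c this(2)] level_profilesD(3)[OF c this(1)]
  show ?thesis using assms by auto
qed

lemma profile_bottom: "i \<in> {1..int k} \<Longrightarrow> c i < 0"
  using level_profilesD(3)[OF c, of i] profile_top[of "int n + 1 - i"] kn by auto

lemma profile_sum_eq_half_height:
  "(\<Sum>i = 1..int n. c i * (2 * i - int n - 1)) = 2 * int (half_height n c)"
proof -
  let ?T = "{int n - int k + 1..int n}"
  have "(\<Sum>i = 1..int k. c i * (2 * i - int n - 1)) = (\<Sum>i\<in>?T. c i * (2 * i - int n - 1))"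
    unfolding sum_window_reflect[where n = n]
  proof (rule sum.cong)
    fix i assume "i \<in> ?T"
    then have "c (int n + 1 - i) = - c i" using level_profilesD(3)[OF c, of i] kn by auto
    then show "c (int n + 1 - i) * (2 * (int n + 1 - i) - int n - 1) = c i * (2 * i - int n - 1)"
      by (simp add: algebra_simps)
  qed simp
  moreover have "(\<Sum>i = int k + 1..int n - int k. c i * (2 * i - int n - 1)) = 0"
    by (rule sum.neutral) (use profile_middle in simp)
  moreover have "int (half_height n c) = (\<Sum>i\<in>?T. c i * (2 * i - int n - 1))"
  proof -
    have "half_height n c = (\<Sum>i\<in>?T. nat (c i) * nat (2 * i - int n - 1))"
    proof -
      have "(\<Sum>i = 1..int k. nat (c i) * nat (2 * i - int n - 1)) = 0"
        by (rule sum.neutral) (use profile_bottom in force)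
      moreover have "(\<Sum>i = int k + 1..int n - int k. nat (c i) * nat (2 * i - int n - 1)) = 0"
        by (rule sum.neutral) (use profile_middle in force)
      ultimately show ?thesis unfolding half_height_def sum_window_split[OF kn] by simp
    qed
    moreover have "int (nat (c i) * nat (2 * i - int n - 1)) = c i * (2 * i - int n - 1)" if "i \<in> ?T" for i
      using that profile_top[OF that] kn by simp
    ultimately show ?thesis by (simp add: of_nat_sum)
  qed
  ultimately show ?thesis unfolding sum_window_split[OF kn] by simp
qed

text \<open>The sum of the ranks counts pairs of equal level. The negative blocks contribute as much
  as the positive ones, and the block of level 0 has n - 2k elements.\<close>

lemma sum_block_pos:
  "2 * (\<Sum>j = 1..int n. int (block_pos n c j)) = 4 * (\<Sum>j = int n - int k + 1..int n. int (block_pos n c j))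
     + (int n - 2 * int k) * (int n - 2 * int k - 1)"
proof -
  let ?T = "{int n - int k + 1..int n}"
  let ?eq = "\<lambda>i j. of_bool (i < j \<and> c i = c j) :: int"
  have pos_T: "int (block_pos n c j) = (\<Sum>i\<in>?T. ?eq i j)" if j: "j \<in> ?T" for j
  proof -
    have "{i \<in> {1..int n}. i < j \<and> c i = c j} = {i \<in> ?T. i < j \<and> c i = c j}"
    proof (intro Set.set_eqI iffI)
      fix i assume i: "i \<in> {i \<in> {1..int n}. i < j \<and> c i = c j}"
      then show "i \<in> {i \<in> ?T. i < j \<and> c i = c j}"
        using profile_top[OF j] level_profilesD(5)[OF c, of i] by auto
    qed (use kn in auto)
    then show ?thesis by (simp add: block_pos_def sum_of_bool_eq Int_def)
  qed
  have pos_B: "int (block_pos n c j) = (\<Sum>i = 1..int k. ?eq i j)" if j: "j \<in> {1..int k}" for j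
  proof -
    have "{i \<in> {1..int n}. i < j \<and> c i = c j} = {i \<in> {1..int k}. i < j \<and> c i = c j}"
      using j kn by auto
    then show ?thesis by (simp add: block_pos_def sum_of_bool_eq Int_def)
  qed
  have "(\<Sum>j = 1..int k. int (block_pos n c j)) = (\<Sum>j = 1..int k. \<Sum>i = 1..int k. ?eq i j)"
    by (rule sum.cong) (simp_all add: pos_B)
  also have "\<dots> = (\<Sum>j\<in>?T. \<Sum>i\<in>?T. ?eq (int n + 1 - i) (int n + 1 - j))"
    unfolding sum_window_reflect[where n = n] ..
  \<comment> \<open>Reflection reverses positions, so individual ranks are not preserved; only after
    the pairs are swapped do the totals agree.\<close>
  also have "\<dots> = (\<Sum>j\<in>?T. \<Sum>i\<in>?T. ?eq j i)"
  proof (intro sum.cong refl)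
    fix i j assume ij: "j \<in> ?T" "i \<in> ?T"
    then have "c (int n + 1 - i) = - c i" "c (int n + 1 - j) = - c j"
      using level_profilesD(3)[OF c, of i] level_profilesD(3)[OF c, of j] kn by auto
    then show "?eq (int n + 1 - i) (int n + 1 - j) = ?eq j i" by auto
  qed
  also have "\<dots> = (\<Sum>j\<in>?T. \<Sum>i\<in>?T. ?eq i j)" by (rule sum.swap)
  also have "\<dots> = (\<Sum>j\<in>?T. int (block_pos n c j))" by (rule sum.cong) (simp_all add: pos_T)
  finally have bottom: "(\<Sum>j = 1..int k. int (block_pos n c j)) = (\<Sum>j\<in>?T. int (block_pos n c j))" .
  have "(\<Sum>j = int k + 1..int n - int k. int (block_pos n c j)) = (\<Sum>j = int k + 1..int n - int k. j - int k - 1)"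
  proof (rule sum.cong)
    fix j assume j: "j \<in> {int k + 1..int n - int k}"
    have "{i \<in> {1..int n}. i < j \<and> c i = c j} = {int k + 1..j - 1}"
    proof (intro Set.set_eqI iffI)
      fix i assume i: "i \<in> {i \<in> {1..int n}. i < j \<and> c i = c j}"
      then have "\<not> i \<le> int k" using profile_bottom[of i] profile_middle[OF j] by auto
      then show "i \<in> {int k + 1..j - 1}" using i by simp
    next
      fix i assume i: "i \<in> {int k + 1..j - 1}"
      then have "i \<in> {int k + 1..int n - int k}" using j by auto
      then show "i \<in> {i \<in> {1..int n}. i < j \<and> c i = c j}"
        using profile_middle[of i] profile_middle[OF j] i by auto
    qed
    then show "int (block_pos n c j) = j - int k - 1" using j by (simp add: block_pos_def)
  qed simp
  moreover have "2 * (\<Sum>j = int k + 1..int n - int k. j - int k - 1) = (int n - 2 * int k) * (int n - 2 * int k - 1)"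
  proof -
    have "int (n - 2 * k) = int n - 2 * int k" using kn by simp
    moreover from this have "int k + int (n - 2 * k) = int n - int k" by simp
    ultimately show ?thesis using sum_consecutive[of "int k" "n - 2 * k"] by simp
  qed
  ultimately show ?thesis unfolding sum_window_split[OF kn] bottom by simp
qed

text \<open>For j < i the truncated difference exceeds \<open>c i - c j - 1\<close> by one exactly
  when the levels agree, and for j at least i it vanishes. This leaves a linear sum plus ranks. The
  offset is the number of all pairs minus the number of pairs within the zero block, kept on the
  left to avoid subtraction.\<close>

lemma profile_length:
  "int (\<Sum>i = 1..int n. \<Sum>j = 1..int n. nat (c i - c j - 1)) + int k * (2 * int n - 2 * int k - 1) =
     2 * int (half_height n c) + 2 * (\<Sum>j = int n - int k + 1..int n. int (block_pos n c j))"
proof -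
  have row: "int (\<Sum>j = 1..int n. nat (c i - c j - 1)) = (\<Sum>j = 1..i - 1. c i - c j - 1) + int (block_pos n c i)"
    if i: "i \<in> {1..int n}" for i
  proof -
    have mono: "c j \<le> c i" if "1 \<le> j" "j \<le> i" for j
      using level_profilesD(2)[OF c, of j i] that i by simp
    have split: "{1..int n} = {1..i - 1} \<union> {i..int n}" using i by auto
    have "(\<Sum>j = 1..int n. int (nat (c i - c j - 1))) =
        (\<Sum>j = 1..i - 1. int (nat (c i - c j - 1))) + (\<Sum>j = i..int n. int (nat (c i - c j - 1)))"
      unfolding split by (rule sum.union_disjoint) auto
    also have "(\<Sum>j = i..int n. int (nat (c i - c j - 1))) = 0"
      using level_profilesD(2)[OF c, of i] i by (intro sum.neutral) force
    also have "(\<Sum>j = 1..i - 1. int (nat (c i - c j - 1))) =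
        (\<Sum>j = 1..i - 1. (c i - c j - 1) + of_bool (c j = c i))"
    proof (rule sum.cong)
      fix j assume "j \<in> {1..i - 1}"
      then show "int (nat (c i - c j - 1)) = (c i - c j - 1) + of_bool (c j = c i)"
        using mono[of j] by auto
    qed simp
    also have "\<dots> = (\<Sum>j = 1..i - 1. c i - c j - 1) + (\<Sum>j = 1..i - 1. of_bool (c j = c i))"
      by (rule sum.distrib)
    also have "(\<Sum>j = 1..i - 1. of_bool (c j = c i)) = int (block_pos n c i)"
    proof -
      have "{j \<in> {1..int n}. j < i \<and> c j = c i} = {j \<in> {1..i - 1}. c j = c i}" using i by auto
      then show ?thesis by (simp add: block_pos_def sum_of_bool_eq Int_def)
    qed
    finally show ?thesis by simp
  qed
  have "int (\<Sum>i = 1..int n. \<Sum>j = 1..int n. nat (c i - c j - 1)) =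
      (\<Sum>i = 1..int n. int (\<Sum>j = 1..int n. nat (c i - c j - 1)))"
    by (rule of_nat_sum)
  also have "\<dots> = (\<Sum>i = 1..int n. (\<Sum>j = 1..i - 1. c i - c j - 1) + int (block_pos n c i))"
    by (rule sum.cong[OF refl]) (rule row)
  also have "\<dots> = (\<Sum>i = 1..int n. \<Sum>j = 1..i - 1. c i - c j - 1) + (\<Sum>i = 1..int n. int (block_pos n c i))"
    by (rule sum.distrib)
  finally have L: "int (\<Sum>i = 1..int n. \<Sum>j = 1..int n. nat (c i - c j - 1)) =
    (\<Sum>i = 1..int n. \<Sum>j = 1..i - 1. c i - c j - 1) + (\<Sum>i = 1..int n. int (block_pos n c i))" .
  have "int n * (int n - 1) - (int n - 2 * int k) * (int n - 2 * int k - 1)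
      = 2 * (int k * (2 * int n - 2 * int k - 1))"
    by (simp add: algebra_simps)
  then show ?thesis
    using sum_pair_differences[of c n] sum_block_pos profile_sum_eq_half_height unfolding L by linarith
qed

end

section \<open>Removing one level from a profile\<close>

definition level_step :: "nat \<Rightarrow> nat \<Rightarrow> int \<Rightarrow> int" where
  "level_step n k i =
     (if i \<in> {1..int n} then of_bool (int n - int k < i) - of_bool (i \<le> int k) else 0)"

text \<open>\<open>Q\<close> and \<open>h\<close> stay abstract so that the recursion is pure
  algebra; they become the square of the indeterminate and \<open>block_weight\<close>.\<close>

definition profile_weight :: "'a::comm_monoid_mult \<Rightarrow> (nat \<Rightarrow> 'a) \<Rightarrow> nat \<Rightarrow> nat \<Rightarrow> (int \<Rightarrow> int) \<Rightarrow> 'a" where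
  "profile_weight Q h n k c =
     Q ^ half_height n c * (\<Prod>j = int n - int k + 1..int n. h (block_pos n c j))"

lemma level_step_outside: "i \<notin> {1..int n} \<Longrightarrow> level_step n k i = 0"
  by (simp only: level_step_def if_False)

lemma level_step_cases:
  assumes "2 * k \<le> n" and "i \<in> {1..int n}"
  obtains "i \<in> {1..int k}" "level_step n k i = - 1"
    | "i \<in> {int k + 1..int n - int k}" "level_step n k i = 0"
    | "i \<in> {int n - int k + 1..int n}" "level_step n k i = 1"
proof -
  consider "i \<le> int k" | "int k < i" "i \<le> int n - int k" | "int n - int k < i" by linarith
  then show thesis
    by cases (use assms that in \<open>auto simp: level_step_def\<close>)
qed

lemma level_step_mono: "1 \<le> i \<Longrightarrow> i \<le> j \<Longrightarrow> j \<le> int n \<Longrightarrow> level_step n k i \<le> level_step n k j"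
  by (auto simp: level_step_def)

lemma level_step_reflect: "i \<in> {1..int n} \<Longrightarrow> level_step n k (int n + 1 - i) = - level_step n k i"
  by (auto simp: level_step_def)

lemma level_profile_nonneg:
  assumes "2 * k \<le> n" "c \<in> level_profiles n k M" "int k < i"
  shows "0 \<le> c i"
proof (cases "i \<in> {1..int n}")
  case True
  then show ?thesis
    using profile_middle[OF assms(1,2), of i] profile_top[OF assms(1,2), of i] assms(3)
    by (cases "i \<le> int n - int k") auto
next
  case False
  then show ?thesis using level_profilesD(1)[OF assms(2)] by simp
qed

lemma level_profile_nonpos:
  assumes "c \<in> level_profiles n k M" "i \<le> int n - int k"
  shows "c i \<le> 0"
  using level_profilesD(5)[OF assms(1), of i] level_profilesD(1)[OF assms(1), of i] assms(2)
  by (cases "i \<in> {1..int n}") auto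

context
  fixes n k :: nat
  assumes kn: "2 * k \<le> n"
begin

lemma add_level_step:
  assumes k': "k' \<le> k" and c: "c \<in> level_profiles n k' M"
  shows "(\<lambda>i. c i + level_step n k i) \<in> level_profiles n k (Suc M)"
proof -
  note cD = level_profilesD[OF c]
  have k'n: "2 * k' \<le> n" using k' kn by simp
  have out: "c i + level_step n k i = 0" if "i \<notin> {1..int n}" for i
    using cD(1)[OF that] level_step_outside[OF that, of k] by simp
  have mono: "c i + level_step n k i \<le> c j + level_step n k j" if "1 \<le> i" "i \<le> j" "j \<le> int n" for i j
    using cD(2)[OF that] level_step_mono[OF that, of k] by simp
  have refl': "c (int n + 1 - i) + level_step n k (int n + 1 - i) = - (c i + level_step n k i)"
    if "i \<in> {1..int n}" for i
    using cD(3)[OF that] level_step_reflect[OF that, of k] by simp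
  have bound: "c i + level_step n k i \<le> int (Suc M)" if "i \<in> {1..int n}" for i
    using cD(4)[OF that] by (simp add: level_step_def)
  have pos: "0 < c i + level_step n k i \<longleftrightarrow> int n - int k < i" if i: "i \<in> {1..int n}" for i
    using kn i
  proof (cases rule: level_step_cases)
    case 3
    then show ?thesis using level_profile_nonneg[OF k'n c, of i] k' kn by auto
  qed (use level_profile_nonpos[OF c, of i] k' kn in auto)
  show ?thesis unfolding level_profiles_def mem_Collect_eq
    using out mono refl' bound pos by blast
qed

text \<open>Exactly the positions of level above 1 stay positive, and by monotonicity they are the
  last k' of the window.\<close>

lemma diff_level_step:
  assumes c: "c \<in> level_profiles n k (Suc M)"
  defines "k' \<equiv> card {i \<in> {1..int n}. 1 < c i}"
  shows "k' \<le> k" "(\<lambda>i. c i - level_step n k i) \<in> level_profiles n k' M"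
proof -
  note cD = level_profilesD[OF c]
  note top = profile_top[OF kn c] and middle = profile_middle[OF kn c] and bottom = profile_bottom[OF kn c]
  have "{i \<in> {1..int n}. 1 < c i} \<subseteq> {int n - int k + 1..int n}"
  proof
    fix i assume "i \<in> {i \<in> {1..int n}. 1 < c i}"
    then show "i \<in> {int n - int k + 1..int n}" using cD(5)[of i] by auto
  qed
  then have "k' \<le> card {int n - int k + 1..int n}" unfolding k'_def by (intro card_mono) simp_all
  then show "k' \<le> k" by simp
  have gt1: "1 < c i \<longleftrightarrow> int n - int k' < i" if "i \<in> {1..int n}" for i
  proof -
    have "c i < 2 \<longleftrightarrow> i \<le> sublevel_count n c 2" by (rule less_iff_le_sublevel_count[OF cD(2) that])
    moreover have "sublevel_count n c 2 + int k' = int n" unfolding k'_def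
      using sublevel_count_compl[of n c 1] by simp
    ultimately show ?thesis by linarith
  qed
  have out: "c i - level_step n k i = 0" if "i \<notin> {1..int n}" for i
    using cD(1)[OF that] level_step_outside[OF that, of k] by simp
  have sgn: "(level_step n k i = - 1 \<and> c i < 0) \<or> (level_step n k i = 0 \<and> c i = 0)
      \<or> (level_step n k i = 1 \<and> 0 < c i)" if "i \<in> {1..int n}" for i
    using kn that by (cases rule: level_step_cases) (use top[of i] middle[of i] bottom[of i] in auto)
  have mono: "c i - level_step n k i \<le> c j - level_step n k j" if ij: "1 \<le> i" "i \<le> j" "j \<le> int n" for i j
    using sgn[of i] sgn[of j] cD(2)[OF ij] ij by auto
  have refl': "c (int n + 1 - i) - level_step n k (int n + 1 - i) = - (c i - level_step n k i)"
    if "i \<in> {1..int n}" for i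
    using cD(3)[OF that] level_step_reflect[OF that, of k] by simp
  have bound: "c i - level_step n k i \<le> int M" if "i \<in> {1..int n}" for i
    using cD(4)[OF that] sgn[OF that] by auto
  have pos: "0 < c i - level_step n k i \<longleftrightarrow> int n - int k' < i" if "i \<in> {1..int n}" for i
    using gt1[OF that] sgn[OF that] by auto
  show "(\<lambda>i. c i - level_step n k i) \<in> level_profiles n k' M"
    unfolding level_profiles_def mem_Collect_eq using out mono refl' bound pos by blast
qed

lemma half_height_level_step:
  assumes k': "k' \<le> k" and c: "c \<in> level_profiles n k' M"
  shows "half_height n (\<lambda>i. c i + level_step n k i) = half_height n c + k * (n - k)"
proof -
  let ?T = "{int n - int k + 1..int n}"
  have k'n: "2 * k' \<le> n" using k' kn by simp
  have "half_height n (\<lambda>i. c i + level_step n k i) =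
      (\<Sum>i = 1..int n. nat (c i) * nat (2 * i - int n - 1) + (if i \<in> ?T then nat (2 * i - int n - 1) else 0))"
    unfolding half_height_def
  proof (rule sum.cong)
    fix i assume i: "i \<in> {1..int n}"
    show "nat (c i + level_step n k i) * nat (2 * i - int n - 1) =
        nat (c i) * nat (2 * i - int n - 1) + (if i \<in> ?T then nat (2 * i - int n - 1) else 0)"
      using kn i
    proof (cases rule: level_step_cases)
      case 1
      then have "c i \<le> 0" using level_profile_nonpos[OF c, of i] k' kn by auto
      then show ?thesis using 1 kn by simp
    next
      case 2
      then show ?thesis by simp
    next
      case 3
      then have "0 \<le> c i" using level_profile_nonneg[OF k'n c, of i] k' kn by auto
      then have "nat (c i + 1) = nat (c i) + 1" by simp
      then show ?thesis using 3 by simp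
    qed
  qed simp
  also have "\<dots> = half_height n c + (\<Sum>i = 1..int n. if i \<in> ?T then nat (2 * i - int n - 1) else 0)"
    unfolding half_height_def by (rule sum.distrib)
  also have "(\<Sum>i = 1..int n. if i \<in> ?T then nat (2 * i - int n - 1) else 0) = (\<Sum>i\<in>?T. nat (2 * i - int n - 1))"
  proof -
    have "{1..int n} \<inter> ?T = ?T" using kn by auto
    then show ?thesis unfolding sum.inter_restrict[OF finite_atLeastAtMost_int, symmetric] by (rule arg_cong)
  qed
  \<comment> \<open>The weights 2i - n - 1 of the top k positions form an arithmetic progression
    with difference 2, starting at n - 2k + 1.\<close>
  also have "\<dots> = k * (n - k)"
  proof -
    have "int (\<Sum>i\<in>?T. nat (2 * i - int n - 1)) = (\<Sum>i\<in>?T. 2 * (i - (int n - int k) - 1) + (int n - 2 * int k + 1))"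
      unfolding of_nat_sum by (rule sum.cong) (use kn in auto)
    also have "\<dots> = 2 * (\<Sum>i\<in>?T. i - (int n - int k) - 1) + int k * (int n - 2 * int k + 1)"
    proof -
      have "(\<Sum>i\<in>?T. int n - 2 * int k + 1) = int k * (int n - 2 * int k + 1)" by simp
      then show ?thesis unfolding sum.distrib sum_distrib_left[symmetric] by (rule arg_cong)
    qed
    also have "2 * (\<Sum>i\<in>?T. i - (int n - int k) - 1) = int k * (int k - 1)"
      using sum_consecutive[of "int n - int k" k] by simp
    also have "int k * (int k - 1) + int k * (int n - 2 * int k + 1) = int (k * (n - k))"
      using kn by (simp add: of_nat_diff algebra_simps)
    finally show ?thesis by (simp only: of_nat_eq_iff)
  qed
  finally show ?thesis .
qed

text \<open>Old positive blocks are merely shifted in level. The k - k' positions lifted from 0 to 1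
  form a new block with ranks 0, 1, ..., which is the source of the product of \<open>h\<close> in
  the recursion.\<close>

lemma block_pos_level_step:
  assumes k': "k' \<le> k" and c: "c \<in> level_profiles n k' M"
  shows "j \<in> {int n - int k' + 1..int n} \<Longrightarrow> block_pos n (\<lambda>i. c i + level_step n k i) j = block_pos n c j"
    and "t < k - k' \<Longrightarrow> block_pos n (\<lambda>i. c i + level_step n k i) (int n - int k + 1 + int t) = t"
proof -
  have k'n: "2 * k' \<le> n" using k' kn by simp
  note cD = level_profilesD[OF c]
  note d = add_level_step[OF k' c]
  {
    assume j: "j \<in> {int n - int k' + 1..int n}"
    have jW: "j \<in> {1..int n}" using j k'n by auto
    have cj: "0 < c j" and sj: "level_step n k j = 1"
      using profile_top[OF k'n c j] j k' kn jW by (auto simp: level_step_def)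
    have "c i + level_step n k i = c j + level_step n k j \<longleftrightarrow> c i = c j" if i: "i \<in> {1..int n}" for i
    proof
      assume eq: "c i + level_step n k i = c j + level_step n k j"
      then have "0 < c i + level_step n k i" using cj sj by simp
      then have "int n - int k < i" using level_profilesD(5)[OF d i] by simp
      then have "level_step n k i = 1" using i kn by (auto simp: level_step_def)
      then show "c i = c j" using eq sj by simp
    next
      assume eq: "c i = c j"
      then have "int n - int k' < i" using cD(5)[OF i] cj by simp
      then have "level_step n k i = 1" using i kn k' by (auto simp: level_step_def)
      then show "c i + level_step n k i = c j + level_step n k j" using eq sj by simp
    qed
    then have "{i \<in> {1..int n}. i < j \<and> c i + level_step n k i = c j + level_step n k j}
        = {i \<in> {1..int n}. i < j \<and> c i = c j}" by blast
    then show "block_pos n (\<lambda>i. c i + level_step n k i) j = block_pos n c j" by (simp add: block_pos_def)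
  }
  {
    assume t: "t < k - k'"
    define j where "j = int n - int k + 1 + int t"
    have mid: "c i + level_step n k i = 1" if "int n - int k < i" "i \<le> int n - int k'" for i
    proof -
      have "i \<in> {int k' + 1..int n - int k'}" using that k' kn by auto
      then have "c i = 0" by (rule profile_middle[OF k'n c])
      then show ?thesis using that kn k' by (auto simp: level_step_def)
    qed
    have j: "int n - int k < j" "j \<le> int n - int k'" using t by (auto simp: j_def)
    have "{i \<in> {1..int n}. i < j \<and> c i + level_step n k i = c j + level_step n k j} = {int n - int k + 1..j - 1}"
    proof (intro Set.set_eqI iffI)
      fix i assume i: "i \<in> {i \<in> {1..int n}. i < j \<and> c i + level_step n k i = c j + level_step n k j}"
      then have "0 < c i + level_step n k i" using mid[OF j] by simp
      then have "int n - int k < i" using level_profilesD(5)[OF d, of i] i by simp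
      then show "i \<in> {int n - int k + 1..j - 1}" using i by simp
    next
      fix i assume i: "i \<in> {int n - int k + 1..j - 1}"
      then have "c i + level_step n k i = 1" using mid[of i] j by simp
      then show "i \<in> {i \<in> {1..int n}. i < j \<and> c i + level_step n k i = c j + level_step n k j}"
        using mid[OF j] i j kn by auto
    qed
    then show "block_pos n (\<lambda>i. c i + level_step n k i) (int n - int k + 1 + int t) = t"
      unfolding j_def[symmetric] by (simp add: block_pos_def j_def)
  }
qed

lemma profile_weight_level_step:
  fixes Q :: "'a::comm_monoid_mult"
  assumes k': "k' \<le> k" and c: "c \<in> level_profiles n k' M"
  shows "profile_weight Q h n k (\<lambda>i. c i + level_step n k i) =
    Q ^ (k * (n - k)) * (\<Prod>t<k - k'. h t) * profile_weight Q h n k' c"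
proof -
  let ?d = "\<lambda>i. c i + level_step n k i"
  have "{int n - int k + 1..int n} = {int n - int k + 1..int n - int k'} \<union> {int n - int k' + 1..int n}"
    using k' by auto
  then have "(\<Prod>j = int n - int k + 1..int n. h (block_pos n ?d j)) =
      (\<Prod>j = int n - int k + 1..int n - int k'. h (block_pos n ?d j)) *
      (\<Prod>j = int n - int k' + 1..int n. h (block_pos n ?d j))"
    by (simp add: prod.union_disjoint)
  also have "(\<Prod>j = int n - int k' + 1..int n. h (block_pos n ?d j)) =
      (\<Prod>j = int n - int k' + 1..int n. h (block_pos n c j))"
    by (rule prod.cong) (simp_all only: block_pos_level_step(1)[OF k' c])
  also have "(\<Prod>j = int n - int k + 1..int n - int k'. h (block_pos n ?d j)) = (\<Prod>t<k - k'. h t)"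
  proof (rule prod.reindex_bij_witness[where i = "\<lambda>t. int n - int k + 1 + int t"
        and j = "\<lambda>j. nat (j - (int n - int k + 1))"])
    fix j assume j: "j \<in> {int n - int k + 1..int n - int k'}"
    show "nat (j - (int n - int k + 1)) \<in> {..<k - k'}" using j by auto
    then have t: "nat (j - (int n - int k + 1)) < k - k'" by simp
    show jt: "int n - int k + 1 + int (nat (j - (int n - int k + 1))) = j" using j by simp
    show "h (nat (j - (int n - int k + 1))) = h (block_pos n ?d j)"
      using block_pos_level_step(2)[OF k' c t] by (simp only: jt)
  qed auto
  finally show ?thesis
    unfolding profile_weight_def half_height_level_step[OF k' c] power_add by (simp only: mult_ac)
qed

end

lemma finite_level_profiles: "finite (level_profiles n k M)"
proof -
  have "finite {c. \<forall>i. (i \<in> {1..int n} \<longrightarrow> c i \<in> {- int M..int M}) \<and> (i \<notin> {1..int n} \<longrightarrow> c i = 0)}"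
    by (rule finite_set_of_finite_funs) simp_all
  moreover have "level_profiles n k M \<subseteq>
      {c. \<forall>i. (i \<in> {1..int n} \<longrightarrow> c i \<in> {- int M..int M}) \<and> (i \<notin> {1..int n} \<longrightarrow> c i = 0)}"
  proof
    fix c assume c: "c \<in> level_profiles n k M"
    have "c i \<in> {- int M..int M}" if i: "i \<in> {1..int n}" for i
    proof -
      have "int n + 1 - i \<in> {1..int n}" using i by auto
      from level_profilesD(4)[OF c this] level_profilesD(3,4)[OF c i] show ?thesis by simp
    qed
    then show "c \<in> {c. \<forall>i. (i \<in> {1..int n} \<longrightarrow> c i \<in> {- int M..int M}) \<and> (i \<notin> {1..int n} \<longrightarrow> c i = 0)}"
      using level_profilesD(1)[OF c] by blast
  qed
  ultimately show ?thesis by (rule rev_finite_subset)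
qed

lemma level_profiles_0: "level_profiles n 0 M = {\<lambda>_. 0}"
proof (intro equalityI subsetI)
  fix c assume c: "c \<in> level_profiles n 0 M"
  have "c i = 0" for i
    using profile_middle[OF _ c, of i] level_profilesD(1)[OF c, of i] by (cases "i \<in> {1..int n}") auto
  then show "c \<in> {\<lambda>_. 0}" by auto
qed (auto simp: level_profiles_def)

lemma sum_profile_weight_0: "(\<Sum>c\<in>level_profiles n 0 M. profile_weight Q h n 0 c) = (1::'a::comm_semiring_1)"
  by (simp add: level_profiles_0 profile_weight_def half_height_def)

text \<open>Profiles are sorted by the number j of positions that stay positive. The case j = k,
  where no position drops to 0, is included, so only M is sure to decrease.\<close>

lemma sum_profile_weight_Suc:
  fixes Q :: "'a::comm_semiring_1"
  assumes kn: "2 * k \<le> n"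
  shows "(\<Sum>c\<in>level_profiles n k (Suc M). profile_weight Q h n k c) =
    Q ^ (k * (n - k)) * (\<Sum>j\<le>k. (\<Prod>t<k - j. h t) * (\<Sum>c\<in>level_profiles n j M. profile_weight Q h n j c))"
proof -
  let ?e = "level_step n k"
  have "(\<Sum>c\<in>level_profiles n k (Suc M). profile_weight Q h n k c) =
      (\<Sum>(j, c)\<in>(SIGMA j:{..k}. level_profiles n j M). profile_weight Q h n k (\<lambda>i. c i + ?e i))"
  proof (rule sum.reindex_bij_witness[where i = "\<lambda>(j, c) i. c i + ?e i"
        and j = "\<lambda>c. (card {i \<in> {1..int n}. 1 < c i}, \<lambda>i. c i - ?e i)"])
    fix c assume c: "c \<in> level_profiles n k (Suc M)"
    show "(card {i \<in> {1..int n}. 1 < c i}, \<lambda>i. c i - ?e i) \<in> (SIGMA j:{..k}. level_profiles n j M)"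
      using diff_level_step[OF kn c] by blast
  next
    fix x assume "x \<in> (SIGMA j:{..k}. level_profiles n j M)"
    then obtain j c where x: "x = (j, c)" "j \<le> k" "c \<in> level_profiles n j M" by blast
    have jn: "2 * j \<le> n" using x(2) kn by simp
    show "(case x of (j, c) \<Rightarrow> \<lambda>i. c i + ?e i) \<in> level_profiles n k (Suc M)"
      using add_level_step[OF kn x(2,3)] by (simp add: x(1))
    have "1 < c i + ?e i \<longleftrightarrow> int n - int j < i" if i: "i \<in> {1..int n}" for i
      using kn i
    proof (cases rule: level_step_cases)
      case 3
      then show ?thesis using level_profilesD(5)[OF x(3) i] by auto
    qed (use level_profile_nonpos[OF x(3), of i] x(2) kn in auto)
    then have "{i \<in> {1..int n}. 1 < c i + ?e i} = {int n - int j + 1..int n}" using jn by auto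
    then have "card {i \<in> {1..int n}. 1 < c i + ?e i} = j" by simp
    then show "(card {i \<in> {1..int n}. 1 < (case x of (j, c) \<Rightarrow> \<lambda>i. c i + ?e i) i},
        \<lambda>i. (case x of (j, c) \<Rightarrow> \<lambda>i. c i + ?e i) i - ?e i) = x"
      by (simp add: x(1))
  qed auto
  also have "\<dots> = (\<Sum>j\<le>k. \<Sum>c\<in>level_profiles n j M. profile_weight Q h n k (\<lambda>i. c i + ?e i))"
    by (subst sum.Sigma) (simp_all add: finite_level_profiles)
  also have "\<dots> = (\<Sum>j\<le>k. \<Sum>c\<in>level_profiles n j M.
      Q ^ (k * (n - k)) * (\<Prod>t<k - j. h t) * profile_weight Q h n j c)"
    by (intro sum.cong refl) (simp_all only: atMost_iff profile_weight_level_step[OF kn])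
  finally show ?thesis by (simp only: sum_distrib_left mult.assoc)
qed

section \<open>Finite q-identities and the closed form\<close>

definition q_product :: "'a::comm_ring_1 \<Rightarrow> nat \<Rightarrow> 'a" where
  "q_product Q m = (\<Prod>i = 1..m. 1 - Q ^ i)"

text \<open>The Pascal rule replaces division, so that the identities below hold in every
  commutative ring. \<open>q_product Q m\<close> is the q-Pochhammer symbol (Q;Q)_m.\<close>

fun gauss_binomial :: "'a::comm_ring_1 \<Rightarrow> nat \<Rightarrow> nat \<Rightarrow> 'a" where
  "gauss_binomial Q m 0 = 1"
| "gauss_binomial Q 0 (Suc j) = 0"
| "gauss_binomial Q (Suc m) (Suc j) = gauss_binomial Q m j + Q ^ Suc j * gauss_binomial Q m (Suc j)"

lemma q_product_Suc: "q_product Q (Suc m) = q_product Q m * (1 - Q ^ Suc m)"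
  by (simp add: q_product_def)

lemma q_product_0 [simp]: "q_product Q 0 = 1"
  by (simp add: q_product_def)

lemma gauss_binomial_eq_0: "m < j \<Longrightarrow> gauss_binomial Q m j = 0"
  by (induction Q m j rule: gauss_binomial.induct) auto

lemma gauss_binomial_q_product:
  "j \<le> m \<Longrightarrow> gauss_binomial Q m j * (q_product Q j * q_product Q (m - j)) = q_product Q m"
proof (induction Q m j rule: gauss_binomial.induct)
  case (3 Q m j)
  show ?case
  proof (cases "j = m")
    case True
    then show ?thesis using "3.IH"(1) by (simp add: gauss_binomial_eq_0 q_product_Suc mult_ac flip: mult.assoc)
  next
    case False
    then obtain d where d: "m = Suc (j + d)" using "3.prems" less_imp_Suc_add[of j m] by auto
    have 1: "gauss_binomial Q m j * (q_product Q j * q_product Q (Suc d)) = q_product Q m"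
      using "3.IH"(1) d by simp
    have 2: "gauss_binomial Q m (Suc j) * (q_product Q (Suc j) * q_product Q d) = q_product Q m"
      using "3.IH"(2) d by simp
    have "gauss_binomial Q (Suc m) (Suc j) * (q_product Q (Suc j) * q_product Q (Suc m - Suc j)) =
        (gauss_binomial Q m j * (q_product Q j * q_product Q (Suc d))) * (1 - Q ^ Suc j) +
        (gauss_binomial Q m (Suc j) * (q_product Q (Suc j) * q_product Q d)) * (Q ^ Suc j * (1 - Q ^ Suc d))"
      using d by (simp add: q_product_Suc algebra_simps)
    also have "\<dots> = q_product Q m * (1 - Q ^ (Suc j + Suc d))"
      unfolding 1 2 by (simp add: power_add algebra_simps)
    finally show ?thesis using d by (simp add: q_product_Suc)
  qed
qed simp_all

lemma q_pochhammer_Suc: "q_pochhammer y Q (Suc m) = (1 - y) * q_pochhammer (y * Q) Q m"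
  unfolding q_pochhammer_def prod.lessThan_Suc_shift by (simp add: mult_ac)

text \<open>A finite form of the \<open>q\<close>-binomial theorem; the Pascal rule reduces \<open>k + 1\<close> to the
  values of the sum for \<open>k\<close> at \<open>y\<close> and at \<open>Q y\<close>.\<close>

lemma gauss_binomial_sum:
  "(\<Sum>j\<le>k. gauss_binomial Q k j * y ^ j * q_pochhammer y Q (k - j)) = 1"
proof (induction k arbitrary: y)
  case 0
  show ?case by (simp add: q_pochhammer_def)
next
  case (Suc k)
  let ?S = "\<lambda>y. \<Sum>j\<le>k. gauss_binomial Q k j * y ^ j * q_pochhammer y Q (k - j)"
  let ?u = "\<lambda>j. Q ^ j * gauss_binomial Q k j * y ^ j * q_pochhammer y Q (Suc k - j)"
  have "(\<Sum>j\<le>Suc k. gauss_binomial Q (Suc k) j * y ^ j * q_pochhammer y Q (Suc k - j)) =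
      q_pochhammer y Q (Suc k) +
      (\<Sum>j\<le>k. gauss_binomial Q (Suc k) (Suc j) * y ^ Suc j * q_pochhammer y Q (k - j))"
    by (subst sum.atMost_Suc_shift) simp
  also have "(\<Sum>j\<le>k. gauss_binomial Q (Suc k) (Suc j) * y ^ Suc j * q_pochhammer y Q (k - j)) =
      (\<Sum>j\<le>k. y * (gauss_binomial Q k j * y ^ j * q_pochhammer y Q (k - j)) + ?u (Suc j))"
    by (rule sum.cong) (simp_all add: algebra_simps)
  also have "\<dots> = y * ?S y + (\<Sum>j\<le>k. ?u (Suc j))"
    by (simp only: sum.distrib sum_distrib_left)
  also have "q_pochhammer y Q (Suc k) + (y * ?S y + (\<Sum>j\<le>k. ?u (Suc j))) = y * ?S y + (\<Sum>j\<le>Suc k. ?u j)"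
    unfolding sum.atMost_Suc_shift[of ?u k] by (simp add: add_ac)
  \<comment> \<open>The top term has a vanishing binomial. In the others a factor 1 - y splits off
    and shifts the argument to yQ, so the total becomes y + (1 - y).\<close>
  also have "(\<Sum>j\<le>Suc k. ?u j) = (\<Sum>j\<le>k. ?u j)" by (simp add: gauss_binomial_eq_0)
  also have "\<dots> = (\<Sum>j\<le>k. (1 - y) * (gauss_binomial Q k j * (y * Q) ^ j * q_pochhammer (y * Q) Q (k - j)))"
    by (rule sum.cong) (simp_all add: Suc_diff_le q_pochhammer_Suc power_mult_distrib mult_ac)
  also have "\<dots> = (1 - y) * ?S (y * Q)" by (simp only: sum_distrib_left)
  finally show ?case unfolding Suc.IH by simp
qed

lemma q_product_split:
  "q_product Q (m + d) = q_product Q m * q_pochhammer (Q ^ Suc m) Q d"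
proof (induction d)
  case 0
  show ?case by (simp add: q_pochhammer_def)
next
  case (Suc d)
  then show ?case by (simp add: q_product_Suc q_pochhammer_def power_add mult_ac)
qed

lemma double_sum_descending:
  "m \<le> n \<Longrightarrow> 2 * int (\<Sum>t = 1..m. n - t) = int m * (2 * int n - int m - 1)"
proof (induction m)
  case (Suc m)
  then show ?case by (simp add: of_nat_diff algebra_simps)
qed simp

text \<open>The closed form is stated with explicit inverses \<open>I m\<close> of the products \<open>q_product Q m\<close>,
  so that it applies to formal power series.\<close>

lemma closed_form_recursion:
  fixes Q :: "'a::comm_ring_1"
  assumes n: "n > 0" and kn: "2 * k \<le> n"
    and I: "\<And>m. q_product Q m * I m = 1"
    and h: "\<And>t. h t * (1 - Q ^ Suc t) = Q ^ t * (1 - Q)"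
  defines "C \<equiv> \<lambda>k. Q ^ (\<Sum>t = 1..k. n - t) * (1 - Q) ^ k * q_product Q (n - k - 1) * I k * I (n - 1)"
  shows "Q ^ (k * (n - k)) * (\<Sum>j\<le>k. (\<Prod>t<k - j. h t) * C j) = C k"
proof -
  \<comment> \<open>The product of the relations \<open>h\<close> over t < d, with the denominators
    1 - Q^(t+1) collected in \<open>q_product Q d\<close>.\<close>
  have H0: "(\<Prod>t<d. h t) * q_product Q d = Q ^ (\<Sum>t<d. t) * (1 - Q) ^ d" for d
  proof (induction d)
    case (Suc d)
    have "(\<Prod>t<Suc d. h t) * q_product Q (Suc d) =
        ((\<Prod>t<d. h t) * q_product Q d) * (h d * (1 - Q ^ Suc d))"
      by (simp add: q_product_Suc mult_ac)
    then show ?case unfolding Suc.IH h by (simp add: power_add mult_ac)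
  qed simp
  have H: "(\<Prod>t<d. h t) = Q ^ (\<Sum>t<d. t) * (1 - Q) ^ d * I d" for d
  proof -
    have "(\<Prod>t<d. h t) = (\<Prod>t<d. h t) * (q_product Q d * I d)" by (simp add: I)
    also have "\<dots> = ((\<Prod>t<d. h t) * q_product Q d) * I d" by (simp only: mult.assoc)
    finally show ?thesis unfolding H0 .
  qed
  have knle: "k \<le> n - 1" if "k > 0" using kn that by simp
  have k_le: "k \<le> n - 1" using knle by (cases "k = 0") simp_all
  \<comment> \<open>Each term is C k times the corresponding term of the q-binomial identity at y =
    Q^(n-k).\<close>
  have summand: "Q ^ (k * (n - k)) * ((\<Prod>t<k - j. h t) * C j) =
      C k * (gauss_binomial Q k j * (Q ^ (n - k)) ^ j * q_pochhammer (Q ^ (n - k)) Q (k - j))"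
    if j: "j \<le> k" for j
  proof -
    have g: "gauss_binomial Q k j = q_product Q k * I j * I (k - j)"
    proof -
      have "gauss_binomial Q k j = gauss_binomial Q k j * (q_product Q j * I j) * (q_product Q (k - j) * I (k - j))"
        by (simp add: I)
      also have "\<dots> = (gauss_binomial Q k j * (q_product Q j * q_product Q (k - j))) * I j * I (k - j)"
        by (simp only: mult_ac)
      finally show ?thesis unfolding gauss_binomial_q_product[OF j] .
    qed
    have p: "q_product Q (n - j - 1) = q_product Q (n - k - 1) * q_pochhammer (Q ^ (n - k)) Q (k - j)"
    proof -
      have "n - j - 1 = (n - k - 1) + (k - j)" "Suc (n - k - 1) = n - k" using j k_le n by auto
      then show ?thesis using q_product_split[of Q "n - k - 1" "k - j"] by simp
    qed
    have gauss: "2 * int (\<Sum>t<d. t) = int d * (int d - 1)" for d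
      by (induction d) (simp_all add: algebra_simps)
    \<comment> \<open>Once the power of Q belonging to C k is removed, precisely y^j remains.
      Doubling turns the triangular sums into polynomials over the integers.\<close>
    have e: "k * (n - k) + (\<Sum>t<k - j. t) + (\<Sum>t = 1..j. n - t) = (\<Sum>t = 1..k. n - t) + (n - k) * j"
    proof -
      have kj: "int (k - j) = int k - int j" "int (n - k) = int n - int k" using j k_le n by auto
      have tj: "2 * int (\<Sum>t = 1..j. n - t) = int j * (2 * int n - int j - 1)"
        and tk: "2 * int (\<Sum>t = 1..k. n - t) = int k * (2 * int n - int k - 1)"
        by (rule double_sum_descending, use j k_le in linarith)+
      have "2 * int (k * (n - k) + (\<Sum>t<k - j. t) + (\<Sum>t = 1..j. n - t)) =
          2 * (int k * (int n - int k)) + (int k - int j) * (int k - int j - 1) + int j * (2 * int n - int j - 1)"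
        by (simp only: of_nat_add of_nat_mult distrib_left gauss kj tj)
      also have "\<dots> = int k * (2 * int n - int k - 1) + 2 * ((int n - int k) * int j)"
        by (simp add: algebra_simps)
      also have "\<dots> = 2 * int ((\<Sum>t = 1..k. n - t) + (n - k) * j)"
        by (simp only: of_nat_add of_nat_mult distrib_left kj tk)
      finally show ?thesis by (simp only: of_nat_eq_iff mult_cancel_left) simp
    qed
    have ab: "(1 - Q) ^ (k - j) * (1 - Q) ^ j = (1 - Q) ^ k" using j by (simp flip: power_add)
    have "Q ^ (k * (n - k)) * ((\<Prod>t<k - j. h t) * C j) =
        Q ^ (k * (n - k) + (\<Sum>t<k - j. t) + (\<Sum>t = 1..j. n - t)) * ((1 - Q) ^ (k - j) * (1 - Q) ^ j) *
        I (k - j) * q_product Q (n - j - 1) * I j * I (n - 1)"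
      unfolding H C_def power_add by (simp only: mult_ac)
    also have "\<dots> = Q ^ ((\<Sum>t = 1..k. n - t) + (n - k) * j) * (1 - Q) ^ k * I (k - j) *
        (q_product Q (n - k - 1) * q_pochhammer (Q ^ (n - k)) Q (k - j)) * I j * I (n - 1) * (q_product Q k * I k)"
      unfolding e ab p I by simp
    also have "\<dots> = C k * (gauss_binomial Q k j * (Q ^ (n - k)) ^ j * q_pochhammer (Q ^ (n - k)) Q (k - j))"
      unfolding g C_def power_add power_mult by (simp only: mult_ac)
    finally show ?thesis .
  qed
  have "Q ^ (k * (n - k)) * (\<Sum>j\<le>k. (\<Prod>t<k - j. h t) * C j) =
      (\<Sum>j\<le>k. C k * (gauss_binomial Q k j * (Q ^ (n - k)) ^ j * q_pochhammer (Q ^ (n - k)) Q (k - j)))"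
    unfolding sum_distrib_left by (rule sum.cong) (simp_all only: atMost_iff summand)
  also have "\<dots> = C k" unfolding sum_distrib_left[symmetric] gauss_binomial_sum by simp
  finally show ?thesis .
qed

section \<open>Summation of formal power series\<close>

context minimal_involution
begin

lemma lev_eq_profile: "i \<in> {1..int n} \<Longrightarrow> lev i = profile n w i"
  by (simp add: profile_def lev_def)

text \<open>The zero block contributes a q-factorial that depends on n and k only, hence is common
  to all summands; a top position contributes a base-q^2 integer governed by its rank.\<close>

lemma twisted_poincare_profile:
  fixes q :: "'a::comm_semiring_1"
  assumes kn: "2 * k \<le> n" and c: "profile n w \<in> level_profiles n k M"
  shows "twisted_poincare n w q = (\<Prod>m = 1..n - 2 * k. \<Sum>t<m. q ^ t) *
    (\<Prod>j = int n - int k + 1..int n. \<Sum>t<Suc (block_pos n (profile n w) j). (q ^ 2) ^ t)"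
proof -
  let ?c = "profile n w"
  let ?g = "\<lambda>j. \<Sum>t<card {i \<in> nonneg. i \<le> j \<and> lev i = lev j}. (q ^ level_weight (lev j)) ^ t"
  have lc: "lev i = ?c i" if "i \<in> {1..int n}" for i using lev_eq_profile[OF that] .
  note top = profile_top[OF kn c] and mid = profile_middle[OF kn c] and bot = profile_bottom[OF kn c]
  have nn: "nonneg = {int k + 1..int n - int k} \<union> {int n - int k + 1..int n}" (is "_ = ?Z \<union> ?T")
  proof (intro Set.set_eqI iffI)
    fix i assume i: "i \<in> nonneg"
    then have "i \<in> {1..int n}" by (simp add: nonneg_def)
    then show "i \<in> ?Z \<union> ?T" using bot[of i] lc[of i] i by (force simp: nonneg_def)
  next
    fix i assume i: "i \<in> ?Z \<union> ?T"
    then have "i \<in> {1..int n}" "int k < i" using kn by auto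
    then show "i \<in> nonneg" using level_profile_nonneg[OF kn c, of i] lc[of i] by (simp add: nonneg_def)
  qed
  have TW: "i \<in> {1..int n}" if "i \<in> ?T" for i using that kn by auto
  have ZW: "i \<in> {1..int n}" if "i \<in> ?Z" for i using that by auto
  have Z0: "lev i = 0" if "i \<in> ?Z" for i using mid[OF that] lc[OF ZW[OF that]] by simp
  have T0: "0 < lev i" if "i \<in> ?T" for i using top[OF that] lc[OF TW[OF that]] by simp
  have "?g j = (\<Sum>t<nat (j - int k). q ^ t)" if j: "j \<in> ?Z" for j
  proof -
    have "{i \<in> nonneg. i \<le> j \<and> lev i = lev j} = {int k + 1..j}"
    proof (intro Set.set_eqI iffI)
      fix i assume "i \<in> {int k + 1..j}"
      then have "i \<in> ?Z" using j by auto
      then show "i \<in> {i \<in> nonneg. i \<le> j \<and> lev i = lev j}"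
        using Z0[of i] Z0[OF j] \<open>i \<in> {int k + 1..j}\<close> unfolding nn by simp
    qed (use kn in \<open>auto simp: nn\<close>)
    then show ?thesis using Z0[OF j] by (simp add: level_weight_def)
  qed
  then have "(\<Prod>j\<in>?Z. ?g j) = (\<Prod>j\<in>?Z. \<Sum>t<nat (j - int k). q ^ t)" by (intro prod.cong refl)
  also have "\<dots> = (\<Prod>m = 1..n - 2 * k. \<Sum>t<m. q ^ t)"
    by (rule prod.reindex_bij_witness[where i = "\<lambda>m. int k + int m" and j = "\<lambda>j. nat (j - int k)"])
      (use kn in auto)
  finally have Z: "(\<Prod>j\<in>?Z. ?g j) = (\<Prod>m = 1..n - 2 * k. \<Sum>t<m. q ^ t)" .
  have "?g j = (\<Sum>t<Suc (block_pos n ?c j). (q ^ 2) ^ t)" if j: "j \<in> ?T" for j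
  proof -
    have iff: "lev i = lev j \<longleftrightarrow> ?c i = ?c j" if "i \<in> {1..int n}" for i
      by (simp only: lc[OF that] lc[OF TW[OF j]])
    have e: "{i \<in> nonneg. i \<le> j \<and> lev i = lev j} = insert j {i \<in> {1..int n}. i < j \<and> ?c i = ?c j}"
    proof (intro Set.set_eqI iffI)
      fix i assume "i \<in> {i \<in> nonneg. i \<le> j \<and> lev i = lev j}"
      then show "i \<in> insert j {i \<in> {1..int n}. i < j \<and> ?c i = ?c j}"
        using iff[of i] by (auto simp: nonneg_def)
    next
      fix i assume "i \<in> insert j {i \<in> {1..int n}. i < j \<and> ?c i = ?c j}"
      then show "i \<in> {i \<in> nonneg. i \<le> j \<and> lev i = lev j}"
        using iff[of i] T0[OF j] TW[OF j] by (auto simp: nonneg_def)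
    qed
    have "j \<notin> {i \<in> {1..int n}. i < j \<and> ?c i = ?c j}" by simp
    from card_insert_disjoint[OF finite_window this]
    have "card {i \<in> nonneg. i \<le> j \<and> lev i = lev j} = Suc (block_pos n ?c j)"
      by (simp only: e block_pos_def)
    then show ?thesis using T0[OF j] by (simp only: level_weight_def) simp
  qed
  then have T: "(\<Prod>j\<in>?T. ?g j) = (\<Prod>j\<in>?T. \<Sum>t<Suc (block_pos n ?c j). (q ^ 2) ^ t)" by (intro prod.cong refl)
  have "?Z \<inter> ?T = {}" by auto
  then have "twisted_poincare n w q = (\<Prod>j\<in>?Z. ?g j) * (\<Prod>j\<in>?T. ?g j)"
    unfolding twisted_poincare_eq nn by (intro prod.union_disjoint) simp_all
  then show ?thesis unfolding Z T .
qed

lemma cox_length_profile: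
  assumes kn: "2 * k \<le> n" and c: "profile n w \<in> level_profiles n k M"
  shows "k * (2 * n - 2 * k - 1) + cox_length n w =
    2 * (half_height n (profile n w) + (\<Sum>j = int n - int k + 1..int n. block_pos n (profile n w) j))"
proof -
  let ?c = "profile n w"
  have "cox_length n w = (\<Sum>i = 1..int n. \<Sum>j = 1..int n. nat (?c i - ?c j - 1))"
    unfolding cox_length_eq_inv_number[OF n_pos w_affine] inv_number_eq
    by (intro sum.cong refl) (simp_all add: lev_eq_profile)
  moreover have "int (k * (2 * n - 2 * k - 1)) = int k * (2 * int n - 2 * int k - 1)"
    using kn n_pos by (simp add: of_nat_diff)
  ultimately have "int (k * (2 * n - 2 * k - 1)) + int (cox_length n w) = 2 * int (half_height n ?c) +
      2 * (\<Sum>j = int n - int k + 1..int n. int (block_pos n ?c j))"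
    using profile_length[OF kn c] by linarith
  also have "\<dots> = int (2 * (half_height n ?c + (\<Sum>j = int n - int k + 1..int n. block_pos n ?c j)))"
    by (simp add: distrib_left)
  finally show ?thesis by (simp only: of_nat_eq_iff of_nat_add[symmetric])
qed

text \<open>The pair of i and its reflection alone contributes 2 \<open>lev i\<close> - 1. Thus a
  large level forces a large length, which controls the tail of the infinite sum.\<close>

lemma lev_le_cox_length:
  assumes i: "i \<in> {1..int n}" and "0 < lev i"
  shows "lev i \<le> int (cox_length n w)"
proof -
  have i': "int n + 1 - i \<in> {1..int n}" using i by auto
  have "nat (lev i - lev (int n + 1 - i) - 1) \<le> (\<Sum>j = 1..int n. nat (lev i - lev j - 1))"
    by (rule member_le_sum[OF i']) simp_all
  also have "\<dots> \<le> inv_number n w" unfolding inv_number_eq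
    by (rule member_le_sum[OF i, of "\<lambda>i. \<Sum>j = 1..int n. nat (lev i - lev j - 1)"]) simp_all
  finally have "lev i \<le> int (inv_number n w)" using lev_reflect[OF i] assms(2) by simp
  then show ?thesis by (simp only: cox_length_eq_inv_number[OF n_pos w_affine])
qed

end

definition minimal_involutions :: "nat \<Rightarrow> nat \<Rightarrow> (int \<Rightarrow> int) set" where
  "minimal_involutions n k = {w. minimal_involution n w \<and> abs_length n w = k}"

lemma profile_bij:
  assumes n: "n > 0" and k: "k \<le> n"
  shows "bij_betw (profile n) {w \<in> minimal_involutions n k. \<forall>i \<in> {1..int n}. profile n w i \<le> int M}
    (level_profiles n k M)"
proof (rule bij_betw_byWitness[where f' = "build_involution n"])
  show "\<forall>w\<in>{w \<in> minimal_involutions n k. \<forall>i \<in> {1..int n}. profile n w i \<le> int M}.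
      build_involution n (profile n w) = w"
    using minimal_involution.build_involution_profile by (auto simp: minimal_involutions_def)
  show "\<forall>c\<in>level_profiles n k M. profile n (build_involution n c) = c"
    using build_involution_props(2)[OF n] by blast
  show "profile n ` {w \<in> minimal_involutions n k. \<forall>i \<in> {1..int n}. profile n w i \<le> int M} \<subseteq> level_profiles n k M"
  proof
    fix c assume "c \<in> profile n ` {w \<in> minimal_involutions n k. \<forall>i \<in> {1..int n}. profile n w i \<le> int M}"
    then obtain w where w: "c = profile n w" "minimal_involution n w" "abs_length n w = k"
      "\<forall>i \<in> {1..int n}. profile n w i \<le> int M"
      unfolding minimal_involutions_def by blast
    interpret minimal_involution n w by (rule w(2))
    show "c \<in> level_profiles n k M" unfolding w(1)
    proof (rule profile_in_level_profiles[OF k w(3)])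
      fix i assume "i \<in> {1..int n}"
      then show "lev i \<le> int M" using w(4) lev_eq_profile by simp
    qed
  qed
  show "build_involution n ` level_profiles n k M \<subseteq>
      {w \<in> minimal_involutions n k. \<forall>i \<in> {1..int n}. profile n w i \<le> int M}"
  proof
    fix w assume "w \<in> build_involution n ` level_profiles n k M"
    then obtain c where c: "w = build_involution n c" "c \<in> level_profiles n k M" by blast
    interpret minimal_involution n w unfolding c(1) by (rule build_involution_props(1)[OF n c(2)])
    have p: "profile n w = c" unfolding c(1) by (rule build_involution_props(2)[OF n c(2)])
    have "lev i = c i" if "i \<in> {1..int n}" for i using p that by (auto simp: profile_def lev_def)
    then have "abs_length n w = k" using abs_length_iff[OF k] level_profilesD(5)[OF c(2)] by simp
    then show "w \<in> {w \<in> minimal_involutions n k. \<forall>i \<in> {1..int n}. profile n w i \<le> int M}"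
      using minimal_involution_axioms p level_profilesD(4)[OF c(2)] by (simp add: minimal_involutions_def)
  qed
qed

section \<open>Weights as formal power series\<close>

lemma fps_nth_0_prod: "fps_nth (\<Prod>i\<in>A. f i) 0 = (\<Prod>i\<in>A. fps_nth (f i) 0)"
  for f :: "'b \<Rightarrow> 'a::comm_ring_1 fps"
  by (induction A rule: infinite_finite_induct) simp_all

lemma fps_inverse_prod: "inverse (\<Prod>i\<in>A. f i) = (\<Prod>i\<in>A. inverse (f i))"
  for f :: "'b \<Rightarrow> 'a::field fps"
  by (induction A rule: infinite_finite_induct) (simp_all add: fps_inverse_mult)

lemma geometric_nth_0:
  fixes x :: "'a::comm_ring_1 fps"
  assumes "fps_nth x 0 = 0" "m > 0"
  shows "fps_nth (\<Sum>t<m. x ^ t) 0 = 1"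
proof -
  obtain d where "m = Suc d" using assms(2) gr0_implies_Suc by blast
  then show ?thesis using assms(1)
    by (simp add: fps_sum_nth sum.lessThan_Suc_shift fps_nth_power_0 power_0_left del: sum.lessThan_Suc)
qed

lemma q_product_nth_0: "fps_nth x 0 = 0 \<Longrightarrow> fps_nth (q_product x m) 0 = (1::'a::comm_ring_1)"
  by (simp add: q_product_def fps_nth_0_prod fps_nth_power_0 power_0_left)

text \<open>The share of a position of rank t in a positive block: the numerator comes from the
  length, the inverse from the twisted Poincare polynomial.\<close>

definition block_weight :: "nat \<Rightarrow> rat fps" where
  "block_weight t = (fps_X ^ 2) ^ t * inverse (\<Sum>s<Suc t. (fps_X ^ 2) ^ s)"

lemma block_weight_mult: "block_weight t * (1 - (fps_X ^ 2) ^ Suc t) = (fps_X ^ 2) ^ t * (1 - fps_X ^ 2)"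
proof -
  let ?Q = "fps_X ^ 2 :: rat fps" and ?s = "\<Sum>s<Suc t. (fps_X ^ 2 :: rat fps) ^ s"
  have pow: "1 - ?Q ^ Suc t = (1 - ?Q) * ?s" by (rule one_diff_power_eq)
  have inv: "inverse ?s * ?s = 1" 
  proof (rule inverse_mult_eq_1)
    have "fps_nth ?Q 0 = 0" by (simp add: fps_nth_power_0)
    then show "fps_nth ?s 0 \<noteq> 0" using geometric_nth_0[of ?Q "Suc t"] by (simp del: sum.lessThan_Suc)
  qed
  have "block_weight t * (1 - ?Q ^ Suc t) = ?Q ^ t * (1 - ?Q) * (inverse ?s * ?s)"
    unfolding block_weight_def pow by (simp only: mult_ac)
  then show ?thesis unfolding inv by simp
qed


text \<open>The normalising power makes the exponent even, and the whole dependence on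
  \<open>w\<close> moves into \<open>profile_weight\<close>.\<close>

lemma minimal_involution_weight:
  assumes "minimal_involution n w" and kn: "2 * k \<le> n" and c: "profile n w \<in> level_profiles n k M"
  shows "fps_X ^ (k * (2 * n - 2 * k - 1)) *
      (fps_X ^ cox_length n w * (poincare n (fps_X ^ 2) / twisted_poincare n w fps_X)) =
    poincare n (fps_X ^ 2) * inverse (\<Prod>m = 1..n - 2 * k. \<Sum>t<m. fps_X ^ t) *
      profile_weight (fps_X ^ 2) block_weight n k (profile n w)"
proof -
  interpret minimal_involution n w by fact
  let ?c = "profile n w" and ?Q = "fps_X ^ 2 :: rat fps"
  let ?T = "{int n - int k + 1..int n}"
  let ?F = "\<Prod>m = 1..n - 2 * k. \<Sum>t<m. (fps_X :: rat fps) ^ t"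
  let ?R = "\<Prod>j\<in>?T. \<Sum>t<Suc (block_pos n ?c j). ?Q ^ t"
  have Q0: "fps_nth ?Q 0 = 0" by (simp add: fps_nth_power_0)
  have X0: "fps_nth (fps_X :: rat fps) 0 = 0" by simp
  have F0: "fps_nth ?F 0 = 1" unfolding fps_nth_0_prod
    by (rule prod.neutral) (use geometric_nth_0[OF X0] in auto)
  have R0: "fps_nth ?R 0 = 1" unfolding fps_nth_0_prod
    by (rule prod.neutral) (use geometric_nth_0[OF Q0] in blast)
  define Y where "Y = (\<Prod>j\<in>?T. ?Q ^ block_pos n ?c j)"
  have tp: "twisted_poincare n w fps_X = ?F * ?R" by (rule twisted_poincare_profile[OF kn c])
  have "fps_nth (?F * ?R) 0 \<noteq> 0" by (simp only: fps_mult_nth_0 F0 R0)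
  then have quot: "poincare n ?Q / twisted_poincare n w fps_X = poincare n ?Q * (inverse ?F * inverse ?R)"
    unfolding tp fps_inverse_mult[symmetric] by (rule fps_divide_unit)
  have pow: "(fps_X :: rat fps) ^ (k * (2 * n - 2 * k - 1)) * fps_X ^ cox_length n w = ?Q ^ half_height n ?c * Y"
  proof -
    let ?p = "half_height n ?c + (\<Sum>j\<in>?T. block_pos n ?c j)"
    have "(fps_X :: rat fps) ^ (k * (2 * n - 2 * k - 1)) * fps_X ^ cox_length n w = fps_X ^ (2 * ?p)"
      by (simp only: power_add[symmetric] cox_length_profile[OF kn c])
    also have "\<dots> = ?Q ^ ?p" by (rule power_mult)
    finally show ?thesis by (simp only: power_add Y_def power_sum)
  qed
  have weight: "profile_weight ?Q block_weight n k ?c = (?Q ^ half_height n ?c * Y) * inverse ?R"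
    unfolding profile_weight_def block_weight_def prod.distrib fps_inverse_prod mult.assoc Y_def ..
  show ?thesis unfolding quot weight mult.assoc[symmetric] pow by (simp only: mult_ac)
qed

text \<open>Bounded sums and closed form satisfy the same linear recursion, so their differences do
  too; for k > 0 its leading power of Q is divisible by the indeterminate and gains one order per
  step.\<close>

lemma closed_form_approximation:
  fixes n :: nat
  assumes n: "n > 0"
  defines "Q \<equiv> fps_X ^ 2 :: rat fps"
  defines "C \<equiv> \<lambda>k. Q ^ (\<Sum>t = 1..k. n - t) * (1 - Q) ^ k * q_product Q (n - k - 1) *
    inverse (q_product Q k) * inverse (q_product Q (n - 1))"
  assumes "2 * k \<le> n"
  shows "fps_X ^ M dvd (\<Sum>c\<in>level_profiles n k M. profile_weight Q block_weight n k c) - C k"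
  using assms(4)
proof (induction M arbitrary: k)
  case 0
  show ?case by simp
next
  case (Suc M)
  have Q0: "fps_nth Q 0 = 0" by (simp add: Q_def fps_nth_power_0)
  have unit: "q_product Q m * inverse (q_product Q m) = 1" for m
    by (rule inverse_mult_eq_1') (simp add: q_product_nth_0[OF Q0])
  have C_rec: "Q ^ (j * (n - j)) * (\<Sum>i\<le>j. (\<Prod>t<j - i. block_weight t) * C i) = C j" if "2 * j \<le> n" for j
    unfolding C_def
    by (rule closed_form_recursion[OF n that unit]) (use block_weight_mult in \<open>simp only: Q_def\<close>)
  let ?G = "\<lambda>k. \<Sum>c\<in>level_profiles n k M. profile_weight Q block_weight n k c"
  show ?case
  proof (cases "k = 0")
    \<comment> \<open>Here the leading exponent k(n-k) is 0 and gains nothing, but both sides are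
      equal to 1.\<close>
    case True
    then have "C k = 1" using C_rec[of 0] unit[of "n - 1"] by (simp add: C_def)
    then show ?thesis using True by (simp add: sum_profile_weight_0)
  next
    case False
    have "(\<Sum>c\<in>level_profiles n k (Suc M). profile_weight Q block_weight n k c) - C k =
        Q ^ (k * (n - k)) * (\<Sum>j\<le>k. (\<Prod>t<k - j. block_weight t) * ?G j) -
        Q ^ (k * (n - k)) * (\<Sum>j\<le>k. (\<Prod>t<k - j. block_weight t) * C j)"
      by (simp only: sum_profile_weight_Suc[OF Suc.prems] C_rec[OF Suc.prems])
    also have "\<dots> = Q ^ (k * (n - k)) * (\<Sum>j\<le>k. (\<Prod>t<k - j. block_weight t) * (?G j - C j))"
      by (simp add: right_diff_distrib sum_subtractf)
    finally have eq: "(\<Sum>c\<in>level_profiles n k (Suc M). profile_weight Q block_weight n k c) - C k =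
        Q ^ (k * (n - k)) * (\<Sum>j\<le>k. (\<Prod>t<k - j. block_weight t) * (?G j - C j))" .
    have "fps_X ^ M dvd (\<Sum>j\<le>k. (\<Prod>t<k - j. block_weight t) * (?G j - C j))"
    proof (rule dvd_sum)
      fix j assume "j \<in> {..k}"
      then have "2 * j \<le> n" using Suc.prems by simp
      from Suc.IH[OF this] show "fps_X ^ M dvd (\<Prod>t<k - j. block_weight t) * (?G j - C j)"
        by (rule dvd_mult)
    qed
    moreover have "fps_X dvd Q ^ (k * (n - k))"
    proof -
      have "0 < 2 * (k * (n - k))" using False Suc.prems n by simp
      then show ?thesis unfolding Q_def power_mult[symmetric] by (rule dvd_power[OF disjI1])
    qed
    ultimately have "fps_X * fps_X ^ M dvd Q ^ (k * (n - k)) * (\<Sum>j\<le>k. (\<Prod>t<k - j. block_weight t) * (?G j - C j))"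
      by (intro mult_dvd_mono)
    then show ?thesis unfolding eq by simp
  qed
qed

section \<open>Comparison with the stated product over Laurent series\<close>

lemma fps_to_fls_prod: "fps_to_fls (\<Prod>i\<in>A. f i) = (\<Prod>i\<in>A. fps_to_fls (f i))"
  for f :: "'b \<Rightarrow> 'a::comm_ring_1 fps"
  by (induction A rule: infinite_finite_induct) (simp_all add: fls_times_fps_to_fls)

lemma fps_to_fls_sum: "fps_to_fls (\<Sum>i\<in>A. f i) = (\<Sum>i\<in>A. fps_to_fls (f i))"
  for f :: "'b \<Rightarrow> 'a::comm_ring_1 fps"
  by (induction A rule: infinite_finite_induct) simp_all

lemma fps_to_fls_inverse: "fps_nth g 0 \<noteq> 0 \<Longrightarrow> fps_to_fls (inverse g) = inverse (fps_to_fls g)"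
  for g :: "'a::field fps"
  by (simp add: fls_inverse_fps_to_fls)

lemma fps_to_fls_divide: "fps_nth g 0 \<noteq> 0 \<Longrightarrow> fps_to_fls (f / g) = fps_to_fls f / fps_to_fls g"
  for f g :: "'a::field fps"
  by (simp add: fps_divide_unit fls_times_fps_to_fls fps_to_fls_inverse divide_inverse)

lemma geometric_prod:
  fixes x :: "'a::field"
  assumes "x \<noteq> 1"
  shows "(\<Prod>m = 1..N. \<Sum>t<m. x ^ t) = q_product x N / (1 - x) ^ N"
proof -
  have "(\<Sum>t<m. x ^ t) = (1 - x ^ m) / (1 - x)" for m
    using one_diff_power_eq[of x m] assms by simp
  then show ?thesis by (simp add: q_product_def prod_dividef)
qed

text \<open>With base x^2, every factor 1 - x^(2i) splits as (1 - x^i)(1 + x^i). Both sides thereby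
  reduce to the products \<open>q_product x\<close> and \<open>pp\<close> and to powers of 1 - x and
  1 + x.\<close>

lemma closed_form_field:
  fixes x :: "'a::field"
  assumes n: "n > 0" and kn: "2 * k \<le> n" and nz: "\<And>i. i > 0 \<Longrightarrow> x ^ i \<noteq> 1"
  shows "x ^ (k * (2 * n - 2 * k - 1)) *
    (x ^ k\<^sup>2 * (((1 - x ^ n) / (1 - x)) / ((1 - x ^ (2 * n - 2 * k)) / (1 - x))) *
      ((\<Prod>i = 1..n - k. (1 - x ^ i) / (1 - x)) /
        ((\<Prod>i = 1..k. (1 - x ^ i) / (1 - x)) * (\<Prod>i = 1..n - k - k. (1 - x ^ i) / (1 - x)))) *
      q_pochhammer (- (x ^ (k + 1))) x (n - 2 * k) * ((1 + x) / (1 - x)) ^ k *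
      ((1 + x ^ n) / (1 + x) ^ n)) =
    (\<Prod>m = 1..n. \<Sum>t<m. (x ^ 2) ^ t) / (\<Prod>m = 1..n - 2 * k. \<Sum>t<m. x ^ t) *
      ((x ^ 2) ^ (\<Sum>t = 1..k. n - t) * (1 - x ^ 2) ^ k * q_product (x ^ 2) (n - k - 1) /
        (q_product (x ^ 2) k * q_product (x ^ 2) (n - 1)))"
proof -
  define a b where "a = 1 - x" and "b = 1 + x"
  define pp where "pp m = (\<Prod>i = 1..m. 1 + x ^ i)" for m
  have nz2: "1 - x ^ i \<noteq> 0" "1 + x ^ i \<noteq> 0" if "i > 0" for i
  proof -
    show "1 - x ^ i \<noteq> 0" using nz[OF that] by simp
    have "(1 - x ^ i) * (1 + x ^ i) = 1 - x ^ (i + i)" by (simp add: algebra_simps power_add)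
    moreover have "x ^ (i + i) \<noteq> 1" using nz that by simp
    ultimately show "1 + x ^ i \<noteq> 0" by auto
  qed
  have ab0: "a \<noteq> 0" "b \<noteq> 0" using nz2[of 1] by (simp_all add: a_def b_def)
  have q0: "q_product x m \<noteq> 0" "pp m \<noteq> 0" for m
    unfolding q_product_def pp_def
    by (subst prod_zero_iff; use nz2 in \<open>fastforce simp del: right_minus_eq\<close>)+
  have qQ: "q_product (x ^ 2) m = q_product x m * pp m" for m
    unfolding q_product_def pp_def prod.distrib[symmetric]
    by (rule prod.cong) (simp_all add: algebra_simps flip: power_mult power_add mult_2)
  have Qab: "1 - x ^ 2 = a * b" by (simp add: a_def b_def algebra_simps power2_eq_square)
  have frac: "(\<Prod>i = 1..m. (1 - x ^ i) / (1 - x)) = q_product x m / a ^ m" for m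
    by (simp add: q_product_def prod_dividef a_def)
  have poch: "pp (k + d) = pp k * q_pochhammer (- (x ^ (k + 1))) x d" for d
  proof (induction d)
    case 0
    show ?case by (simp add: q_pochhammer_def)
  next
    case (Suc d)
    have "pp (k + Suc d) = pp (k + d) * (1 + x ^ (k + Suc d))" by (simp add: pp_def)
    then show ?case using Suc.IH by (simp add: q_pochhammer_def power_add mult_ac)
  qed
  have "k + (n - 2 * k) = n - k" using kn by simp
  \<comment> \<open>The shifted q-Pochhammer symbol is the segment of \<open>pp\<close> from k+1 to
    n-k.\<close>
  then have P: "q_pochhammer (- (x ^ (k + 1))) x (n - 2 * k) = pp (n - k) / pp k"
    using poch[of "n - 2 * k"] q0(2)[of k] by (simp add: field_simps)
  have x2: "x ^ 2 \<noteq> 1" using nz[of 2] by simp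
  have x1: "x \<noteq> 1" using nz[of 1] by simp
  have "k \<le> n" using kn by simp
  have "int (k * (2 * n - 2 * k - 1)) = int k * (2 * int n - 2 * int k - 1)"
    using kn n by (simp add: of_nat_diff)
  then have "int (k * (2 * n - 2 * k - 1) + k\<^sup>2) = int (2 * (\<Sum>t = 1..k. n - t))"
    using double_sum_descending[OF \<open>k \<le> n\<close>] by (simp add: algebra_simps power2_eq_square)
  then have e: "k * (2 * n - 2 * k - 1) + k\<^sup>2 = 2 * (\<Sum>t = 1..k. n - t)" by (simp only: of_nat_eq_iff)
  have X: "x ^ (k * (2 * n - 2 * k - 1)) * x ^ k\<^sup>2 = (x ^ 2) ^ (\<Sum>t = 1..k. n - t)"
    by (simp only: power_add[symmetric] e power_mult[of x 2])
  define D where "D = 1 - x ^ (2 * n - 2 * k)"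
  have "2 * n - 2 * k > 0" using kn n by simp
  then have D0: "D \<noteq> 0" unfolding D_def by (rule nz2)
  have nk: "n - k = Suc (n - k - 1)" "n = Suc (n - 1)" using kn n by auto
  \<comment> \<open>The last factor of the base-x^2 product is the numerator of the q-integer of 2n
    - 2k, which is where that denominator comes from.\<close>
  have F: "q_product x (n - k) * pp (n - k) = q_product (x ^ 2) (n - k - 1) * D"
  proof -
    have "q_product (x ^ 2) (n - k) = q_product (x ^ 2) (n - k - 1) * (1 - (x ^ 2) ^ (n - k))"
      using q_product_Suc[of "x ^ 2" "n - k - 1"] nk(1) by simp
    then show ?thesis unfolding qQ[of "n - k"] D_def by (simp add: diff_mult_distrib2 flip: power_mult)
  qed
  have N: "q_product (x ^ 2) n = q_product (x ^ 2) (n - 1) * ((1 - x ^ n) * (1 + x ^ n))"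
  proof -
    have "q_product (x ^ 2) n = q_product (x ^ 2) (n - 1) * (1 - (x ^ 2) ^ n)"
      using q_product_Suc[of "x ^ 2" "n - 1"] nk(2) by simp
    moreover have "1 - (x ^ 2) ^ n = (1 - x ^ n) * (1 + x ^ n)"
      by (simp add: algebra_simps flip: power_mult power_add mult_2)
    ultimately show ?thesis by simp
  qed
  define A \<alpha> where "A = a ^ (n - 2 * k)" and "\<alpha> = a ^ k"
  have pw: "a ^ (n - k) = A * \<alpha>" "a ^ n = A * \<alpha> * \<alpha>" "a ^ (n - k - k) = A"
  proof -
    have "n - k = (n - 2 * k) + k" "n = (n - 2 * k) + k + k" "n - k - k = n - 2 * k" using kn by auto
    then show "a ^ (n - k) = A * \<alpha>" "a ^ n = A * \<alpha> * \<alpha>" "a ^ (n - k - k) = A"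
      unfolding A_def \<alpha>_def by (metis power_add)+
  qed
  have A0: "A \<noteq> 0" "\<alpha> \<noteq> 0" using ab0 by (simp_all add: A_def \<alpha>_def)
  \<comment> \<open>All products and powers become letters, leaving a rational identity whose only
    inputs are the relations \<open>X\<close> and \<open>F\<close>; \<beta> and \<open>B\<close>
    stand for the k-th and n-th powers of 1 + x.\<close>
  have alg: "E1 * (E2 * ((N1 / a) / (D / a)) * ((F / (A * \<alpha>)) / ((G / \<alpha>) * (H / A))) * (P1 / P2) * (\<beta> / \<alpha>) * (N2 / B)) =
      (C * (N1 * N2)) / (A * \<alpha> * \<alpha> * B) / (H / A) * (E * (\<alpha> * \<beta>) * C2 / ((G * P2) * C))"
    if "E1 * E2 = E" "F * P1 = C2 * D" "B \<noteq> 0" "H \<noteq> 0" "G \<noteq> 0" "P2 \<noteq> 0" "C \<noteq> 0"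
    for E1 E2 E N1 N2 F G H P1 P2 \<beta> B C C2
  proof -
    have "E1 * (E2 * ((N1 / a) / (D / a)) * ((F / (A * \<alpha>)) / ((G / \<alpha>) * (H / A))) * (P1 / P2) * (\<beta> / \<alpha>) * (N2 / B)) =
        (E1 * E2) * (F * P1) * N1 * N2 * \<beta> / (D * G * H * P2 * \<alpha> * B)"
      using that(3-) ab0 A0 D0 by (simp add: field_simps)
    also have "\<dots> = (C * (N1 * N2)) / (A * \<alpha> * \<alpha> * B) / (H / A) * (E * (\<alpha> * \<beta>) * C2 / ((G * P2) * C))"
      unfolding that(1,2) using that(3-) A0 D0 by (simp add: field_simps)
    finally show ?thesis .
  qed
  have nkk: "n - k - k = n - 2 * k" by simp
  show ?thesis
    unfolding frac geometric_prod[OF x1] geometric_prod[OF x2] P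
    unfolding Qab power_mult_distrib power_divide N
      qQ[of k] D_def[symmetric] a_def[symmetric] b_def[symmetric] pw \<alpha>_def[symmetric] nkk A_def[symmetric]
    by (rule alg) (use X F q0 qQ ab0 in simp_all)
qed

text \<open>The embedding into Laurent series is injective and respects these quotients, because all
  denominators have constant coefficient 1.\<close>

lemma closed_form_eq:
  assumes n: "n > 0" and kn: "2 * k \<le> n"
  defines "q \<equiv> fps_X :: rat fps"
  shows "q ^ (k * (2 * n - 2 * k - 1)) *
    (q ^ k\<^sup>2 * (q_int q n / q_int q (2 * n - 2 * k)) * q_binomial q (n - k) k *
      q_pochhammer (- (q ^ (k + 1))) q (n - 2 * k) * ((1 + q) / (1 - q)) ^ k * ((1 + q ^ n) / (1 + q) ^ n)) =
    poincare n (q ^ 2) * inverse (\<Prod>m = 1..n - 2 * k. \<Sum>t<m. q ^ t) *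
      ((q ^ 2) ^ (\<Sum>t = 1..k. n - t) * (1 - q ^ 2) ^ k * q_product (q ^ 2) (n - k - 1) *
        inverse (q_product (q ^ 2) k) * inverse (q_product (q ^ 2) (n - 1)))"
proof -
  let ?x = "fls_X :: rat fls"
  have q0: "fps_nth q 0 = 0" and Q0: "fps_nth (q ^ 2) 0 = 0" by (simp_all add: q_def fps_nth_power_0)
  have hom: "fps_to_fls q = ?x" by (simp add: q_def)
  have nz: "?x ^ i \<noteq> 1" if "i > 0" for i
  proof
    assume "?x ^ i = 1"
    then have "fps_to_fls (q ^ i) = 1" by (simp add: fps_to_fls_power hom)
    then have "q ^ i = 1" by simp
    then have "fps_nth (q ^ i) 0 = 1" by simp
    then show False using that by (simp add: q0 fps_nth_power_0 zero_power)
  qed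
  have int0: "fps_nth (q_int q m) 0 = 1" if "m > 0" for m
    using that q0 by (simp add: q_int_def fps_divide_unit fps_nth_power_0 zero_power)
  have fact0: "fps_nth (q_fact q m) 0 = 1" for m
    unfolding q_fact_def fps_nth_0_prod by (rule prod.neutral) (use int0 in auto)
  have int_fls: "fps_to_fls (q_int q m) = (1 - ?x ^ m) / (1 - ?x)" for m
    using q0 by (simp add: q_int_def fps_to_fls_divide fps_to_fls_power hom diff_divide_distrib)
  have fact_fls: "fps_to_fls (q_fact q m) = (\<Prod>i = 1..m. (1 - ?x ^ i) / (1 - ?x))" for m
    by (simp add: q_fact_def fps_to_fls_prod int_fls)
  have binom_fls: "fps_to_fls (q_binomial q (n - k) k) = (\<Prod>i = 1..n - k. (1 - ?x ^ i) / (1 - ?x)) /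
      ((\<Prod>i = 1..k. (1 - ?x ^ i) / (1 - ?x)) * (\<Prod>i = 1..n - k - k. (1 - ?x ^ i) / (1 - ?x)))"
    by (simp add: q_binomial_def fps_to_fls_divide fls_times_fps_to_fls fact_fls fact0)
  have poch_fls: "fps_to_fls (q_pochhammer (- (q ^ (k + 1))) q d) = q_pochhammer (- (?x ^ (k + 1))) ?x d" for d
    by (simp add: q_pochhammer_def fps_to_fls_prod fls_times_fps_to_fls fps_to_fls_power hom)
  have prod_fls: "fps_to_fls (q_product (q ^ 2) m) = q_product (?x ^ 2) m" for m
    by (simp add: q_product_def fps_to_fls_prod fps_to_fls_power hom)
  have geom_fls: "fps_to_fls (\<Prod>m = 1..N. \<Sum>t<m. (q ^ e) ^ t) = (\<Prod>m = 1..N. \<Sum>t<m. (?x ^ e) ^ t)" for N e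
    by (simp add: fps_to_fls_prod fps_to_fls_sum fps_to_fls_power hom)
  have geom0: "fps_nth (\<Prod>m = 1..N. \<Sum>t<m. q ^ t) 0 = 1" for N
    unfolding fps_nth_0_prod by (rule prod.neutral) (use geometric_nth_0[OF q0] in auto)
  have "fps_nth (1 + q) 0 = 1" "fps_nth (1 - q) 0 = 1" using q0 by simp_all
  then have "fps_nth ((1 + q) ^ n) 0 = 1" by (simp add: fps_nth_power_0)
  have "2 * n - 2 * k > 0" using kn n by simp
  have "fps_to_fls (q ^ (k * (2 * n - 2 * k - 1)) *
    (q ^ k\<^sup>2 * (q_int q n / q_int q (2 * n - 2 * k)) * q_binomial q (n - k) k *
      q_pochhammer (- (q ^ (k + 1))) q (n - 2 * k) * ((1 + q) / (1 - q)) ^ k * ((1 + q ^ n) / (1 + q) ^ n))) =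
    ?x ^ (k * (2 * n - 2 * k - 1)) *
    (?x ^ k\<^sup>2 * (((1 - ?x ^ n) / (1 - ?x)) / ((1 - ?x ^ (2 * n - 2 * k)) / (1 - ?x))) *
      ((\<Prod>i = 1..n - k. (1 - ?x ^ i) / (1 - ?x)) /
        ((\<Prod>i = 1..k. (1 - ?x ^ i) / (1 - ?x)) * (\<Prod>i = 1..n - k - k. (1 - ?x ^ i) / (1 - ?x)))) *
      q_pochhammer (- (?x ^ (k + 1))) ?x (n - 2 * k) * ((1 + ?x) / (1 - ?x)) ^ k *
      ((1 + ?x ^ n) / (1 + ?x) ^ n))"
    using \<open>fps_nth (1 - q) 0 = 1\<close> \<open>fps_nth ((1 + q) ^ n) 0 = 1\<close> int0[OF \<open>2 * n - 2 * k > 0\<close>]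
    by (simp only: fls_times_fps_to_fls fps_to_fls_power fps_to_fls_divide int_fls binom_fls poch_fls
        fps_to_fls_plus fps_to_fls_minus fps_one_to_fls hom one_neq_zero not_False_eq_True)
  also have "\<dots> = (\<Prod>m = 1..n. \<Sum>t<m. (?x ^ 2) ^ t) / (\<Prod>m = 1..n - 2 * k. \<Sum>t<m. ?x ^ t) *
      ((?x ^ 2) ^ (\<Sum>t = 1..k. n - t) * (1 - ?x ^ 2) ^ k * q_product (?x ^ 2) (n - k - 1) /
        (q_product (?x ^ 2) k * q_product (?x ^ 2) (n - 1)))"
    by (rule closed_form_field[OF n kn nz])
  also have "\<dots> = fps_to_fls (poincare n (q ^ 2) * inverse (\<Prod>m = 1..n - 2 * k. \<Sum>t<m. q ^ t) *
      ((q ^ 2) ^ (\<Sum>t = 1..k. n - t) * (1 - q ^ 2) ^ k * q_product (q ^ 2) (n - k - 1) *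
        inverse (q_product (q ^ 2) k) * inverse (q_product (q ^ 2) (n - 1))))"
  proof -
    have "fps_to_fls (inverse (\<Prod>m = 1..n - 2 * k. \<Sum>t<m. q ^ t)) = inverse (\<Prod>m = 1..n - 2 * k. \<Sum>t<m. ?x ^ t)"
      using geom0[of "n - 2 * k"] geom_fls[where e = 1] by (simp add: fps_to_fls_inverse)
    moreover have "fps_to_fls (inverse (q_product (q ^ 2) m)) = inverse (q_product (?x ^ 2) m)" for m
      using q_product_nth_0[OF Q0, of m] by (simp add: fps_to_fls_inverse prod_fls)
    ultimately show ?thesis
      unfolding poincare_eq[OF n] fls_times_fps_to_fls geom_fls prod_fls
      by (simp add: fps_to_fls_power hom divide_inverse mult_ac)
  qed
  finally show ?thesis by (simp only: fps_to_fls_eq_iff)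
qed

section \<open>Evaluation of the infinite sum\<close>

theorem theorem2p26:
  fixes n k :: nat and q :: "rat fps"
  defines "q \<equiv> fps_X"
  assumes "n > 0" and "k \<le> n div 2"
  shows "Sigma_aff n k =
    q ^ (k\<^sup>2) * (q_int q n / q_int q (2 * n - 2 * k)) * q_binomial q (n - k) k *
    q_pochhammer (- (q ^ (k + 1))) q (n - 2 * k) * ((1 + q) / (1 - q)) ^ k *
    ((1 + q ^ n) / (1 + q) ^ n)"
proof -
  have n: "n > 0" and kn: "2 * k \<le> n" and k_le: "k \<le> n" using assms(2,3) by auto
  define R where "R = q ^ (k\<^sup>2) * (q_int q n / q_int q (2 * n - 2 * k)) * q_binomial q (n - k) k *
    q_pochhammer (- (q ^ (k + 1))) q (n - 2 * k) * ((1 + q) / (1 - q)) ^ k *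
    ((1 + q ^ n) / (1 + q) ^ n)"
  define f where "f w = q ^ cox_length n w * (poincare n (q ^ 2) / twisted_poincare n w q)" for w
  define E where "E = k * (2 * n - 2 * k - 1)"
  define U where "U = poincare n (q ^ 2) * inverse (\<Prod>m = 1..n - 2 * k. \<Sum>t<m. q ^ t)"
  define C where "C = (q ^ 2) ^ (\<Sum>t = 1..k. n - t) * (1 - q ^ 2) ^ k * q_product (q ^ 2) (n - k - 1) *
    inverse (q_product (q ^ 2) k) * inverse (q_product (q ^ 2) (n - 1))"
  have closed: "q ^ E * R = U * C"
    unfolding q_def E_def R_def U_def C_def by (rule closed_form_eq[OF n kn])
  let ?S = "minimal_involutions n k"
  let ?SM = "\<lambda>M. {w \<in> ?S. \<forall>i \<in> {1..int n}. profile n w i \<le> int M}"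
  have "(f has_sum R) ?S"
    unfolding has_sum_def
  \<comment> \<open>Convergence is coefficientwise: each coefficient of the finite partial sums must
    become constant.\<close>
  proof (rule tendsto_fpsI)
    fix d
    \<comment> \<open>The agreement modulo q^M concerns series multiplied by q^E; after cancelling
      q^E it still covers the coefficient of degree d.\<close>
    define M where "M = E + Suc d"
    have bij: "bij_betw (profile n) (?SM M) (level_profiles n k M)" by (rule profile_bij[OF n k_le])
    have fin: "finite (?SM M)" using bij_betw_finite[OF bij] finite_level_profiles by blast
    have "q ^ E * f w = U * profile_weight (q ^ 2) block_weight n k (profile n w)" if w: "w \<in> ?SM M" for w
    proof -
      have "minimal_involution n w" using w by (simp add: minimal_involutions_def)
      moreover have "profile n w \<in> level_profiles n k M" using bij_betw_apply[OF bij w] .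
      ultimately show ?thesis
        unfolding q_def E_def f_def U_def by (rule minimal_involution_weight[OF _ kn])
    qed
    then have "q ^ E * (\<Sum>w\<in>?SM M. f w) = (\<Sum>w\<in>?SM M. U * profile_weight (q ^ 2) block_weight n k (profile n w))"
      unfolding sum_distrib_left by (rule sum.cong[OF refl])
    also have "\<dots> = U * (\<Sum>w\<in>?SM M. profile_weight (q ^ 2) block_weight n k (profile n w))"
      by (simp only: sum_distrib_left)
    also have "(\<Sum>w\<in>?SM M. profile_weight (q ^ 2) block_weight n k (profile n w)) =
        (\<Sum>c\<in>level_profiles n k M. profile_weight (q ^ 2) block_weight n k c)"
      by (rule sum.reindex_bij_betw[OF bij])
    finally have "q ^ E * ((\<Sum>w\<in>?SM M. f w) - R) =
        U * ((\<Sum>c\<in>level_profiles n k M. profile_weight (q ^ 2) block_weight n k c) - C)"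
      using closed by (simp only: right_diff_distrib)
    moreover have "q ^ M dvd (\<Sum>c\<in>level_profiles n k M. profile_weight (q ^ 2) block_weight n k c) - C"
      unfolding q_def C_def by (rule closed_form_approximation[OF n kn])
    ultimately have "q ^ E * q ^ Suc d dvd q ^ E * ((\<Sum>w\<in>?SM M. f w) - R)"
      unfolding M_def power_add[symmetric] by simp
    then have main: "q ^ Suc d dvd (\<Sum>w\<in>?SM M. f w) - R" by (simp add: q_def)
    \<comment> \<open>Beyond the bound some level exceeds M, hence so does the length, and the
      summand does not reach degree d.\<close>
    have tail: "q ^ Suc d dvd f w" if w: "w \<in> ?S - ?SM M" for w
    proof -
      interpret minimal_involution n w using w by (simp add: minimal_involutions_def)
      obtain i where i: "i \<in> {1..int n}" "int M < profile n w i" using w by force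
      then have "int M < lev i" using lev_eq_profile by simp
      then have "M < cox_length n w" using lev_le_cox_length[OF i(1)] by linarith
      then have "q ^ Suc d dvd q ^ cox_length n w" by (intro le_imp_power_dvd) (simp add: M_def)
      then show ?thesis unfolding f_def by (rule dvd_mult2)
    qed
    show "\<forall>\<^sub>F F in finite_subsets_at_top ?S. fps_nth (sum f F) d = fps_nth R d"
      unfolding eventually_finite_subsets_at_top
    proof (intro exI[of _ "?SM M"] conjI allI impI)
      fix F assume F: "finite F \<and> ?SM M \<subseteq> F \<and> F \<subseteq> ?S"
      then have "sum f F = sum f (F - ?SM M) + sum f (?SM M)" by (intro sum.subset_diff) blast+
      moreover have "q ^ Suc d dvd sum f (F - ?SM M)" by (rule dvd_sum) (use tail F in blast)
      ultimately have "q ^ Suc d dvd sum f F - R" using main by (simp add: dvd_add add_diff_eq[symmetric])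
      then obtain g where "sum f F - R = q ^ Suc d * g" by (rule dvdE)
      then have "fps_nth (sum f F - R) d = 0" by (simp only: q_def fps_X_power_mult_nth) simp
      then show "fps_nth (sum f F) d = fps_nth R d" by simp
    qed (use fin in blast)+
  qed
  moreover have "{w. w \<in> involutions n \<and> (\<forall>s \<in> finite_gens n. cox_length n (w \<circ> s) > cox_length n w) \<and>
      abs_length n w = k} = ?S"
    unfolding minimal_involutions_def minimal_involution_iff[OF n] by blast
  ultimately have "Sigma_aff n k = R"
    unfolding Sigma_aff_def f_def q_def by (simp only: infsumI)
  then show ?thesis unfolding R_def .
qed

end
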